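(* Let $R$ be an archimedean non-discrete valuation domain and let $L=L_v$ be the induced non-discrete length function on $\mathrm{Mod}(R)$. There exists a unique length function $L_X:\mathrm{lFin}_L[X]\to \mathbb{R}_{\geq 0}\cup\{\infty\}$ such that $$L_X(B(N))=L(N)\quad\text{for all } R\text{-modules } N \text{ with } L(N)<\infty.$$ This function coincides with the restriction of the algebraic entropy $\mathrm{ent}_L$ to $\mathrm{lFin}_L[X]$.
   Context: For a ring $R$, a function $L:\mathrm{Mod}(R)\to \mathbb{R}_{\geq 0}\cup\{\infty\}$ is a length function if: $L(0)=0$ and $L(M)=L(M')$ whenever $M\cong M'$; $L(M)=L(M')+L(M'')$ for every short exact sequence $0\to M'\to M\to M''\to 0$ (additive); and $L(M)=\sup\{L(F): F \text{ a finitely generated submodule of } M\}$ for all $M$ (upper continuous). A module $N$ is $L$-finite if $L(N)<\infty$; $\mathrm{Fin}_L(M)$ is the set of $L$-finite submodules of $M$. A module is locally $L$-finite if all its finitely generated submodules are $L$-finite. A non-discrete archimedean valuation domain $R$ is a rank-one valuation domain whose value group is (isomorphic to) a dense additive subgroup of $\mathbb{R}$; let $v:Q\to\mathbb{R}\cup\{\infty\}$ be the valuation on its field of quotients $Q$. The length function $L_v:\mathrm{Mod}(R)\to\mathbb{R}_{\ge 0}\cup\{\infty\}$ is the unique length function with $L_v(R/I)=\inf\{v(a):a\in I\}$ for every non-zero ideal $I$ of $R$, and $L_v(R)=\infty$ (existence and uniqueness are due to Northcott and Reufel). $M_\phi$, with $M$ an $R$-module and $\phi\in\mathrm{End}_R(M)$,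 denotes the $R[X]$-module with underlying $R$-module $M$ on which $X$ acts as $\phi$. $\mathrm{lFin}_L[X]$ is the full subcategory of $\mathrm{Mod}(R[X])$ consisting of the $M_\phi$ with $M$ locally $L$-finite as an $R$-module. A length function on $\mathrm{lFin}_L[X]$ is a function to $\mathbb{R}_{\ge 0}\cup\{\infty\}$ that is isomorphism invariant and zero on $0$, additive on short exact sequences of $R[X]$-modules in $\mathrm{lFin}_L[X]$, and upper continuous with respect to finitely generated $R[X]$-submodules. The Bernoulli functor $B:\mathrm{Mod}(R)\to\mathrm{Mod}(R[X])$ is $B(M)=(M^{(\mathbb{N})})_\beta$, where $\beta(x_0,x_1,x_2,\dots)=(0,x_0,x_1,\dots)$ is the right Bernoulli shift; it is isomorphic to $-\otimes_R R[X]$. For $N\in\mathrm{Fin}_L(M)$ and $n\geq 1$ let $T_n(\phi,N)=\sum_{i=0}^{n-1}\phi^i(N)$ and $\mathrm{ent}_L(\phi,N)=\lim_{n\to\infty}L(T_n(\phi,N))/n$ (the limit exists and is finite). The algebraic $L$-entropy is $\mathrm{ent}_L(M_\phi)=\sup\{\mathrm{ent}_L(\phi,N): N\in\mathrm{Fin}_L(M)\}$. *)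

theory Defs
  imports
    "HOL-Library.Extended_Nonnegative_Real"
    "HOL-Library.Equipollence"
    "HOL-Algebra.QuotRing"
    "HOL-Algebra.UnivPoly"
begin

section \<open>Non-discrete archimedean valuation domains\<close>

text \<open>
  \<open>R\<close> is the valuation ring of a valuation \<open>v\<close> on \<open>Q\<close> whose value group is a dense subgroup of
  the reals. That \<open>Q\<close> is the field of quotients of \<open>R\<close> is then automatic, see \<open>quotient_field\<close>
  below.
\<close>

locale nondiscrete_archimedean_valuation_domain =
  field Q for R :: "'r ring" and Q :: "'r ring" and v :: "'r \<Rightarrow> ereal" +
  assumes R_eq: "R = Q\<lparr>carrier := {a \<in> carrier Q. 0 \<le> v a}\<rparr>"
    and v_not_MInfty: "a \<in> carrier Q \<Longrightarrow> v a \<noteq> - \<infinity>"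
    and v_infinity_iff: "a \<in> carrier Q \<Longrightarrow> v a = \<infinity> \<longleftrightarrow> a = \<zero>\<^bsub>Q\<^esub>"
    and v_mult: "\<lbrakk>a \<in> carrier Q; b \<in> carrier Q\<rbrakk> \<Longrightarrow> v (a \<otimes>\<^bsub>Q\<^esub> b) = v a + v b"
    and v_add: "\<lbrakk>a \<in> carrier Q; b \<in> carrier Q\<rbrakk> \<Longrightarrow> min (v a) (v b) \<le> v (a \<oplus>\<^bsub>Q\<^esub> b)"
    and value_group_dense:
      "s < t \<Longrightarrow> \<exists>a \<in> carrier Q. a \<noteq> \<zero>\<^bsub>Q\<^esub> \<and> ereal s < v a \<and> v a < ereal t"
begin

lemma v_one: "v \<one>\<^bsub>Q\<^esub> = 0"
  using v_mult[of "\<one>\<^bsub>Q\<^esub>" "\<one>\<^bsub>Q\<^esub>"] v_not_MInfty[of "\<one>\<^bsub>Q\<^esub>"] v_infinity_iff[of "\<one>\<^bsub>Q\<^esub>"]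
  by (cases "v \<one>\<^bsub>Q\<^esub>") auto

lemma valuation_ring:
  assumes "a \<in> carrier Q" "a \<noteq> \<zero>\<^bsub>Q\<^esub>"
  shows "a \<in> carrier R \<or> inv\<^bsub>Q\<^esub> a \<in> carrier R"
proof -
  have u: "a \<in> Units Q" using assms by (simp add: field_Units)
  have "v a + v (inv\<^bsub>Q\<^esub> a) = 0"
    using u assms(1) v_mult[of a "inv\<^bsub>Q\<^esub> a"] v_one by simp
  then have "0 \<le> v a \<or> 0 \<le> v (inv\<^bsub>Q\<^esub> a)"
    by (cases "v a"; cases "v (inv\<^bsub>Q\<^esub> a)") auto
  then show ?thesis using assms u by (simp add: R_eq)
qed

lemma quotient_field:
  assumes "a \<in> carrier Q"
  shows "\<exists>b \<in> carrier R. \<exists>c \<in> carrier R. c \<noteq> \<zero>\<^bsub>Q\<^esub> \<and> a = b \<otimes>\<^bsub>Q\<^esub> inv\<^bsub>Q\<^esub> c"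
proof -
  have one: "\<one>\<^bsub>Q\<^esub> \<in> carrier R" by (simp add: R_eq v_one)
  show ?thesis
  proof (cases "a \<in> carrier R")
    case True
    then show ?thesis using one assms by (intro bexI[of _ a] bexI[of _ "\<one>\<^bsub>Q\<^esub>"]) auto
  next
    case False
    have nz: "a \<noteq> \<zero>\<^bsub>Q\<^esub>"
      using False v_infinity_iff[of "\<zero>\<^bsub>Q\<^esub>"] by (auto simp: R_eq)
    then have u: "a \<in> Units Q" using assms by (simp add: field_Units)
    have "inv\<^bsub>Q\<^esub> a \<in> carrier R" using valuation_ring[OF assms nz] False by simp
    moreover have "inv\<^bsub>Q\<^esub> a \<noteq> \<zero>\<^bsub>Q\<^esub>" using u Units_inv_Units field_Units by auto
    ultimately show ?thesis using one u assms
      by (intro bexI[of _ "\<one>\<^bsub>Q\<^esub>"] bexI[of _ "inv\<^bsub>Q\<^esub> a"]) auto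
  qed
qed

end


section \<open>Modules\<close>

text \<open>
  Modules are records \<open>M\<close> satisfying \<open>module R M\<close>. Their \<open>mult\<close> and \<open>one\<close> components carry no
  meaning. A submodule is a subset of the carrier; as a module it is \<open>M\<lparr>carrier := N\<rparr>\<close>.
\<close>

definition mod_hom ::
    "('s, 'z) ring_scheme \<Rightarrow> ('s, 'm) module \<Rightarrow> ('s, 'n) module \<Rightarrow> ('m \<Rightarrow> 'n) set" where
  "mod_hom S M N = {f \<in> carrier M \<rightarrow> carrier N.
     (\<forall>x\<in>carrier M. \<forall>y\<in>carrier M. f (x \<oplus>\<^bsub>M\<^esub> y) = f x \<oplus>\<^bsub>N\<^esub> f y) \<and>
     (\<forall>a\<in>carrier S. \<forall>x\<in>carrier M. f (a \<odot>\<^bsub>M\<^esub> x) = a \<odot>\<^bsub>N\<^esub> f x)}"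

definition mod_isomorphic ::
    "('s, 'z) ring_scheme \<Rightarrow> ('s, 'm) module \<Rightarrow> ('s, 'n) module \<Rightarrow> bool" where
  "mod_isomorphic S M N \<longleftrightarrow> (\<exists>f \<in> mod_hom S M N. bij_betw f (carrier M) (carrier N))"

definition mod_short_exact ::
    "('s, 'z) ring_scheme \<Rightarrow> ('s, 'a) module \<Rightarrow> ('a \<Rightarrow> 'b) \<Rightarrow> ('s, 'b) module \<Rightarrow> ('b \<Rightarrow> 'c) \<Rightarrow>
     ('s, 'c) module \<Rightarrow> bool" where
  "mod_short_exact S A f B g C \<longleftrightarrow>
     f \<in> mod_hom S A B \<and> g \<in> mod_hom S B C \<and>
     inj_on f (carrier A) \<and>
     f ` carrier A = {x \<in> carrier B. g x = \<zero>\<^bsub>C\<^esub>} \<and>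
     g ` carrier B = carrier C"

definition mod_span :: "('s, 'z) ring_scheme \<Rightarrow> ('s, 'm) module \<Rightarrow> 'm set \<Rightarrow> 'm set" where
  "mod_span S M E = \<Inter>{N. submodule N S M \<and> E \<subseteq> N}"

definition fg_submodules :: "('s, 'z) ring_scheme \<Rightarrow> ('s, 'm) module \<Rightarrow> 'm set set" where
  "fg_submodules S M =
     {N. submodule N S M \<and> (\<exists>E. finite E \<and> E \<subseteq> carrier M \<and> N = mod_span S M E)}"

definition self_module :: "('s, 'z) ring_scheme \<Rightarrow> ('s, 's) module" where
  "self_module S =
     \<lparr>carrier = carrier S, mult = mult S, one = \<one>\<^bsub>S\<^esub>, zero = \<zero>\<^bsub>S\<^esub>, add = add S, smult = mult S\<rparr>"

definition quot_module :: "('s, 'z) ring_scheme \<Rightarrow> 's set \<Rightarrow> ('s, 's set) module" where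
  "quot_module S I =
     \<lparr>carrier = carrier (S Quot I), mult = mult (S Quot I), one = \<one>\<^bsub>S Quot I\<^esub>,
      zero = \<zero>\<^bsub>S Quot I\<^esub>, add = add (S Quot I),
      smult = (\<lambda>a A. (I +>\<^bsub>S\<^esub> a) \<otimes>\<^bsub>S Quot I\<^esub> A)\<rparr>"


section \<open>Length functions\<close>

text \<open>
  The class of all modules is represented by the modules whose carrier is a subset of a fixed type
  \<open>'m\<close>, i.e. up to isomorphism by all modules of cardinality at most that of \<open>'m\<close>. If
  \<open>R\<close> is infinite and \<open>carrier R \<lesssim> (UNIV :: 'm set)\<close>, then up to isomorphism these are closed under
  submodules, quotients, extensions and \<open>B\<close>, and they contain all finitely generated modules over
  \<open>R\<close> and \<open>R[X]\<close>. A full subcategory is given by the set \<open>C\<close> of its objects.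
\<close>

definition length_function ::
    "('s, 'z) ring_scheme \<Rightarrow> ('s, 'm) module set \<Rightarrow> (('s, 'm) module \<Rightarrow> ennreal) \<Rightarrow> bool" where
  "length_function S C len \<longleftrightarrow>
     (\<forall>M\<in>C. carrier M = {\<zero>\<^bsub>M\<^esub>} \<longrightarrow> len M = 0) \<and>
     (\<forall>M\<in>C. \<forall>N\<in>C. mod_isomorphic S M N \<longrightarrow> len M = len N) \<and>
     (\<forall>M'\<in>C. \<forall>M\<in>C. \<forall>M''\<in>C. \<forall>f g. mod_short_exact S M' f M g M'' \<longrightarrow> len M = len M' + len M'') \<and>
     (\<forall>M\<in>C. len M = (SUP F\<in>fg_submodules S M. len (M\<lparr>carrier := F\<rparr>)))"

text \<open>
  \<open>induced_length R v L\<close> says that \<open>L\<close> is the length function \<open>L\<^sub>v\<close> on \<open>Mod(R)\<close>, which Northcott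
  and Reufel showed to exist and to be unique. Since the carriers of \<open>R/I\<close> and \<open>R\<close> need not be
  subsets of \<open>'m\<close>, the prescribed values are imposed on all their isomorphic copies that are.
\<close>

definition induced_length ::
    "'r ring \<Rightarrow> ('r \<Rightarrow> ereal) \<Rightarrow> (('r, 'm) module \<Rightarrow> ennreal) \<Rightarrow> bool" where
  "induced_length R v L \<longleftrightarrow>
     length_function R {M. module R M} L \<and>
     (\<forall>I M. ideal I R \<and> I \<noteq> {\<zero>\<^bsub>R\<^esub>} \<and> module R M \<and> mod_isomorphic R M (quot_module R I) \<longrightarrow>
        L M = e2ennreal (INF a\<in>I. v a)) \<and>
     (\<forall>M. module R M \<and> mod_isomorphic R M (self_module R) \<longrightarrow> L M = \<infinity>)"

definition Fin_sub ::
    "'r ring \<Rightarrow> (('r, 'm) module \<Rightarrow> ennreal) \<Rightarrow> ('r, 'm) module \<Rightarrow> 'm set set" where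
  "Fin_sub R L M = {N. submodule N R M \<and> L (M\<lparr>carrier := N\<rparr>) < \<infinity>}"

definition locally_finite ::
    "'r ring \<Rightarrow> (('r, 'm) module \<Rightarrow> ennreal) \<Rightarrow> ('r, 'm) module \<Rightarrow> bool" where
  "locally_finite R L M \<longleftrightarrow> fg_submodules R M \<subseteq> Fin_sub R L M"


section \<open>Modules over the polynomial ring\<close>

text \<open>\<open>M\<^sub>\<phi>\<close>: a polynomial \<open>p\<close> acts on \<open>x\<close> as the sum of the \<open>p\<^sub>i \<phi>\<^sup>i(x)\<close>.\<close>

definition poly_module :: "'r ring \<Rightarrow> ('r, 'm) module \<Rightarrow> ('m \<Rightarrow> 'm) \<Rightarrow> (nat \<Rightarrow> 'r, 'm) module" where
  "poly_module R M \<phi> =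
     \<lparr>carrier = carrier M, mult = mult M, one = \<one>\<^bsub>M\<^esub>, zero = \<zero>\<^bsub>M\<^esub>, add = add M,
      smult = (\<lambda>p x. \<Oplus>\<^bsub>M\<^esub>i\<in>{i. coeff (UP R) p i \<noteq> \<zero>\<^bsub>R\<^esub>}. coeff (UP R) p i \<odot>\<^bsub>M\<^esub> (\<phi> ^^ i) x)\<rparr>"

text \<open>
  Conversely, every \<open>R[X]\<close>-module \<open>P\<close> is \<open>M\<^sub>\<phi>\<close> for its underlying \<open>R\<close>-module \<open>M\<close> and the action
  \<open>\<phi>\<close> of \<open>X\<close> on it.
\<close>

definition underlying :: "'r ring \<Rightarrow> (nat \<Rightarrow> 'r, 'm) module \<Rightarrow> ('r, 'm) module" where
  "underlying R P =
     \<lparr>carrier = carrier P, mult = mult P, one = \<one>\<^bsub>P\<^esub>, zero = \<zero>\<^bsub>P\<^esub>, add = add P,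
      smult = (\<lambda>a x. monom (UP R) a 0 \<odot>\<^bsub>P\<^esub> x)\<rparr>"

definition X_action :: "'r ring \<Rightarrow> (nat \<Rightarrow> 'r, 'm) module \<Rightarrow> 'm \<Rightarrow> 'm" where
  "X_action R P x = monom (UP R) \<one>\<^bsub>R\<^esub> 1 \<odot>\<^bsub>P\<^esub> x"

definition lFin_X ::
    "'r ring \<Rightarrow> (('r, 'm) module \<Rightarrow> ennreal) \<Rightarrow> (nat \<Rightarrow> 'r, 'm) module set" where
  "lFin_X R L = {P. module (UP R) P \<and> locally_finite R L (underlying R P)}"

definition direct_power :: "('r, 'm) module \<Rightarrow> ('r, nat \<Rightarrow> 'm) module" where
  "direct_power M =
     \<lparr>carrier = {x. (\<forall>i. x i \<in> carrier M) \<and> finite {i. x i \<noteq> \<zero>\<^bsub>M\<^esub>}},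
      mult = (\<lambda>x y i. x i \<otimes>\<^bsub>M\<^esub> y i), one = (\<lambda>i. \<one>\<^bsub>M\<^esub>),
      zero = (\<lambda>i. \<zero>\<^bsub>M\<^esub>), add = (\<lambda>x y i. x i \<oplus>\<^bsub>M\<^esub> y i),
      smult = (\<lambda>a x i. a \<odot>\<^bsub>M\<^esub> x i)\<rparr>"

definition right_shift :: "('r, 'm) module \<Rightarrow> (nat \<Rightarrow> 'm) \<Rightarrow> nat \<Rightarrow> 'm" where
  "right_shift M x i = (case i of 0 \<Rightarrow> \<zero>\<^bsub>M\<^esub> | Suc j \<Rightarrow> x j)"

definition bernoulli :: "'r ring \<Rightarrow> ('r, 'm) module \<Rightarrow> (nat \<Rightarrow> 'r, nat \<Rightarrow> 'm) module" where
  "bernoulli R M = poly_module R (direct_power M) (right_shift M)"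


section \<open>Algebraic entropy\<close>

definition trajectory :: "('r, 'm) module \<Rightarrow> ('m \<Rightarrow> 'm) \<Rightarrow> 'm set \<Rightarrow> nat \<Rightarrow> 'm set" where
  "trajectory M \<phi> N n = {\<Oplus>\<^bsub>M\<^esub>i\<in>{..<n}. (\<phi> ^^ i) (y i) | y. y \<in> {..<n} \<rightarrow> N}"

definition ent_sub ::
    "(('r, 'm) module \<Rightarrow> ennreal) \<Rightarrow> ('r, 'm) module \<Rightarrow> ('m \<Rightarrow> 'm) \<Rightarrow> 'm set \<Rightarrow> ennreal" where
  "ent_sub L M \<phi> N = lim (\<lambda>n. L (M\<lparr>carrier := trajectory M \<phi> N n\<rparr>) / of_nat n)"

definition ent ::
    "'r ring \<Rightarrow> (('r, 'm) module \<Rightarrow> ennreal) \<Rightarrow> ('r, 'm) module \<Rightarrow> ('m \<Rightarrow> 'm) \<Rightarrow> ennreal" where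
  "ent R L M \<phi> = (SUP N\<in>Fin_sub R L M. ent_sub L M \<phi> N)"

definition ent_X ::
    "'r ring \<Rightarrow> (('r, 'm) module \<Rightarrow> ennreal) \<Rightarrow> (nat \<Rightarrow> 'r, 'm) module \<Rightarrow> ennreal" where
  "ent_X R L P = ent R L (underlying R P) (X_action R P)"


section \<open>The normalisation by the Bernoulli functor\<close>

text \<open>
  The value on \<open>B(N)\<close> is prescribed, as for \<open>induced_length\<close>, on the isomorphic copies of \<open>B(N)\<close>
  whose carrier is a subset of \<open>'m\<close>.
\<close>

definition bernoulli_normalised ::
    "'r ring \<Rightarrow> (('r, 'm) module \<Rightarrow> ennreal) \<Rightarrow> ((nat \<Rightarrow> 'r, 'm) module \<Rightarrow> ennreal) \<Rightarrow> bool" where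
  "bernoulli_normalised R L LX \<longleftrightarrow>
     (\<forall>N P. module R N \<and> L N < \<infinity> \<and> module (UP R) P \<and> mod_isomorphic (UP R) P (bernoulli R N) \<longrightarrow>
        LX P = L N)"

end

(*
  Lengths of submodules of a fixed module form a modular function, so for an endomorphism phi and a
  submodule N of finite length the increments L(T_{n+1}) - L(T_n) of the trajectory T_n decrease; their
  limit e(N) is the entropy of N. The entropy is additive: once the increments of the image
  of N in a quotient have almost stabilised, at m say, the trajectory of N grows only as fast as its
  image plus the trajectory of the part of T_{m+1}(N) inside the submodule.

  Conversely, let P be generated over R[X] by a finitely generated R-submodule N. The cokernel of
  the injective map X - B(phi) on B(P) is P, and already B(N) maps onto P. The kernel of B(N) -> P is
  the increasing union of the intersections of B(N) with (X - B(phi))(B(T_n)), whose lengths are forced by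
  modularity and by the values on B(N), B(T_n) and B(T_{n+1}). So every normalised length function
  takes the value e(N) on P. Since R is infinite, so is the type of elements, which therefore has room
  for a copy of B(P).
*)
theory Submission
  imports Defs "HOL-Algebra.Free_Abelian_Groups" "HOL-Algebra.Subrings"
begin

section \<open>Submodules and homomorphisms\<close>

text \<open>The values of \<open>L\<close> are dense. So the decreasing increments of a trajectory
  may never become stationary, and a submodule of finite length may contain no finitely generated
  submodule of the same length. Upper estimates of entropy are therefore made up to an error e. They
  rest on one principle: a map sends a quotient B/A onto the quotient of the images, whose length
  can only be smaller. Errors linear in n survive the division by n, bounded ones vanish.

  For uniqueness, P may have infinite length over R, and then the normalisation says nothing about
  B(P). The B(T_n) have finite length, which makes cancellation in \<open>ennreal\<close>
  legitimate, and upper continuity passes to their union. Upper continuity also explains why it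
  suffices to treat P generated by a finitely generated R-submodule: an R[X]-span is the union of
  the trajectories of the R-span of the same generators.\<close>

abbreviation res :: "('s, 'm) module \<Rightarrow> 'm set \<Rightarrow> ('s, 'm) module" where
  "res M A \<equiv> M\<lparr>carrier := A\<rparr>"

lemma (in module) submodule_iff:
  "submodule H R M \<longleftrightarrow> H \<subseteq> carrier M \<and> \<zero>\<^bsub>M\<^esub> \<in> H \<and> (\<forall>x\<in>H. \<forall>y\<in>H. x \<oplus>\<^bsub>M\<^esub> y \<in> H) \<and>
     (\<forall>a\<in>carrier R. \<forall>x\<in>H. a \<odot>\<^bsub>M\<^esub> x \<in> H)" (is "_ \<longleftrightarrow> ?c")
proof
  assume "submodule H R M"
  then show ?c
    using submoduleE[of H] subgroup.one_closed[OF submodule.axioms(1), of H R M] by auto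
next
  assume c: ?c
  have "\<ominus>\<^bsub>M\<^esub> x \<in> H" if "x \<in> H" for x
  proof -
    have "\<ominus>\<^bsub>M\<^esub> x = (\<ominus> \<one>) \<odot>\<^bsub>M\<^esub> x" using that c smult_l_minus[of \<one> x] by auto
    then show ?thesis using that c by auto
  qed
  then show "submodule H R M" using c by (intro submoduleI) auto
qed

lemma module_res: "module S M \<Longrightarrow> submodule A S M \<Longrightarrow> module S (res M A)"
  by (simp add: submodule.submodule_is_module)

lemma submodule_res_iff:
  assumes "module S M" "submodule A S M"
  shows "submodule B S (res M A) \<longleftrightarrow> submodule B S M \<and> B \<subseteq> A"
proof -
  interpret M: module S M by fact
  interpret A: module S "res M A" by (rule module_res[OF assms])
  have "A \<subseteq> carrier M" using assms(2) by (simp add: M.submodule_iff)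
  then show ?thesis unfolding M.submodule_iff A.submodule_iff by auto
qed

lemma submodule_carrier: "module S M \<Longrightarrow> submodule (carrier M) S M"
  by (rule module.carrier_is_submodule)

lemma submodule_subset: "submodule A S M \<Longrightarrow> A \<subseteq> carrier M"
  by (simp add: submodule_def subgroup_def)

lemma submodule_zero: "module S M \<Longrightarrow> submodule A S M \<Longrightarrow> \<zero>\<^bsub>M\<^esub> \<in> A"
  by (simp add: module.submodule_iff)

lemma submodule_Int:
  "module S M \<Longrightarrow> submodule A S M \<Longrightarrow> submodule B S M \<Longrightarrow> submodule (A \<inter> B) S M"
  by (auto simp: module.submodule_iff)

lemma submodule_zero_set: "module S M \<Longrightarrow> submodule {\<zero>\<^bsub>M\<^esub>} S M"
proof -
  assume "module S M"
  then interpret module S M .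
  show ?thesis by (simp add: submodule_iff)
qed

lemma submodule_UN_chain:
  assumes "module S M" "\<And>n::nat. submodule (A n) S M" "\<And>n. A n \<subseteq> A (Suc n)"
  shows "submodule (\<Union>n. A n) S M"
proof -
  interpret M: module S M by fact
  have mono: "m \<le> n \<Longrightarrow> A m \<subseteq> A n" for m n using lift_Suc_mono_le[of A] assms(3) by blast
  have A: "A n \<subseteq> carrier M" "\<zero>\<^bsub>M\<^esub> \<in> A n" "\<forall>x\<in>A n. \<forall>y\<in>A n. x \<oplus>\<^bsub>M\<^esub> y \<in> A n"
    "\<forall>a\<in>carrier S. \<forall>x\<in>A n. a \<odot>\<^bsub>M\<^esub> x \<in> A n" for n
    using assms(2)[of n] by (auto simp: M.submodule_iff)
  have "x \<oplus>\<^bsub>M\<^esub> y \<in> A (max m n)" if "x \<in> A m" "y \<in> A n" for x y m n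
    using that A(3)[of "max m n"] mono[of m "max m n"] mono[of n "max m n"] by auto
  moreover have "a \<odot>\<^bsub>M\<^esub> x \<in> A n" if "a \<in> carrier S" "x \<in> A n" for a x n
    using that A(4) by auto
  ultimately show ?thesis unfolding M.submodule_iff using A(1,2)
    by (simp add: UN_subset_iff) meson
qed

section \<open>Sums of submodules\<close>

definition msum :: "('s, 'm) module \<Rightarrow> 'm set \<Rightarrow> 'm set \<Rightarrow> 'm set" where
  "msum M A B = {a \<oplus>\<^bsub>M\<^esub> b | a b. a \<in> A \<and> b \<in> B}"

lemma msumI: "a \<in> A \<Longrightarrow> b \<in> B \<Longrightarrow> a \<oplus>\<^bsub>M\<^esub> b \<in> msum M A B"
  by (auto simp: msum_def)

lemma submodule_msum:
  assumes "module S M" "submodule A S M" "submodule B S M"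
  shows "submodule (msum M A B) S M"
proof -
  interpret M: module S M by fact
  have A: "A \<subseteq> carrier M" "\<zero>\<^bsub>M\<^esub> \<in> A" "\<forall>x\<in>A. \<forall>y\<in>A. x \<oplus>\<^bsub>M\<^esub> y \<in> A"
    "\<forall>a\<in>carrier S. \<forall>x\<in>A. a \<odot>\<^bsub>M\<^esub> x \<in> A"
    and B: "B \<subseteq> carrier M" "\<zero>\<^bsub>M\<^esub> \<in> B" "\<forall>x\<in>B. \<forall>y\<in>B. x \<oplus>\<^bsub>M\<^esub> y \<in> B"
    "\<forall>a\<in>carrier S. \<forall>x\<in>B. a \<odot>\<^bsub>M\<^esub> x \<in> B"
    using assms(2,3) by (auto simp: M.submodule_iff)
  show ?thesis unfolding M.submodule_iff
  proof (intro conjI ballI)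
    show "msum M A B \<subseteq> carrier M" using A B by (auto simp: msum_def)
    show "\<zero>\<^bsub>M\<^esub> \<in> msum M A B" using msumI[OF A(2) B(2), of M] by simp
  next
    fix x y assume "x \<in> msum M A B" "y \<in> msum M A B"
    then obtain a b a' b' where x: "x = a \<oplus>\<^bsub>M\<^esub> b" "y = a' \<oplus>\<^bsub>M\<^esub> b'"
      and ab: "a \<in> A" "b \<in> B" "a' \<in> A" "b' \<in> B"
      by (auto simp: msum_def)
    have "x \<oplus>\<^bsub>M\<^esub> y = (a \<oplus>\<^bsub>M\<^esub> a') \<oplus>\<^bsub>M\<^esub> (b \<oplus>\<^bsub>M\<^esub> b')"
      using x ab A(1) B(1) by (simp add: M.add.m_ac subset_iff)
    then show "x \<oplus>\<^bsub>M\<^esub> y \<in> msum M A B" using A(3) B(3) ab by (auto intro: msumI)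
  next
    fix s x assume s: "s \<in> carrier S" and "x \<in> msum M A B"
    then obtain a b where x: "x = a \<oplus>\<^bsub>M\<^esub> b" "a \<in> A" "b \<in> B" by (auto simp: msum_def)
    then have "s \<odot>\<^bsub>M\<^esub> x = (s \<odot>\<^bsub>M\<^esub> a) \<oplus>\<^bsub>M\<^esub> (s \<odot>\<^bsub>M\<^esub> b)"
      using s A(1) B(1) by (simp add: M.smult_r_distr subset_iff)
    then show "s \<odot>\<^bsub>M\<^esub> x \<in> msum M A B" using A(4) B(4) x s by (auto intro: msumI)
  qed
qed

lemma
  assumes "module S M" "submodule A S M" "submodule B S M"
  shows msum_upper1: "A \<subseteq> msum M A B" and msum_upper2: "B \<subseteq> msum M A B"
proof -
  interpret M: module S M by fact
  have A: "A \<subseteq> carrier M" "\<zero>\<^bsub>M\<^esub> \<in> A" and B: "B \<subseteq> carrier M" "\<zero>\<^bsub>M\<^esub> \<in> B"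
    using assms(2,3) by (auto simp: M.submodule_iff)
  show "A \<subseteq> msum M A B"
  proof
    fix a assume "a \<in> A"
    then show "a \<in> msum M A B" using msumI[of a A "\<zero>\<^bsub>M\<^esub>" B M] A B by auto
  qed
  show "B \<subseteq> msum M A B"
  proof
    fix b assume "b \<in> B"
    then show "b \<in> msum M A B" using msumI[of "\<zero>\<^bsub>M\<^esub>" A b B M] A B by auto
  qed
qed

lemma msum_least:
  assumes "module S M" "submodule C S M" "A \<subseteq> C" "B \<subseteq> C"
  shows "msum M A B \<subseteq> C"
  using assms by (auto simp: msum_def module.submodule_iff subset_iff)

lemma msum_mono: "A \<subseteq> A' \<Longrightarrow> B \<subseteq> B' \<Longrightarrow> msum M A B \<subseteq> msum M A' B'"
  by (auto simp: msum_def)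

section \<open>Homomorphisms, images and kernels\<close>

lemma mod_homD:
  assumes "f \<in> mod_hom S M N"
  shows "x \<in> carrier M \<Longrightarrow> f x \<in> carrier N"
    and "x \<in> carrier M \<Longrightarrow> y \<in> carrier M \<Longrightarrow> f (x \<oplus>\<^bsub>M\<^esub> y) = f x \<oplus>\<^bsub>N\<^esub> f y"
    and "a \<in> carrier S \<Longrightarrow> x \<in> carrier M \<Longrightarrow> f (a \<odot>\<^bsub>M\<^esub> x) = a \<odot>\<^bsub>N\<^esub> f x"
  using assms by (auto simp: mod_hom_def)

lemma mod_hom_zero:
  assumes "module S M" "module S N" "f \<in> mod_hom S M N"
  shows "f \<zero>\<^bsub>M\<^esub> = \<zero>\<^bsub>N\<^esub>"
proof -
  interpret M: module S M by fact
  interpret N: module S N by fact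
  have "f (\<zero>\<^bsub>S\<^esub> \<odot>\<^bsub>M\<^esub> \<zero>\<^bsub>M\<^esub>) = \<zero>\<^bsub>S\<^esub> \<odot>\<^bsub>N\<^esub> f \<zero>\<^bsub>M\<^esub>"
    by (rule mod_homD[OF assms(3)]) auto
  then show ?thesis using mod_homD(1)[OF assms(3)] by simp
qed

lemma mod_hom_minus:
  assumes "module S M" "module S N" "f \<in> mod_hom S M N" "x \<in> carrier M" "y \<in> carrier M"
  shows "f (x \<ominus>\<^bsub>M\<^esub> y) = f x \<ominus>\<^bsub>N\<^esub> f y"
proof -
  interpret M: module S M by fact
  interpret N: module S N by fact
  have m: "\<ominus>\<^bsub>M\<^esub> y = (\<ominus>\<^bsub>S\<^esub> \<one>\<^bsub>S\<^esub>) \<odot>\<^bsub>M\<^esub> y" using assms(5) M.smult_l_minus[of "\<one>\<^bsub>S\<^esub>" y] by simp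
  have n: "\<ominus>\<^bsub>N\<^esub> f y = (\<ominus>\<^bsub>S\<^esub> \<one>\<^bsub>S\<^esub>) \<odot>\<^bsub>N\<^esub> f y"
    using assms(5) mod_homD(1)[OF assms(3)] N.smult_l_minus[of "\<one>\<^bsub>S\<^esub>" "f y"] by simp
  show ?thesis unfolding a_minus_def m n using assms(4,5) by (simp add: mod_homD[OF assms(3)])
qed

lemma mod_hom_res:
  assumes "f \<in> mod_hom S M N" "A \<subseteq> carrier M" "f ` A \<subseteq> B"
  shows "f \<in> mod_hom S (res M A) (res N B)"
  using assms by (auto simp: mod_hom_def subset_iff)

lemma mod_hom_comp:
  "f \<in> mod_hom S M N \<Longrightarrow> g \<in> mod_hom S N K \<Longrightarrow> (\<lambda>x. g (f x)) \<in> mod_hom S M K"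
  by (auto simp: mod_hom_def Pi_iff)

lemma mod_hom_image_submodule:
  assumes "module S M" "module S N" "f \<in> mod_hom S M N" "submodule A S M"
  shows "submodule (f ` A) S N"
proof -
  interpret M: module S M by fact
  interpret N: module S N by fact
  have A: "A \<subseteq> carrier M" "\<zero>\<^bsub>M\<^esub> \<in> A" "\<forall>x\<in>A. \<forall>y\<in>A. x \<oplus>\<^bsub>M\<^esub> y \<in> A"
    "\<forall>a\<in>carrier S. \<forall>x\<in>A. a \<odot>\<^bsub>M\<^esub> x \<in> A" using assms(4) by (auto simp: M.submodule_iff)
  show ?thesis unfolding N.submodule_iff
  proof (intro conjI ballI)
    show "f ` A \<subseteq> carrier N" using A(1) mod_homD(1)[OF assms(3)] by auto
    show "\<zero>\<^bsub>N\<^esub> \<in> f ` A" using A(2) mod_hom_zero[OF assms(1-3)] by (metis imageI)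
  next
    fix x y assume "x \<in> f ` A" "y \<in> f ` A"
    then obtain a b where "a \<in> A" "b \<in> A" "x = f a" "y = f b" by auto
    then show "x \<oplus>\<^bsub>N\<^esub> y \<in> f ` A" using A mod_homD(2)[OF assms(3), of a b] by (metis imageI subsetD)
  next
    fix s x assume "s \<in> carrier S" "x \<in> f ` A"
    then obtain a where "a \<in> A" "x = f a" by auto
    then show "s \<odot>\<^bsub>N\<^esub> x \<in> f ` A"
      using A \<open>s \<in> carrier S\<close> mod_homD(3)[OF assms(3), of s a] by (metis imageI subsetD)
  qed
qed

lemma mod_hom_vimage_submodule:
  assumes "module S M" "module S N" "f \<in> mod_hom S M N" "submodule A S M" "submodule B S N"
  shows "submodule {x \<in> A. f x \<in> B} S M"
proof -
  interpret M: module S M by fact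
  interpret N: module S N by fact
  have A: "A \<subseteq> carrier M" "\<zero>\<^bsub>M\<^esub> \<in> A" "\<forall>x\<in>A. \<forall>y\<in>A. x \<oplus>\<^bsub>M\<^esub> y \<in> A"
    "\<forall>a\<in>carrier S. \<forall>x\<in>A. a \<odot>\<^bsub>M\<^esub> x \<in> A" using assms(4) by (auto simp: M.submodule_iff)
  have B: "B \<subseteq> carrier N" "\<zero>\<^bsub>N\<^esub> \<in> B" "\<forall>x\<in>B. \<forall>y\<in>B. x \<oplus>\<^bsub>N\<^esub> y \<in> B"
    "\<forall>a\<in>carrier S. \<forall>x\<in>B. a \<odot>\<^bsub>N\<^esub> x \<in> B" using assms(5) by (auto simp: N.submodule_iff)
  show ?thesis unfolding M.submodule_iff
    using A B mod_homD[OF assms(3)] mod_hom_zero[OF assms(1-3)] by (auto simp: subset_iff)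
qed

lemma mod_hom_kernel_submodule:
  assumes "module S M" "module S N" "f \<in> mod_hom S M N" "submodule A S M"
  shows "submodule {x \<in> A. f x = \<zero>\<^bsub>N\<^esub>} S M"
  using mod_hom_vimage_submodule[OF assms submodule_zero_set[OF assms(2)]] by simp

lemma mod_hom_image_msum:
  assumes "f \<in> mod_hom S M N" "A \<subseteq> carrier M" "B \<subseteq> carrier M"
  shows "f ` msum M A B = msum N (f ` A) (f ` B)"
proof -
  have "f (a \<oplus>\<^bsub>M\<^esub> b) = f a \<oplus>\<^bsub>N\<^esub> f b" if "a \<in> A" "b \<in> B" for a b
    using that assms mod_homD(2)[OF assms(1)] by blast
  then show ?thesis by (auto simp: msum_def image_iff) metis+
qed

lemma mod_hom_injI:
  assumes "module S M" "module S N" "f \<in> mod_hom S M N" "submodule A S M"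
    and "\<And>x. x \<in> A \<Longrightarrow> f x = \<zero>\<^bsub>N\<^esub> \<Longrightarrow> x = \<zero>\<^bsub>M\<^esub>"
  shows "inj_on f A"
proof
  interpret M: module S M by fact
  interpret N: module S N by fact
  fix x y assume xy: "x \<in> A" "y \<in> A" "f x = f y"
  have A: "A \<subseteq> carrier M" using assms(4) by (rule submodule_subset)
  have "x \<ominus>\<^bsub>M\<^esub> y \<in> A" using M.submoduleE(3,5)[OF assms(4)] xy unfolding a_minus_def by auto
  moreover have "f (x \<ominus>\<^bsub>M\<^esub> y) = \<zero>\<^bsub>N\<^esub>"
    using mod_hom_minus[OF assms(1-3)] xy A mod_homD(1)[OF assms(3)]
    by (auto simp: subset_iff a_minus_def N.r_neg)
  ultimately have "x \<ominus>\<^bsub>M\<^esub> y = \<zero>\<^bsub>M\<^esub>" using assms(5) by auto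
  then have "y = y \<oplus>\<^bsub>M\<^esub> (x \<ominus>\<^bsub>M\<^esub> y)" using xy A by (simp add: subset_iff)
  also have "\<dots> = x" using xy A by (simp add: a_minus_def subset_iff M.a_lcomm M.r_neg)
  finally show "x = y" by simp
qed

section \<open>Transport of structure and quotients\<close>

lemma module_hom_image:
  assumes "module S M" "carrier N = f ` carrier M" "\<zero>\<^bsub>N\<^esub> = f \<zero>\<^bsub>M\<^esub>" "f \<in> mod_hom S M N"
  shows "module S N"
proof -
  interpret M: module S M by fact
  note f = mod_homD[OF assms(4)]
  have fadd: "f x \<oplus>\<^bsub>N\<^esub> f y = f (x \<oplus>\<^bsub>M\<^esub> y)" if "x \<in> carrier M" "y \<in> carrier M" for x y
    using f that by simp
  have fsm: "a \<odot>\<^bsub>N\<^esub> f x = f (a \<odot>\<^bsub>M\<^esub> x)" if "a \<in> carrier S" "x \<in> carrier M" for x a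
    using f that by simp
  show ?thesis
  proof (rule moduleI)
    show "cring S" by (rule M.R.is_cring)
    show "abelian_group N"
    proof (rule abelian_groupI)
      fix x assume "x \<in> carrier N"
      then obtain a where "a \<in> carrier M" "x = f a" using assms by auto
      then show "\<exists>y\<in>carrier N. y \<oplus>\<^bsub>N\<^esub> x = \<zero>\<^bsub>N\<^esub>"
        using assms(2,3) by (auto simp: fadd M.l_neg intro!: bexI[of _ "\<ominus>\<^bsub>M\<^esub> a"])
    qed (use assms(2,3) in \<open>auto simp: fadd M.add.m_ac\<close>)
  qed (use assms(2,3) in \<open>auto simp: fadd fsm M.smult_l_distr M.smult_r_distr M.smult_assoc1\<close>)
qed

text \<open>The fibres of \<open>f\<close> form a congruence, so the structure of \<open>M\<close>
  descends to the image of \<open>f\<close> in any type. Two uses follow: \<open>f\<close> choosing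
  representatives of cosets, and \<open>f\<close> injective, moving B(N) into the type of the
  elements of \<open>N\<close>.\<close>

lemma module_transfer:
  fixes M :: "('s, 'm) module" and f :: "'m \<Rightarrow> 'n"
  assumes "module S M"
    and add: "\<And>x y x' y'. \<lbrakk>x \<in> carrier M; y \<in> carrier M; x' \<in> carrier M; y' \<in> carrier M;
      f x = f x'; f y = f y'\<rbrakk> \<Longrightarrow> f (x \<oplus>\<^bsub>M\<^esub> y) = f (x' \<oplus>\<^bsub>M\<^esub> y')"
    and smult: "\<And>a x x'. \<lbrakk>a \<in> carrier S; x \<in> carrier M; x' \<in> carrier M; f x = f x'\<rbrakk> \<Longrightarrow>
      f (a \<odot>\<^bsub>M\<^esub> x) = f (a \<odot>\<^bsub>M\<^esub> x')"
  obtains N :: "('s, 'n) module" where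
    "module S N" "carrier N = f ` carrier M" "\<zero>\<^bsub>N\<^esub> = f \<zero>\<^bsub>M\<^esub>" "f \<in> mod_hom S M N"
proof -
  interpret M: module S M by fact
  define g where "g = inv_into (carrier M) f"
  have g: "g (f x) \<in> carrier M" "f (g (f x)) = f x" if "x \<in> carrier M" for x
    using that inv_into_into[of "f x" f "carrier M"] f_inv_into_f[of "f x" f "carrier M"]
    by (auto simp: g_def)
  define N :: "('s, 'n) module" where
    "N = \<lparr>carrier = f ` carrier M, mult = undefined, one = undefined, ring.zero = f \<zero>\<^bsub>M\<^esub>,
       add = (\<lambda>x y. f (g x \<oplus>\<^bsub>M\<^esub> g y)), smult = (\<lambda>a x. f (a \<odot>\<^bsub>M\<^esub> g x))\<rparr>"
  have "f \<in> mod_hom S M N"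
    unfolding mod_hom_def
  proof (intro CollectI conjI ballI)
    show "f \<in> carrier M \<rightarrow> carrier N" by (simp add: N_def)
  next
    fix x y assume "x \<in> carrier M" "y \<in> carrier M"
    then show "f (x \<oplus>\<^bsub>M\<^esub> y) = f x \<oplus>\<^bsub>N\<^esub> f y"
      using add[of x y "g (f x)" "g (f y)"] g by (simp add: N_def)
  next
    fix a x assume "a \<in> carrier S" "x \<in> carrier M"
    then show "f (a \<odot>\<^bsub>M\<^esub> x) = a \<odot>\<^bsub>N\<^esub> f x"
      using smult[of a x "g (f x)"] g by (simp add: N_def)
  qed
  then show thesis using that[of N] module_hom_image[OF assms(1), of N f] by (simp add: N_def)
qed

text \<open>A length function only sees modules over one element type, so the quotient has to stay
  in \<open>'m\<close>: each coset is represented by a chosen element instead of by a set.\<close>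

lemma quotient_exists:
  fixes M :: "('s, 'm) module"
  assumes "module S M" "submodule B S M"
  obtains N :: "('s, 'm) module" and f where
    "module S N" "f \<in> mod_hom S M N" "f ` carrier M = carrier N"
    "{x \<in> carrier M. f x = \<zero>\<^bsub>N\<^esub>} = B"
proof -
  interpret M: module S M by fact
  have B: "B \<subseteq> carrier M" "\<zero>\<^bsub>M\<^esub> \<in> B" "\<And>x y. x\<in>B \<Longrightarrow> y\<in>B \<Longrightarrow> x \<oplus>\<^bsub>M\<^esub> y \<in> B"
    "\<And>a x. a\<in>carrier S \<Longrightarrow> x\<in>B \<Longrightarrow> a \<odot>\<^bsub>M\<^esub> x \<in> B" "\<And>x. x \<in> B \<Longrightarrow> \<ominus>\<^bsub>M\<^esub> x \<in> B"
    using assms(2) M.submoduleE(3) by (auto simp: M.submodule_iff)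
  define f where "f x = (SOME y. y \<in> carrier M \<and> y \<ominus>\<^bsub>M\<^esub> x \<in> B)" for x
  have f: "f x \<in> carrier M \<and> f x \<ominus>\<^bsub>M\<^esub> x \<in> B" if "x \<in> carrier M" for x
    unfolding f_def by (rule someI[of _ x]) (use that B in \<open>auto simp: a_minus_def M.r_neg\<close>)
  have feq: "f x = f y \<longleftrightarrow> x \<ominus>\<^bsub>M\<^esub> y \<in> B" if xy: "x \<in> carrier M" "y \<in> carrier M" for x y
  proof
    assume e: "f x = f y"
    have "x \<ominus>\<^bsub>M\<^esub> y = (f y \<ominus>\<^bsub>M\<^esub> y) \<oplus>\<^bsub>M\<^esub> (\<ominus>\<^bsub>M\<^esub> (f x \<ominus>\<^bsub>M\<^esub> x))"
      unfolding e[symmetric] using f[OF xy(1)] xy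
        M.add.m_lcomm[of "f x" "\<ominus>\<^bsub>M\<^esub> y" "\<ominus>\<^bsub>M\<^esub> f x"]
      by (simp add: a_minus_def M.minus_add M.a_ac M.r_neg2 M.r_neg1 M.r_neg)
    then show "x \<ominus>\<^bsub>M\<^esub> y \<in> B" using f xy B by auto
  next
    assume d: "x \<ominus>\<^bsub>M\<^esub> y \<in> B"
    have "z \<ominus>\<^bsub>M\<^esub> x \<in> B \<longleftrightarrow> z \<ominus>\<^bsub>M\<^esub> y \<in> B" if z: "z \<in> carrier M" for z
    proof -
      have "z \<ominus>\<^bsub>M\<^esub> y = (z \<ominus>\<^bsub>M\<^esub> x) \<oplus>\<^bsub>M\<^esub> (x \<ominus>\<^bsub>M\<^esub> y)"
        "z \<ominus>\<^bsub>M\<^esub> x = (z \<ominus>\<^bsub>M\<^esub> y) \<oplus>\<^bsub>M\<^esub> (\<ominus>\<^bsub>M\<^esub> (x \<ominus>\<^bsub>M\<^esub> y))"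
        using xy z M.r_neg1[of y "z \<ominus>\<^bsub>M\<^esub> x"]
        by (simp_all add: a_minus_def M.minus_add M.a_ac M.r_neg2 M.r_neg1)
      then show ?thesis using B(3)[OF _ d, of "z \<ominus>\<^bsub>M\<^esub> x"] B(3)[OF _ B(5)[OF d], of "z \<ominus>\<^bsub>M\<^esub> y"]
        by argo
    qed
    \<comment> \<open>The predicate under \<open>SOME\<close> depends only on the coset, hence so
      does the chosen element.\<close>
    then have "(\<lambda>z. z \<in> carrier M \<and> z \<ominus>\<^bsub>M\<^esub> x \<in> B) = (\<lambda>z. z \<in> carrier M \<and> z \<ominus>\<^bsub>M\<^esub> y \<in> B)"
      by auto
    then show "f x = f y" unfolding f_def by simp
  qed
  have *: "f (x \<oplus>\<^bsub>M\<^esub> y) = f (x' \<oplus>\<^bsub>M\<^esub> y')"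
    if "x \<in> carrier M" "y \<in> carrier M" "x' \<in> carrier M" "y' \<in> carrier M" "f x = f x'" "f y = f y'"
    for x y x' y'
  proof -
    have "(x \<oplus>\<^bsub>M\<^esub> y) \<ominus>\<^bsub>M\<^esub> (x' \<oplus>\<^bsub>M\<^esub> y') = (x \<ominus>\<^bsub>M\<^esub> x') \<oplus>\<^bsub>M\<^esub> (y \<ominus>\<^bsub>M\<^esub> y')"
      using that(1-4) by (simp add: a_minus_def M.minus_add M.a_ac)
    then show ?thesis using that B feq by auto
  qed
  have **: "f (a \<odot>\<^bsub>M\<^esub> x) = f (a \<odot>\<^bsub>M\<^esub> x')"
    if "a \<in> carrier S" "x \<in> carrier M" "x' \<in> carrier M" "f x = f x'" for a x x'
  proof -
    have "(a \<odot>\<^bsub>M\<^esub> x) \<ominus>\<^bsub>M\<^esub> (a \<odot>\<^bsub>M\<^esub> x') = a \<odot>\<^bsub>M\<^esub> (x \<ominus>\<^bsub>M\<^esub> x')"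
      using that(1-3) by (simp add: a_minus_def M.smult_r_distr M.smult_r_minus)
    then show ?thesis using that B feq by auto
  qed
  obtain N :: "('s, 'm) module" where N: "module S N" "carrier N = f ` carrier M"
    "\<zero>\<^bsub>N\<^esub> = f \<zero>\<^bsub>M\<^esub>" "f \<in> mod_hom S M N"
    using module_transfer[OF assms(1), of f] * ** by blast
  have "f x = \<zero>\<^bsub>N\<^esub> \<longleftrightarrow> x \<in> B" if "x \<in> carrier M" for x
  proof -
    have "\<ominus>\<^bsub>M\<^esub> \<zero>\<^bsub>M\<^esub> = \<zero>\<^bsub>M\<^esub>" by (rule M.minus_equality) auto
    then have "x \<ominus>\<^bsub>M\<^esub> \<zero>\<^bsub>M\<^esub> = x" using that by (simp only: a_minus_def M.r_zero)
    then show ?thesis unfolding N(3) using feq[OF that, of "\<zero>\<^bsub>M\<^esub>"] by simp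
  qed
  then show thesis using that[OF N(1,4)] N(2) B(1) by auto
qed

section \<open>Spans and finitely generated submodules\<close>

lemma mod_span_submodule:
  assumes "module S M" "E \<subseteq> carrier M"
  shows "submodule (mod_span S M E) S M"
proof -
  interpret M: module S M by fact
  have "carrier M \<in> {N. submodule N S M \<and> E \<subseteq> N}" using assms submodule_carrier by auto
  then have "mod_span S M E \<subseteq> carrier M" unfolding mod_span_def by (rule Inter_lower)
  then show ?thesis unfolding M.submodule_iff by (simp add: mod_span_def M.submodule_iff)
qed

lemma mod_span_upper: "E \<subseteq> mod_span S M E"
  by (auto simp: mod_span_def)

lemma mod_span_least: "submodule N S M \<Longrightarrow> E \<subseteq> N \<Longrightarrow> mod_span S M E \<subseteq> N"
  by (auto simp: mod_span_def)

lemma mod_span_res: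
  assumes "module S M" "submodule A S M" "E \<subseteq> A"
  shows "mod_span S (res M A) E = mod_span S M E"
proof
  have A: "A \<subseteq> carrier M" using assms(2) by (rule submodule_subset)
  show "mod_span S (res M A) E \<subseteq> mod_span S M E"
    using assms A mod_span_least[OF assms(2,3)] mod_span_submodule[OF assms(1), of E]
    by (intro mod_span_least mod_span_upper) (auto simp: submodule_res_iff)
  show "mod_span S M E \<subseteq> mod_span S (res M A) E"
    using mod_span_submodule[OF module_res[OF assms(1,2)], of E] assms
    by (intro mod_span_least mod_span_upper) (simp add: submodule_res_iff)
qed

lemma fg_submodules_res:
  assumes "module S M" "submodule A S M"
  shows "fg_submodules S (res M A) = {F \<in> fg_submodules S M. F \<subseteq> A}"
proof -
  have A: "A \<subseteq> carrier M" using assms(2) by (rule submodule_subset)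
  have "F \<in> fg_submodules S (res M A) \<longleftrightarrow> F \<in> fg_submodules S M \<and> F \<subseteq> A" for F
  proof
    assume "F \<in> fg_submodules S (res M A)"
    then obtain E where E: "finite E" "F = mod_span S (res M A) E" "E \<subseteq> A" "submodule F S (res M A)"
      by (auto simp: fg_submodules_def)
    have "F = mod_span S M E" using E(2) mod_span_res[OF assms E(3)] by simp
    moreover have "submodule F S M \<and> F \<subseteq> A" using E(4) by (simp add: submodule_res_iff[OF assms])
    ultimately show "F \<in> fg_submodules S M \<and> F \<subseteq> A"
      using E(1,3) A by (auto simp: fg_submodules_def)
  next
    assume F: "F \<in> fg_submodules S M \<and> F \<subseteq> A"
    then obtain E where "finite E" "F = mod_span S M E" "E \<subseteq> carrier M" "submodule F S M"
      by (auto simp: fg_submodules_def)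
    moreover have "E \<subseteq> F" unfolding \<open>F = mod_span S M E\<close> by (rule mod_span_upper)
    ultimately have E: "E \<subseteq> A" "finite E" "F = mod_span S M E" "submodule F S M" using F by auto
    have "F = mod_span S (res M A) E" using E(3) mod_span_res[OF assms E(1)] by simp
    moreover have "submodule F S (res M A)" using E(4) F by (simp add: submodule_res_iff[OF assms])
    ultimately show "F \<in> fg_submodules S (res M A)"
      using E(1,2) by (auto simp: fg_submodules_def)
  qed
  then show ?thesis by auto
qed

lemma mod_hom_image_span:
  assumes "module S M" "module S N" "f \<in> mod_hom S M N" "E \<subseteq> carrier M"
  shows "f ` mod_span S M E = mod_span S N (f ` E)"
proof
  have fE: "f ` E \<subseteq> carrier N" using assms mod_homD(1)[OF assms(3)] by auto
  have "submodule {x \<in> carrier M. f x \<in> mod_span S N (f ` E)} S M"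
    using mod_hom_vimage_submodule[OF assms(1-3) submodule_carrier[OF assms(1)]]
      mod_span_submodule[OF assms(2) fE] by blast
  then have "mod_span S M E \<subseteq> {x \<in> carrier M. f x \<in> mod_span S N (f ` E)}"
    using assms(4) mod_span_upper[of "f ` E" S N] by (intro mod_span_least) auto
  then show "f ` mod_span S M E \<subseteq> mod_span S N (f ` E)" by auto
  show "mod_span S N (f ` E) \<subseteq> f ` mod_span S M E"
    using mod_hom_image_submodule[OF assms(1-3) mod_span_submodule[OF assms(1,4)]]
    by (intro mod_span_least) (auto intro!: imageI mod_span_upper[THEN subsetD])
qed

text \<open>Only the finitely many generators are lifted; the span of the lifts then maps onto
  \<open>G\<close>.\<close>

lemma fg_submodules_lift:
  assumes "module S M" "module S N" "f \<in> mod_hom S M N" "G \<in> fg_submodules S N"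
    "G \<subseteq> f ` carrier M"
  shows "\<exists>F\<in>fg_submodules S M. f ` F = G"
proof -
  obtain E where E: "finite E" "G = mod_span S N E" "E \<subseteq> carrier N" "submodule G S N"
    using assms(4) by (auto simp: fg_submodules_def)
  have "E \<subseteq> f ` carrier M" using mod_span_upper[of E S N] E(2) assms(5) by auto
  then obtain E' where E': "E' \<subseteq> carrier M" "finite E'" "E = f ` E'"
    using E(1) finite_subset_image by metis
  show ?thesis
    using E' E(2) mod_hom_image_span[OF assms(1-3) E'(1)] mod_span_submodule[OF assms(1) E'(1)]
    by (auto intro!: bexI[of _ "mod_span S M E'"] simp: fg_submodules_def)
qed

section \<open>Lengths of submodules\<close>

text \<open>Finitely many generators lie in one member of the chain. This compactness turns upper
  continuity into continuity along increasing unions.\<close>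

lemma fg_submodule_chain:
  assumes "F \<in> fg_submodules S M" "\<And>n::nat. submodule (A n) S M" "\<And>n. A n \<subseteq> A (Suc n)"
    "F \<subseteq> (\<Union>n. A n)"
  shows "\<exists>n. F \<subseteq> A n"
proof -
  have mono: "m \<le> n \<Longrightarrow> A m \<subseteq> A n" for m n using lift_Suc_mono_le[of A] assms(3) by blast
  obtain E where E: "finite E" "F = mod_span S M E" using assms(1) by (auto simp: fg_submodules_def)
  have "E \<subseteq> (\<Union>n. A n)" using E assms(4) mod_span_upper[of E S M] by auto
  with \<open>finite E\<close> have "\<exists>n. E \<subseteq> A n"
  proof (induction rule: finite_induct)
    case (insert x G)
    then obtain n m where "G \<subseteq> A n" "x \<in> A m" by auto
    then have "insert x G \<subseteq> A (max n m)" using mono[of n "max n m"] mono[of m "max n m"] by auto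
    then show ?case by blast
  qed auto
  then obtain n where "E \<subseteq> A n" by auto
  then have "F \<subseteq> A n" unfolding E(2) using assms(2) by (intro mod_span_least)
  then show ?thesis by blast
qed

lemma length_functionD:
  assumes "length_function S C len"
  shows "M \<in> C \<Longrightarrow> carrier M = {\<zero>\<^bsub>M\<^esub>} \<Longrightarrow> len M = 0"
    and "M \<in> C \<Longrightarrow> N \<in> C \<Longrightarrow> mod_isomorphic S M N \<Longrightarrow> len M = len N"
    and "A \<in> C \<Longrightarrow> M \<in> C \<Longrightarrow> N \<in> C \<Longrightarrow> mod_short_exact S A f M g N \<Longrightarrow> len M = len A + len N"
    and "M \<in> C \<Longrightarrow> len M = (SUP F\<in>fg_submodules S M. len (res M F))"
  using assms unfolding length_function_def by blast+

text \<open>The closure conditions hold both for all R-modules and for \<open>lFin_X R L\<close>, so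
  one calculus of lengths serves \<open>L\<close> as well as a length function over R[X].\<close>

locale length_fun =
  fixes S :: "('s, 'z) ring_scheme" and C :: "('s, 'm) module set" and len :: "('s, 'm) module \<Rightarrow> ennreal"
  assumes len: "length_function S C len"
    and C_module: "M \<in> C \<Longrightarrow> module S M"
    and C_sub: "M \<in> C \<Longrightarrow> submodule A S M \<Longrightarrow> res M A \<in> C"
    and C_image: "M \<in> C \<Longrightarrow> module S N \<Longrightarrow> f \<in> mod_hom S M N \<Longrightarrow> f ` carrier M = carrier N \<Longrightarrow> N \<in> C"
begin

lemma len_zero:
  assumes "M \<in> C"
  shows "len (res M {\<zero>\<^bsub>M\<^esub>}) = 0"
proof -
  have "res M {\<zero>\<^bsub>M\<^esub>} \<in> C" using C_sub[OF assms submodule_zero_set[OF C_module[OF assms]]] .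
  then show ?thesis by (rule length_functionD(1)[OF len]) simp
qed

lemma len_surj:
  assumes "M \<in> C" "N \<in> C" "f \<in> mod_hom S M N" "f ` carrier M = carrier N"
  shows "len M = len (res M {x \<in> carrier M. f x = \<zero>\<^bsub>N\<^esub>}) + len N"
proof -
  let ?K = "{x \<in> carrier M. f x = \<zero>\<^bsub>N\<^esub>}"
  have M: "module S M" "module S N" using assms C_module by auto
  have K: "submodule ?K S M" using mod_hom_kernel_submodule[OF M assms(3) submodule_carrier[OF M(1)]] .
  have "mod_short_exact S (res M ?K) (\<lambda>x. x) M f N"
    unfolding mod_short_exact_def using assms by (auto simp: mod_hom_def)
  from length_functionD(3)[OF len C_sub[OF assms(1) K] assms(1,2) this] show ?thesis .
qed

lemma len_hom:
  assumes "M \<in> C" "module S N" "f \<in> mod_hom S M N" "submodule A S M"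
  shows "len (res M A) = len (res M {x \<in> A. f x = \<zero>\<^bsub>N\<^esub>}) + len (res N (f ` A))"
proof -
  have M: "module S M" using assms C_module by auto
  have A: "A \<subseteq> carrier M" using assms(4) by (rule submodule_subset)
  have MA: "res M A \<in> C" using assms C_sub by auto
  have N: "module S (res N (f ` A))"
    using module_res mod_hom_image_submodule M assms by blast
  have f: "f \<in> mod_hom S (res M A) (res N (f ` A))" using mod_hom_res[OF assms(3) A] by simp
  have "res N (f ` A) \<in> C" using C_image[OF MA N f] by simp
  from len_surj[OF MA this f] show ?thesis by simp
qed

lemma len_inj:
  assumes "M \<in> C" "module S N" "f \<in> mod_hom S M N" "submodule A S M" "inj_on f A"
  shows "len (res N (f ` A)) = len (res M A)"
proof -
  have M: "module S M" using assms C_module by auto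
  have z: "\<zero>\<^bsub>M\<^esub> \<in> A" using submodule_zero[OF M assms(4)] .
  have "{x \<in> A. f x = \<zero>\<^bsub>N\<^esub>} = {\<zero>\<^bsub>M\<^esub>}"
    using z mod_hom_zero[OF M assms(2,3)] assms(5) by (auto simp: inj_on_def)
  then show ?thesis using len_hom[OF assms(1-4)] len_zero[OF assms(1)] by simp
qed

lemma len_mono:
  assumes "M \<in> C" "submodule A S M" "submodule B S M" "A \<subseteq> B"
  shows "len (res M A) \<le> len (res M B)"
proof -
  have M: "module S M" using assms C_module by auto
  obtain N :: "('s, 'm) module" and f where N: "module S N" "f \<in> mod_hom S M N"
    "{x \<in> carrier M. f x = \<zero>\<^bsub>N\<^esub>} = A"
    using quotient_exists[OF M assms(2)] by metis
  have "{x \<in> B. f x = \<zero>\<^bsub>N\<^esub>} = A" using N(3) assms(4) submodule_subset[OF assms(3)] by auto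
  then show ?thesis using len_hom[OF assms(1) N(1,2) assms(3)] by simp
qed

text \<open>Modulo \<open>B\<close>, the submodules A + B and A have the same image, with kernels B
  and the intersection of A and B. Written as a sum, the identity also holds for infinite
  lengths.\<close>

lemma len_modular:
  assumes "M \<in> C" "submodule A S M" "submodule B S M"
  shows "len (res M (msum M A B)) + len (res M (A \<inter> B)) = len (res M A) + len (res M B)"
proof -
  have M: "module S M" using assms C_module by auto
  obtain N :: "('s, 'm) module" and f where N: "module S N" "f \<in> mod_hom S M N"
    "{x \<in> carrier M. f x = \<zero>\<^bsub>N\<^esub>} = B"
    using quotient_exists[OF M assms(3)] by metis
  have AB: "submodule (msum M A B) S M" using submodule_msum[OF M assms(2,3)] .
  interpret N: module S N by fact
  have A: "A \<subseteq> carrier M" "B \<subseteq> carrier M" using assms(2,3) submodule_subset by auto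
  have 1: "{x \<in> msum M A B. f x = \<zero>\<^bsub>N\<^esub>} = B"
    using N(3) submodule_subset[OF AB] msum_upper2[OF M assms(2,3)] by auto
  have 2: "{x \<in> A. f x = \<zero>\<^bsub>N\<^esub>} = A \<inter> B" using N(3) A by auto
  have 3: "f (a \<oplus>\<^bsub>M\<^esub> b) = f a" if "a \<in> A" "b \<in> B" for a b
  proof -
    have "f b = \<zero>\<^bsub>N\<^esub>" "a \<in> carrier M" "b \<in> carrier M" using that A N(3) by auto
    then show ?thesis using mod_homD[OF N(2)] by simp
  qed
  have "f ` msum M A B \<subseteq> f ` A" using 3 by (auto simp: msum_def)
  then have 4: "f ` msum M A B = f ` A" using msum_upper1[OF M assms(2,3)] by blast
  show ?thesis using len_hom[OF assms(1) N(1,2) AB] len_hom[OF assms(1) N(1,2) assms(2)]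
    unfolding 1 2 4 by (simp add: ac_simps)
qed

lemma len_fg:
  assumes "M \<in> C" "submodule A S M"
  shows "len (res M A) = (SUP F\<in>{F \<in> fg_submodules S M. F \<subseteq> A}. len (res M F))"
proof -
  have "len (res M A) = (SUP F\<in>fg_submodules S (res M A). len (res (res M A) F))"
    by (rule length_functionD(4)[OF len C_sub[OF assms]])
  then show ?thesis by (simp add: fg_submodules_res[OF C_module[OF assms(1)] assms(2)])
qed

text \<open>Upper continuity computes the length of the union from its finitely generated
  submodules, each of which lies in a single \<open>A n\<close>.\<close>

lemma len_UN:
  assumes "M \<in> C" "\<And>n::nat. submodule (A n) S M" "\<And>n. A n \<subseteq> A (Suc n)"
  shows "len (res M (\<Union>n. A n)) = (SUP n. len (res M (A n)))"
proof (rule antisym)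
  have M: "module S M" using assms C_module by auto
  have U: "submodule (\<Union>n. A n) S M" using submodule_UN_chain[where A = A, OF M assms(2,3)] .
  show "(SUP n. len (res M (A n))) \<le> len (res M (\<Union>n. A n))"
    by (intro SUP_least len_mono assms U) auto
  show "len (res M (\<Union>n. A n)) \<le> (SUP n. len (res M (A n)))"
    unfolding len_fg[OF assms(1) U]
  proof (rule SUP_least)
    fix F assume F: "F \<in> {F \<in> fg_submodules S M. F \<subseteq> (\<Union>n. A n)}"
    then obtain n where "F \<subseteq> A n"
      using fg_submodule_chain[where A = A, OF _ assms(2,3)] by blast
    moreover have "submodule F S M" using F by (simp add: fg_submodules_def)
    ultimately show "len (res M F) \<le> (SUP n. len (res M (A n)))"
      by (intro SUP_upper2[of n] len_mono assms) auto
  qed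
qed

end

section \<open>Submodules of finite length\<close>

definition fin_submodule ::
    "('s, 'z) ring_scheme \<Rightarrow> (('s, 'm) module \<Rightarrow> ennreal) \<Rightarrow> ('s, 'm) module \<Rightarrow> 'm set \<Rightarrow> bool" where
  "fin_submodule S len M A \<longleftrightarrow> submodule A S M \<and> len (res M A) < \<infinity>"

text \<open>Real values allow increments to be subtracted. An infinite length is sent to 0, so
  \<open>rlen\<close> is meaningful only together with \<open>fin_submodule\<close>.\<close>

definition rlen :: "(('s, 'm) module \<Rightarrow> ennreal) \<Rightarrow> ('s, 'm) module \<Rightarrow> 'm set \<Rightarrow> real" where
  "rlen len M A = enn2real (len (res M A))"

lemma fin_submoduleD: "fin_submodule S len M A \<Longrightarrow> submodule A S M"
  by (simp add: fin_submodule_def)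

lemma rlen_nonneg: "0 \<le> rlen len M A"
  by (simp add: rlen_def)

lemma ennreal_rlen: "fin_submodule S len M A \<Longrightarrow> ennreal (rlen len M A) = len (res M A)"
  by (simp add: rlen_def fin_submodule_def less_top)

context length_fun
begin

lemma fin_mono:
  assumes "M \<in> C" "fin_submodule S len M B" "submodule A S M" "A \<subseteq> B"
  shows "fin_submodule S len M A"
  using assms len_mono[OF assms(1,3), of B] by (auto simp: fin_submodule_def)

lemma rlen_mono:
  assumes "M \<in> C" "fin_submodule S len M B" "submodule A S M" "A \<subseteq> B"
  shows "rlen len M A \<le> rlen len M B"
  using assms len_mono[OF assms(1,3), of B] unfolding rlen_def fin_submodule_def
  by (intro enn2real_mono) auto

lemma fin_msum:
  assumes "M \<in> C" "fin_submodule S len M A" "fin_submodule S len M B"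
  shows "fin_submodule S len M (msum M A B)"
proof -
  have AB: "submodule A S M" "submodule B S M" using assms by (auto simp: fin_submodule_def)
  have "len (res M (msum M A B)) \<le> len (res M A) + len (res M B)"
    unfolding len_modular[OF assms(1) AB, symmetric] by simp
  also have "\<dots> < \<infinity>" using assms(2,3) by (simp add: fin_submodule_def)
  finally show ?thesis using submodule_msum[OF C_module[OF assms(1)] AB]
    by (simp add: fin_submodule_def)
qed

lemma rlen_modular:
  assumes "M \<in> C" "fin_submodule S len M A" "fin_submodule S len M B"
  shows "rlen len M (msum M A B) + rlen len M (A \<inter> B) = rlen len M A + rlen len M B"
proof -
  have AB: "submodule A S M" "submodule B S M" using assms by (auto simp: fin_submodule_def)
  have I: "fin_submodule S len M (A \<inter> B)"
    using fin_mono[OF assms(1,2)] submodule_Int[OF C_module[OF assms(1)] AB] by simp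
  have s: "fin_submodule S len M (msum M A B)" by (rule fin_msum) fact+
  have "ennreal (rlen len M (msum M A B) + rlen len M (A \<inter> B)) = ennreal (rlen len M A + rlen len M B)"
    using len_modular[OF assms(1) AB] ennreal_rlen[OF s] ennreal_rlen[OF I]
      ennreal_rlen[OF assms(2)] ennreal_rlen[OF assms(3)] by (simp add: rlen_nonneg)
  then show ?thesis by (simp add: rlen_nonneg del: ennreal_plus)
qed

lemma fin_hom:
  assumes "M \<in> C" "module S N" "f \<in> mod_hom S M N" "fin_submodule S len M A"
  shows "fin_submodule S len N (f ` A)"
proof -
  have A: "submodule A S M" using assms(4) by (rule fin_submoduleD)
  have "len (res N (f ` A)) \<le> len (res M A)" unfolding len_hom[OF assms(1-3) A] by simp
  then show ?thesis
    using assms(4) mod_hom_image_submodule[OF C_module[OF assms(1)] assms(2,3) A]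
    by (auto simp: fin_submodule_def)
qed

lemma rlen_hom:
  assumes "M \<in> C" "module S N" "f \<in> mod_hom S M N" "fin_submodule S len M A"
  shows "rlen len M A = rlen len M {x \<in> A. f x = \<zero>\<^bsub>N\<^esub>} + rlen len N (f ` A)"
proof -
  have A: "submodule A S M" using assms(4) by (rule fin_submoduleD)
  have K: "fin_submodule S len M {x \<in> A. f x = \<zero>\<^bsub>N\<^esub>}"
    using fin_mono[OF assms(1,4)] mod_hom_kernel_submodule[OF C_module[OF assms(1)] assms(2,3) A] by auto
  have "ennreal (rlen len M A) = ennreal (rlen len M {x \<in> A. f x = \<zero>\<^bsub>N\<^esub>} + rlen len N (f ` A))"
    using len_hom[OF assms(1-3) A] ennreal_rlen[OF fin_hom[OF assms]] ennreal_rlen[OF K]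
      ennreal_rlen[OF assms(4)] by (simp add: rlen_nonneg)
  then show ?thesis by (simp add: rlen_nonneg del: ennreal_plus)
qed

text \<open>The differences are the lengths of B/A and of f(B)/f(A), and the first quotient maps
  onto the second.\<close>

lemma rlen_hom_diff:
  assumes "M \<in> C" "module S N" "f \<in> mod_hom S M N" "fin_submodule S len M B" "submodule A S M" "A \<subseteq> B"
  shows "rlen len N (f ` B) - rlen len N (f ` A) \<le> rlen len M B - rlen len M A"
proof -
  have M: "module S M" using assms C_module by auto
  have A: "fin_submodule S len M A" using fin_mono[OF assms(1,4,5,6)] .
  have "fin_submodule S len M {x \<in> B. f x = \<zero>\<^bsub>N\<^esub>}"
    using fin_mono[OF assms(1,4)]
      mod_hom_kernel_submodule[OF M assms(2,3) fin_submoduleD[OF assms(4)]] by auto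
  then have "rlen len M {x \<in> A. f x = \<zero>\<^bsub>N\<^esub>} \<le> rlen len M {x \<in> B. f x = \<zero>\<^bsub>N\<^esub>}"
    using mod_hom_kernel_submodule[OF M assms(2,3,5)] assms(1,6) by (intro rlen_mono) auto
  then show ?thesis using rlen_hom[OF assms(1-4)] rlen_hom[OF assms(1-3) A] by simp
qed

text \<open>B/A maps onto (D + B)/(D + A). Both orders of the summands are recorded, since
  trajectories grow on the right of \<open>msum\<close> while the comparison may concern either
  summand.\<close>

lemma rlen_msum_diff:
  assumes "M \<in> C" "fin_submodule S len M B" "submodule A S M" "A \<subseteq> B" "fin_submodule S len M D"
  shows "rlen len M (msum M D B) - rlen len M (msum M D A) \<le> rlen len M B - rlen len M A"
    and "rlen len M (msum M B D) - rlen len M (msum M A D) \<le> rlen len M B - rlen len M A"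
proof -
  have M: "module S M" using assms C_module by auto
  have A: "fin_submodule S len M A" using fin_mono[OF assms(1-4)] .
  note s = fin_submoduleD[OF A] fin_submoduleD[OF assms(2)] fin_submoduleD[OF assms(5)]
  have "fin_submodule S len M (D \<inter> B)"
    using fin_mono[OF assms(1,2)] submodule_Int[OF M s(3,2)] by auto
  then have "rlen len M (D \<inter> A) \<le> rlen len M (D \<inter> B)"
    using submodule_Int[OF M s(3,1)] assms(1,4) by (intro rlen_mono) auto
  moreover from this have "rlen len M (A \<inter> D) \<le> rlen len M (B \<inter> D)" by (simp add: Int_commute)
  ultimately show "rlen len M (msum M D B) - rlen len M (msum M D A) \<le> rlen len M B - rlen len M A"
    "rlen len M (msum M B D) - rlen len M (msum M A D) \<le> rlen len M B - rlen len M A"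
    using rlen_modular[OF assms(1,5,2)] rlen_modular[OF assms(1,5) A]
     rlen_modular[OF assms(1,2,5)] rlen_modular[OF assms(1) A assms(5)] by linarith+
qed

lemma rlen_fg_approx:
  assumes "M \<in> C" "fin_submodule S len M A" "0 < e"
  shows "\<exists>F\<in>fg_submodules S M. F \<subseteq> A \<and> rlen len M A \<le> rlen len M F + e"
proof (rule ccontr)
  assume "\<not> ?thesis"
  then have less: "rlen len M F \<le> rlen len M A - e" if "F \<in> fg_submodules S M" "F \<subseteq> A" for F
    using that by force
  have A: "submodule A S M" using assms(2) by (rule fin_submoduleD)
  have F: "len (res M F) \<le> ennreal (rlen len M A - e)" if "F \<in> fg_submodules S M" "F \<subseteq> A" for F
  proof -
    have "fin_submodule S len M F"
      using fin_mono[OF assms(1,2)] that by (auto simp: fg_submodules_def)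
    from ennreal_rlen[OF this] show ?thesis using less[OF that] by (metis ennreal_leI)
  qed
  \<comment> \<open>The span of the empty set shows that \<open>rlen len M A - e\<close> is
    nonnegative, so that \<open>ennreal\<close> does not truncate it.\<close>
  have z: "mod_span S M {} \<in> fg_submodules S M" "mod_span S M {} \<subseteq> A"
    using mod_span_submodule[OF C_module[OF assms(1)], of "{}"] mod_span_least[OF A]
    by (auto simp: fg_submodules_def)
  have "len (res M A) \<le> ennreal (rlen len M A - e)"
    unfolding len_fg[OF assms(1) A] by (rule SUP_least) (use F in auto)
  then have "ennreal (rlen len M A) \<le> ennreal (rlen len M A - e)"
    using ennreal_rlen[OF assms(2)] by simp
  moreover have "0 \<le> rlen len M A - e" using less[OF z] rlen_nonneg[of len M] order_trans by blast
  ultimately show False using assms(3) by simp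
qed

end

section \<open>Trajectories and their growth rate\<close>

text \<open>The increments decrease and are nonnegative, hence converge to some e. Bounding all
  increments below by e, and those from m on above by the m-th, squeezes \<open>a n / n\<close>
  towards the same limit.\<close>

lemma increments_tendsto:
  fixes a :: "nat \<Rightarrow> real"
  assumes "\<And>n. a n \<le> a (Suc n)" and "decseq (\<lambda>n. a (Suc n) - a n)"
  shows "\<exists>e. (\<lambda>n. a (Suc n) - a n) \<longlonglongrightarrow> e \<and> (\<lambda>n. a n / real n) \<longlonglongrightarrow> e \<and> 0 \<le> e \<and>
    (\<forall>n. e \<le> a (Suc n) - a n)"
proof -
  define d where "d n = a (Suc n) - a n" for n
  have d0: "0 \<le> d n" for n using assms(1) by (simp add: d_def)
  have dec: "decseq d" using assms(2) by (simp add: d_def[abs_def])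
  obtain e where e: "d \<longlonglongrightarrow> e" "\<And>n. e \<le> d n"
    using decseq_convergent[OF dec, of 0] d0 by auto
  have lower: "a 0 + real n * e \<le> a n" for n
  proof (induction n)
    case (Suc n)
    then show ?case using e(2)[of n] by (simp add: d_def algebra_simps)
  qed simp
  have upper: "a (m + n) \<le> a m + real n * d m" for m n
  proof (induction n)
    case (Suc n)
    then show ?case using decseqD[OF dec, of m "m + n"] by (simp add: d_def algebra_simps)
  qed simp
  have "(\<lambda>n. a n / real n) \<longlonglongrightarrow> e"
  proof (rule LIMSEQ_I)
    fix r :: real assume r: "0 < r"
    \<comment> \<open>Half of the tolerance goes to \<open>d m\<close>; the other half absorbs the
      constants \<open>a 0\<close> and \<open>a m\<close>, which is what \<open>k\<close> is chosen
      for.\<close>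
    obtain m where m: "d m < e + r / 2"
      using order_tendstoD(2)[OF e(1), of "e + r / 2"] r by (auto simp: eventually_sequentially)
    obtain k :: nat where k: "real k > (\<bar>a 0\<bar> + \<bar>a m\<bar>) / (r / 2)" using reals_Archimedean2 by blast
    have "norm (a n / real n - e) < r" if n: "n \<ge> Suc (max k m)" for n
    proof -
      have n0: "real n > 0" using n by auto
      have "real n * (r / 2) > \<bar>a 0\<bar> + \<bar>a m\<bar>"
      proof -
        have "\<bar>a 0\<bar> + \<bar>a m\<bar> < real k * (r / 2)" using k r by (simp add: field_simps)
        also have "\<dots> \<le> real n * (r / 2)" using n r by (intro mult_right_mono) auto
        finally show ?thesis .
      qed
      then have 1: "\<bar>a 0\<bar> < real n * (r / 2)" "\<bar>a m\<bar> < real n * (r / 2)" by auto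
      have "real (n - m) * d m \<le> real n * d m" using d0[of m] by (intro mult_right_mono) auto
      also have "\<dots> \<le> real n * (e + r / 2)" using m n0 by (intro mult_left_mono) auto
      finally have "a n \<le> a m + real n * (e + r / 2)" using upper[of m "n - m"] n by simp
      then have "a n < real n * (e + r)" using 1 by (simp add: algebra_simps)
      moreover have "a n > real n * (e - r)"
        using lower[of n] 1 r n0 by (simp add: algebra_simps abs_less_iff)
      ultimately show ?thesis using n0 by (simp add: abs_less_iff field_simps)
    qed
    then show "\<exists>no. \<forall>n\<ge>no. norm (a n / real n - e) < r" by blast
  qed
  moreover have "0 \<le> e" using LIMSEQ_le_const[OF e(1), of 0] d0 by auto
  ultimately show ?thesis using e unfolding d_def by auto
qed

text \<open>This is how all growth rates are compared: a bounded error \<open>c\<close> disappears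
  after division by n, an error \<open>d\<close> per step remains.\<close>

lemma growth_le:
  fixes a b :: "nat \<Rightarrow> real"
  assumes "(\<lambda>n. a n / real n) \<longlonglongrightarrow> x" "(\<lambda>n. b n / real n) \<longlonglongrightarrow> y"
    and "\<And>n. a n \<le> b n + c + real n * d"
  shows "x \<le> y + d"
proof (rule LIMSEQ_le[OF assms(1)])
  show "(\<lambda>n. b n / real n + c * (1 / real n) + d) \<longlonglongrightarrow> y + d"
    using tendsto_add[OF tendsto_add[OF assms(2) tendsto_mult_right_zero[OF lim_1_over_n, of c]] tendsto_const[of d]]
    by simp
  have "a n / real n \<le> b n / real n + c * (1 / real n) + d" if "n \<ge> 1" for n
    using assms(3)[of n] that by (simp add: field_simps)
  then show "\<exists>N. \<forall>n\<ge>N. a n / real n \<le> b n / real n + c * (1 / real n) + d" by blast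
qed

section \<open>Trajectories of an endomorphism\<close>

lemma mod_hom_funpow: "\<phi> \<in> mod_hom S M M \<Longrightarrow> \<phi> ^^ n \<in> mod_hom S M M"
proof (induction n)
  case (Suc n)
  then show ?case using mod_hom_comp[of "\<phi> ^^ n" S M M \<phi> M] by (simp add: comp_def)
qed (simp add: mod_hom_def)

lemma trajectory_0:
  assumes "module S M"
  shows "trajectory M \<phi> N 0 = {\<zero>\<^bsub>M\<^esub>}"
proof -
  interpret M: module S M by fact
  show ?thesis by (auto simp: trajectory_def)
qed

lemma trajectory_Suc:
  assumes "module S M" "\<phi> \<in> mod_hom S M M" "N \<subseteq> carrier M"
  shows "trajectory M \<phi> N (Suc n) = msum M (trajectory M \<phi> N n) ((\<phi> ^^ n) ` N)"
proof -
  interpret M: module S M by fact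
  have c: "(\<phi> ^^ i) x \<in> carrier M" if "x \<in> N" for i x
    using mod_homD(1)[OF mod_hom_funpow[OF assms(2)], of x i] that assms(3) by auto
  have step: "(\<Oplus>\<^bsub>M\<^esub>i\<in>{..<Suc n}. (\<phi> ^^ i) (y i)) = (\<Oplus>\<^bsub>M\<^esub>i\<in>{..<n}. (\<phi> ^^ i) (y i)) \<oplus>\<^bsub>M\<^esub> (\<phi> ^^ n) (y n)"
    if "y \<in> {..<Suc n} \<rightarrow> N" for y
  proof -
    have "(\<Oplus>\<^bsub>M\<^esub>i\<in>insert n {..<n}. (\<phi> ^^ i) (y i)) = (\<phi> ^^ n) (y n) \<oplus>\<^bsub>M\<^esub> (\<Oplus>\<^bsub>M\<^esub>i\<in>{..<n}. (\<phi> ^^ i) (y i))"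
      using that c by (intro M.finsum_insert) (auto simp: Pi_iff)
    moreover have "(\<Oplus>\<^bsub>M\<^esub>i\<in>{..<n}. (\<phi> ^^ i) (y i)) \<in> carrier M"
      using c by (intro M.finsum_closed) (use that in \<open>force simp: Pi_iff\<close>)
    ultimately show ?thesis using that c by (simp add: lessThan_Suc M.a_comm)
  qed
  show ?thesis
  proof
    show "trajectory M \<phi> N (Suc n) \<subseteq> msum M (trajectory M \<phi> N n) ((\<phi> ^^ n) ` N)"
    proof
      fix x assume "x \<in> trajectory M \<phi> N (Suc n)"
      then obtain y where y: "y \<in> {..<Suc n} \<rightarrow> N" "x = (\<Oplus>\<^bsub>M\<^esub>i\<in>{..<Suc n}. (\<phi> ^^ i) (y i))"
        unfolding trajectory_def by blast
      have "(\<Oplus>\<^bsub>M\<^esub>i\<in>{..<n}. (\<phi> ^^ i) (y i)) \<in> trajectory M \<phi> N n"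
        using y(1) unfolding trajectory_def by (intro CollectI exI[of _ y]) auto
      then show "x \<in> msum M (trajectory M \<phi> N n) ((\<phi> ^^ n) ` N)"
        unfolding y(2) step[OF y(1)] using y(1) by (intro msumI) auto
    qed
    show "msum M (trajectory M \<phi> N n) ((\<phi> ^^ n) ` N) \<subseteq> trajectory M \<phi> N (Suc n)"
    proof
      fix x assume "x \<in> msum M (trajectory M \<phi> N n) ((\<phi> ^^ n) ` N)"
      then obtain y z where y: "y \<in> {..<n} \<rightarrow> N" "z \<in> N"
        "x = (\<Oplus>\<^bsub>M\<^esub>i\<in>{..<n}. (\<phi> ^^ i) (y i)) \<oplus>\<^bsub>M\<^esub> (\<phi> ^^ n) z"
        unfolding trajectory_def msum_def by blast
      define w where "w = y(n := z)"
      have w: "w \<in> {..<Suc n} \<rightarrow> N" using y by (auto simp: w_def less_Suc_eq)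
      have "(\<Oplus>\<^bsub>M\<^esub>i\<in>{..<n}. (\<phi> ^^ i) (y i)) = (\<Oplus>\<^bsub>M\<^esub>i\<in>{..<n}. (\<phi> ^^ i) (w i))"
        using y(1) c by (intro M.finsum_cong') (auto simp: w_def Pi_iff)
      then have "x = (\<Oplus>\<^bsub>M\<^esub>i\<in>{..<Suc n}. (\<phi> ^^ i) (w i))"
        unfolding step[OF w] y(3) by (simp add: w_def)
      then show "x \<in> trajectory M \<phi> N (Suc n)" using w unfolding trajectory_def by blast
    qed
  qed
qed

context
  fixes S :: "('s, 'z) ring_scheme" and M :: "('s, 'm) module" and \<phi> and N
  assumes M: "module S M" and phi: "\<phi> \<in> mod_hom S M M" and N: "submodule N S M"
begin

lemma trajectory_submodule: "submodule (trajectory M \<phi> N n) S M"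
proof (induction n)
  case 0
  then show ?case using submodule_zero_set[OF M] by (simp add: trajectory_0[OF M])
next
  case (Suc n)
  then show ?case
    using submodule_msum[OF M Suc mod_hom_image_submodule[OF M M mod_hom_funpow[OF phi] N]]
    by (simp add: trajectory_Suc[OF M phi submodule_subset[OF N]])
qed

lemma funpow_submodule: "submodule ((\<phi> ^^ n) ` N) S M"
  by (rule mod_hom_image_submodule[OF M M mod_hom_funpow[OF phi] N])

lemma
  shows trajectory_Suc_upper1: "trajectory M \<phi> N n \<subseteq> trajectory M \<phi> N (Suc n)"
    and trajectory_Suc_upper2: "(\<phi> ^^ n) ` N \<subseteq> trajectory M \<phi> N (Suc n)"
  unfolding trajectory_Suc[OF M phi submodule_subset[OF N]]
  using msum_upper1[OF M trajectory_submodule funpow_submodule]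
    msum_upper2[OF M trajectory_submodule funpow_submodule] by blast+

lemma trajectory_incseq: "m \<le> n \<Longrightarrow> trajectory M \<phi> N m \<subseteq> trajectory M \<phi> N n"
  using lift_Suc_mono_le[of "trajectory M \<phi> N"] trajectory_Suc_upper1 by blast

lemma funpow_image_trajectory:
  "(\<phi> ^^ k) ` trajectory M \<phi> N n \<subseteq> trajectory M \<phi> N (n + k)"
proof (induction n)
  case 0
  then show ?case
    using mod_hom_zero[OF M M mod_hom_funpow[OF phi]] submodule_zero[OF M trajectory_submodule]
    by (simp add: trajectory_0[OF M])
next
  case (Suc n)
  have "(\<phi> ^^ k) ` trajectory M \<phi> N (Suc n)
      = msum M ((\<phi> ^^ k) ` trajectory M \<phi> N n) ((\<phi> ^^ k) ` (\<phi> ^^ n) ` N)"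
    unfolding trajectory_Suc[OF M phi submodule_subset[OF N]]
    by (intro mod_hom_image_msum[OF mod_hom_funpow[OF phi]] submodule_subset[of _ S] trajectory_submodule
        funpow_submodule)
  also have "(\<phi> ^^ k) ` (\<phi> ^^ n) ` N = (\<phi> ^^ (n + k)) ` N"
    by (simp add: image_image funpow_add add.commute[of n])
  also have "msum M ((\<phi> ^^ k) ` trajectory M \<phi> N n) \<dots> \<subseteq> trajectory M \<phi> N (Suc n + k)"
    using Suc trajectory_Suc_upper1[of "n + k"] trajectory_Suc_upper2[of "n + k"]
    by (intro msum_least[OF M trajectory_submodule]) auto
  finally show ?case .
qed

lemma trajectory_least:
  assumes "submodule A S M" "N \<subseteq> A" "\<phi> ` A \<subseteq> A"
  shows "trajectory M \<phi> N n \<subseteq> A"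
proof (induction n)
  case 0
  then show ?case using submodule_zero[OF M assms(1)] by (simp add: trajectory_0[OF M])
next
  case (Suc n)
  have "(\<phi> ^^ n) ` A \<subseteq> A" for n
    by (induction n) (use assms(3) in auto)
  then have "(\<phi> ^^ n) ` N \<subseteq> A" using assms(2) by blast
  then show ?case unfolding trajectory_Suc[OF M phi submodule_subset[OF N]]
    using Suc by (intro msum_least[OF M assms(1)])
qed

lemma trajectory_1: "trajectory M \<phi> N 1 = N"
proof
  show "trajectory M \<phi> N 1 \<subseteq> N"
    using msum_least[OF M N, of "{\<zero>\<^bsub>M\<^esub>}" N] submodule_zero[OF M N]
    by (simp add: trajectory_Suc[OF M phi submodule_subset[OF N]] trajectory_0[OF M])
  show "N \<subseteq> trajectory M \<phi> N 1" using trajectory_Suc_upper2[of 0] by simp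
qed

text \<open>Splits off the summand with i = 0, where \<open>trajectory_Suc\<close> splits off the
  last one. The rest is then an image of the previous trajectory, which makes increments comparable
  and later decomposes B(T_(n+1)).\<close>

lemma trajectory_Suc_shift: "trajectory M \<phi> N (Suc n) \<subseteq> msum M N (\<phi> ` trajectory M \<phi> N n)"
proof (induction n)
  case 0
  have "submodule (\<phi> ` trajectory M \<phi> N 0) S M"
    by (rule mod_hom_image_submodule[OF M M phi trajectory_submodule])
  from msum_upper1[OF M N this] show ?case using trajectory_1 by simp
next
  case (Suc n)
  let ?X = "msum M N (\<phi> ` trajectory M \<phi> N (Suc n))"
  have s: "submodule (\<phi> ` trajectory M \<phi> N k) S M" for k
    by (rule mod_hom_image_submodule[OF M M phi trajectory_submodule])
  have "trajectory M \<phi> N (Suc n) \<subseteq> ?X"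
    using Suc msum_mono[of N N "\<phi> ` trajectory M \<phi> N n" "\<phi> ` trajectory M \<phi> N (Suc n)" M]
      trajectory_Suc_upper1[of n] by blast
  moreover have "(\<phi> ^^ Suc n) ` N \<subseteq> ?X"
    using trajectory_Suc_upper2[of n] msum_upper2[OF M N s, of "Suc n"] by (force simp: image_image)
  ultimately show ?case
    unfolding trajectory_Suc[OF M phi submodule_subset[OF N], of "Suc n"]
    by (intro msum_least[OF M] submodule_msum[OF M N s])
qed

end

lemma trajectory_mono:
  assumes "N \<subseteq> N'"
  shows "trajectory M \<phi> N n \<subseteq> trajectory M \<phi> N' n"
  unfolding trajectory_def using assms by blast

lemma trajectory_image:
  assumes "module S M" "module S M'" "\<phi> \<in> mod_hom S M M" "\<psi> \<in> mod_hom S M' M'" "f \<in> mod_hom S M M'"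
    and "\<And>x. x \<in> carrier M \<Longrightarrow> f (\<phi> x) = \<psi> (f x)" "submodule N S M"
  shows "f ` trajectory M \<phi> N n = trajectory M' \<psi> (f ` N) n"
proof -
  note N = submodule_subset[OF assms(7)]
  have fN: "submodule (f ` N) S M'" by (rule mod_hom_image_submodule[OF assms(1,2,5,7)])
  have comm: "f ((\<phi> ^^ n) x) = (\<psi> ^^ n) (f x)" if "x \<in> carrier M" for n x
    by (induction n) (simp_all add: assms(6) mod_homD(1)[OF mod_hom_funpow[OF assms(3)] that])
  show ?thesis
  proof (induction n)
    case 0
    then show ?case using mod_hom_zero[OF assms(1,2,5)] by (simp add: trajectory_0[OF assms(1)] trajectory_0[OF assms(2)])
  next
    case (Suc n)
    have "f ` (\<phi> ^^ n) ` N = (\<psi> ^^ n) ` f ` N" using comm N by (auto simp: image_image subset_iff)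
    then show ?case
      unfolding trajectory_Suc[OF assms(1,3) N] trajectory_Suc[OF assms(2,4) submodule_subset[OF fN]]
      using Suc N mod_hom_image_msum[OF assms(5) submodule_subset[OF trajectory_submodule[OF assms(1,3,7)]]
          submodule_subset[OF funpow_submodule[OF assms(1,3,7)]]]
      by simp
  qed
qed

text \<open>The real-valued counterpart of \<open>ent_sub\<close>; they agree on submodules of
  finite length by \<open>ent_sub_eq_growth\<close>.\<close>

definition growth :: "(('s, 'm) module \<Rightarrow> ennreal) \<Rightarrow> ('s, 'm) module \<Rightarrow> ('m \<Rightarrow> 'm) \<Rightarrow> 'm set \<Rightarrow> real" where
  "growth len M \<phi> N = lim (\<lambda>n. rlen len M (trajectory M \<phi> N n) / real n)"

section \<open>Growth rates of trajectories\<close>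

locale length_endo = length_fun S C len
  for S :: "('s, 'z) ring_scheme" and C :: "('s, 'm) module set" and len +
  fixes M and \<phi>
  assumes M_in: "M \<in> C" and phi: "\<phi> \<in> mod_hom S M M"
begin

abbreviation "fin \<equiv> fin_submodule S len M"
abbreviation "traj \<equiv> trajectory M \<phi>"
abbreviation "rl \<equiv> rlen len M"

lemma M_module: "module S M"
  using C_module[OF M_in] .

lemma fin_trajectory:
  assumes "fin N"
  shows "fin (traj N n)"
proof (induction n)
  case 0
  then show ?case using len_zero[OF M_in] submodule_zero_set[OF M_module]
    by (simp add: trajectory_0[OF M_module] fin_submodule_def)
next
  case (Suc n)
  then show ?case using fin_msum[OF M_in Suc fin_hom[OF M_in M_module mod_hom_funpow[OF phi] assms]]
    by (simp add: trajectory_Suc[OF M_module phi submodule_subset[OF fin_submoduleD[OF assms]]])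
qed

text \<open>Increments decrease because T_(n+2) = T_(n+1) + phi(T_(n+1)) and phi(T_n) lies in
  T_(n+1): the quotient T_(n+2)/T_(n+1) is an image of phi(T_(n+1))/phi(T_n), which in turn is an
  image of T_(n+1)/T_n.\<close>

lemma growth_limits:
  assumes "fin N"
  shows "(\<lambda>n. rl (traj N (Suc n)) - rl (traj N n)) \<longlonglongrightarrow> growth len M \<phi> N"
    and "(\<lambda>n. rl (traj N n) / real n) \<longlonglongrightarrow> growth len M \<phi> N"
    and "0 \<le> growth len M \<phi> N"
    and "growth len M \<phi> N \<le> rl (traj N (Suc n)) - rl (traj N n)"
    and "decseq (\<lambda>n. rl (traj N (Suc n)) - rl (traj N n))"
proof -
  note N = fin_submoduleD[OF assms]
  note T = trajectory_submodule[OF M_module phi N]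
  note fT = fin_trajectory[OF assms]
  note up = trajectory_Suc_upper1[OF M_module phi N]
  have inc: "rl (traj N n) \<le> rl (traj N (Suc n))" for n
    by (rule rlen_mono[OF M_in fT T up])
  have dec: "decseq (\<lambda>n. rl (traj N (Suc n)) - rl (traj N n))"
    unfolding decseq_Suc_iff
  proof
    fix n
    have pT: "submodule (\<phi> ` traj N k) S M" "fin (\<phi> ` traj N k)" for k
      using mod_hom_image_submodule[OF M_module M_module phi T] fin_hom[OF M_in M_module phi fT] by auto
    have "traj N (Suc (Suc n)) \<subseteq> msum M N (\<phi> ` traj N (Suc n))"
      by (rule trajectory_Suc_shift[OF M_module phi N])
    also have "\<dots> \<subseteq> msum M (traj N (Suc n)) (\<phi> ` traj N (Suc n))"
      using trajectory_incseq[OF M_module phi N, of 1 "Suc n"] trajectory_1[OF M_module phi N]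
      by (intro msum_mono) auto
    finally have 1: "rl (traj N (Suc (Suc n))) \<le> rl (msum M (traj N (Suc n)) (\<phi> ` traj N (Suc n)))"
      by (intro rlen_mono[OF M_in] fin_msum[OF M_in] fT pT T)
    have "msum M (traj N (Suc n)) (\<phi> ` traj N n) \<subseteq> traj N (Suc n)"
      using funpow_image_trajectory[OF M_module phi N, of 1 n]
      by (intro msum_least[OF M_module T]) auto
    then have 2: "rl (msum M (traj N (Suc n)) (\<phi> ` traj N n)) \<le> rl (traj N (Suc n))"
      by (intro rlen_mono[OF M_in fT] submodule_msum[OF M_module] T pT)
    have 3: "rl (msum M (traj N (Suc n)) (\<phi> ` traj N (Suc n))) - rl (msum M (traj N (Suc n)) (\<phi> ` traj N n))
        \<le> rl (\<phi> ` traj N (Suc n)) - rl (\<phi> ` traj N n)"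
      using up[of n] by (intro rlen_msum_diff(1) M_in pT fT) auto
    have "rl (\<phi> ` traj N (Suc n)) - rl (\<phi> ` traj N n) \<le> rl (traj N (Suc n)) - rl (traj N n)"
      by (rule rlen_hom_diff[OF M_in M_module phi fT T up])
    then show "rl (traj N (Suc (Suc n))) - rl (traj N (Suc n)) \<le> rl (traj N (Suc n)) - rl (traj N n)"
      using 1 2 3 by linarith
  qed
  obtain e where e: "(\<lambda>n. rl (traj N (Suc n)) - rl (traj N n)) \<longlonglongrightarrow> e"
      "(\<lambda>n. rl (traj N n) / real n) \<longlonglongrightarrow> e" "0 \<le> e" "\<And>n. e \<le> rl (traj N (Suc n)) - rl (traj N n)"
    using increments_tendsto[of "\<lambda>n. rl (traj N n)", OF inc dec] by blast
  have "growth len M \<phi> N = e" unfolding growth_def using e(2) by (rule limI)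
  then show "(\<lambda>n. rl (traj N (Suc n)) - rl (traj N n)) \<longlonglongrightarrow> growth len M \<phi> N"
    "(\<lambda>n. rl (traj N n) / real n) \<longlonglongrightarrow> growth len M \<phi> N"
    "0 \<le> growth len M \<phi> N" "growth len M \<phi> N \<le> rl (traj N (Suc n)) - rl (traj N n)"
    "decseq (\<lambda>n. rl (traj N (Suc n)) - rl (traj N n))"
    using e dec by auto
qed

lemma ent_sub_eq_growth:
  assumes "fin N"
  shows "ent_sub len M \<phi> N = ennreal (growth len M \<phi> N)"
proof -
  have "(\<lambda>n. ennreal (rl (traj N n) / real n)) \<longlonglongrightarrow> ennreal (growth len M \<phi> N)"
    by (rule tendsto_ennrealI[OF growth_limits(2)[OF assms]])
  moreover have "\<forall>\<^sub>F n in sequentially.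
      ennreal (rl (traj N n) / real n) = len (res M (traj N n)) / of_nat n"
    using eventually_gt_at_top[of 0]
  proof eventually_elim
    case (elim n)
    have "ennreal (rl (traj N n) / real n) = ennreal (rl (traj N n)) / ennreal (real n)"
      using elim by (simp add: divide_ennreal rlen_nonneg)
    then show ?case using ennreal_rlen[OF fin_trajectory[OF assms], of n]
      by (simp add: ennreal_of_nat_eq_real_of_nat)
  qed
  ultimately have "(\<lambda>n. len (res M (traj N n)) / of_nat n) \<longlonglongrightarrow> ennreal (growth len M \<phi> N)"
    by (rule Lim_transform_eventually)
  then show ?thesis unfolding ent_sub_def by (rule limI)
qed

lemma growth_mono:
  assumes "fin N" "submodule F S M" "F \<subseteq> N"
  shows "growth len M \<phi> F \<le> growth len M \<phi> N"
proof -
  have F: "fin F" using fin_mono[OF M_in assms] .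
  have "rl (traj F n) \<le> rl (traj N n) + 0 + real n * 0" for n
    using rlen_mono[OF M_in fin_trajectory[OF assms(1)] trajectory_submodule[OF M_module phi assms(2)]
        trajectory_mono[OF assms(3)]] by simp
  then have "growth len M \<phi> F \<le> growth len M \<phi> N + 0"
    by (rule growth_le[OF growth_limits(2)[OF F] growth_limits(2)[OF assms(1)]])
  then show ?thesis by simp
qed

text \<open>T_n(N)/T_n(F) is a sum of n images of N/F, each of length at most \<open>e\<close>;
  dividing by n leaves \<open>e\<close>.\<close>

lemma growth_approx:
  assumes "fin N" "submodule F S M" "F \<subseteq> N" "rl N \<le> rl F + e"
  shows "growth len M \<phi> N \<le> growth len M \<phi> F + e"
proof -
  have F: "fin F" using fin_mono[OF M_in assms(1-3)] .
  note sN = fin_submoduleD[OF assms(1)]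
  have "rl (traj N n) \<le> rl (traj F n) + 0 + real n * e" for n
  proof (induction n)
    case 0
    then show ?case by (simp add: trajectory_0[OF M_module])
  next
    case (Suc n)
    note p = mod_hom_funpow[OF phi, of n]
    have s: "fin (traj N n)" "fin (traj F n)" "fin ((\<phi> ^^ n) ` N)" "fin ((\<phi> ^^ n) ` F)"
      using fin_trajectory assms(1) F fin_hom[OF M_in M_module p] by auto
    have "rl (msum M (traj N n) ((\<phi> ^^ n) ` N)) - rl (msum M (traj F n) ((\<phi> ^^ n) ` N))
       \<le> rl (traj N n) - rl (traj F n)"
      using s trajectory_mono[OF assms(3)] by (intro rlen_msum_diff M_in) (auto dest: fin_submoduleD)
    moreover have "rl (msum M (traj F n) ((\<phi> ^^ n) ` N)) - rl (msum M (traj F n) ((\<phi> ^^ n) ` F))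
       \<le> rl ((\<phi> ^^ n) ` N) - rl ((\<phi> ^^ n) ` F)"
      using s assms(3) by (intro rlen_msum_diff M_in) (auto dest: fin_submoduleD)
    moreover have "rl ((\<phi> ^^ n) ` N) - rl ((\<phi> ^^ n) ` F) \<le> rl N - rl F"
      by (rule rlen_hom_diff[OF M_in M_module p assms(1-3)])
    ultimately show ?case using Suc assms(4)
      unfolding trajectory_Suc[OF M_module phi submodule_subset[OF sN]]
        trajectory_Suc[OF M_module phi submodule_subset[OF assms(2)]]
      by (simp add: algebra_simps)
  qed
  then show ?thesis
    by (rule growth_le[OF growth_limits(2)[OF assms(1)] growth_limits(2)[OF F]])
qed

lemma growth_fg_approx:
  assumes "fin N" "0 < e"
  shows "\<exists>F\<in>fg_submodules S M. F \<subseteq> N \<and> growth len M \<phi> N \<le> growth len M \<phi> F + e"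
  using rlen_fg_approx[OF M_in assms] growth_approx[OF assms(1)] by (auto simp: fg_submodules_def)

text \<open>For an R[X]-submodule \<open>A\<close> this is the entropy of the restriction
  (\<open>ent_X_res\<close>). Staying in the ambient module lets submodules and kernels be compared
  without changing records.\<close>

definition entropy_on :: "'m set \<Rightarrow> ennreal" where
  "entropy_on A = (SUP N\<in>{N. fin N \<and> N \<subseteq> A}. ennreal (growth len M \<phi> N))"

text \<open>By \<open>growth_fg_approx\<close>, the growth of a submodule of finite length is
  approached by that of its finitely generated submodules. The latter can be lifted along
  surjections, and they match upper continuity over R[X].\<close>

lemma entropy_on_fg:
  "entropy_on A = (SUP F\<in>{F \<in> fg_submodules S M. fin F \<and> F \<subseteq> A}. ennreal (growth len M \<phi> F))"
  (is "_ = ?r")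
proof (rule antisym)
  show "entropy_on A \<le> ?r"
    unfolding entropy_on_def
  proof (rule SUP_least, rule ennreal_le_epsilon)
    fix N and e :: real assume N: "N \<in> {N. fin N \<and> N \<subseteq> A}" and e: "0 < e"
    obtain F where F: "F \<in> fg_submodules S M" "F \<subseteq> N" "growth len M \<phi> N \<le> growth len M \<phi> F + e"
      using growth_fg_approx[of N e] N e by auto
    have "fin F" using fin_mono[OF M_in, of N F] N F by (auto simp: fg_submodules_def)
    then have "ennreal (growth len M \<phi> F) \<le> ?r" using F N by (intro SUP_upper) auto
    moreover have "ennreal (growth len M \<phi> N) \<le> ennreal (growth len M \<phi> F) + ennreal e"
      using F(3) growth_limits(3)[OF \<open>fin F\<close>] e
      by (simp flip: ennreal_plus add: ennreal_leI)
    ultimately show "ennreal (growth len M \<phi> N) \<le> ?r + ennreal e"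
      by (meson add_right_mono order_trans)
  qed
  show "?r \<le> entropy_on A"
    unfolding entropy_on_def by (rule SUP_subset_mono) auto
qed

end

section \<open>The addition theorem\<close>

locale length_endo_hom = M: length_endo S C len M \<phi> + N: length_endo S C len N \<psi>
  for S :: "('s, 'z) ring_scheme" and C :: "('s, 'm) module set" and len and M \<phi> N \<psi> +
  fixes g
  assumes g: "g \<in> mod_hom S M N" and comm: "x \<in> carrier M \<Longrightarrow> g (\<phi> x) = \<psi> (g x)"
begin

lemma trajectory_g:
  assumes "submodule X S M"
  shows "g ` trajectory M \<phi> X n = trajectory N \<psi> (g ` X) n"
  by (rule trajectory_image[OF M.M_module N.M_module M.phi N.phi g comm assms])

lemma growth_inj:
  assumes "inj_on g (carrier M)" "M.fin X"
  shows "growth len N \<psi> (g ` X) = growth len M \<phi> X"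
proof -
  note X = fin_submoduleD[OF assms(2)]
  have "rlen len N (trajectory N \<psi> (g ` X) n) = rlen len M (trajectory M \<phi> X n)" for n
  proof -
    note T = trajectory_submodule[OF M.M_module M.phi X, of n]
    have "inj_on g (trajectory M \<phi> X n)"
      using assms(1) submodule_subset[OF T] inj_on_subset by blast
    from M.len_inj[OF M.M_in N.M_module g T this] show ?thesis
      by (simp add: rlen_def trajectory_g[OF X])
  qed
  then show ?thesis by (simp add: growth_def)
qed

lemma entropy_on_inj:
  assumes "inj_on g (carrier M)"
  shows "N.entropy_on (g ` carrier M) = M.entropy_on (carrier M)"
proof (rule antisym)
  show "M.entropy_on (carrier M) \<le> N.entropy_on (g ` carrier M)"
    unfolding M.entropy_on_def
  proof (rule SUP_least)
    fix X assume X: "X \<in> {X. M.fin X \<and> X \<subseteq> carrier M}"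
    then show "ennreal (growth len M \<phi> X) \<le> N.entropy_on (g ` carrier M)"
      unfolding N.entropy_on_def growth_inj[OF assms, of X, symmetric, simplified]
      using M.fin_hom[OF M.M_in N.M_module g, of X] growth_inj[OF assms, of X]
      by (intro SUP_upper2[of "g ` X"]) auto
  qed
  show "N.entropy_on (g ` carrier M) \<le> M.entropy_on (carrier M)"
    unfolding N.entropy_on_def
  proof (rule SUP_least)
    fix Y assume Y: "Y \<in> {Y. N.fin Y \<and> Y \<subseteq> g ` carrier M}"
    define X where "X = {x \<in> carrier M. g x \<in> Y}"
    have X: "submodule X S M" unfolding X_def
      using Y mod_hom_vimage_submodule[OF M.M_module N.M_module g submodule_carrier[OF M.M_module]]
      by (auto dest: fin_submoduleD)
    have YX: "Y = g ` X" using Y by (auto simp: X_def)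
    have "inj_on g X" using assms by (auto simp: X_def inj_on_def)
    then have "M.fin X" using M.len_inj[OF M.M_in N.M_module g X] Y X
      by (auto simp: fin_submodule_def YX)
    then show "ennreal (growth len N \<psi> Y) \<le> M.entropy_on (carrier M)"
      unfolding M.entropy_on_def YX using growth_inj[OF assms, of X] submodule_subset[OF X]
      by (intro SUP_upper2[of X]) auto
  qed
qed

abbreviation "ker \<equiv> {x \<in> carrier M. g x = \<zero>\<^bsub>N\<^esub>}"

lemma rlen_ker:
  assumes "M.fin X"
  shows "rlen len M X = rlen len M (X \<inter> ker) + rlen len N (g ` X)"
proof -
  have "{x \<in> X. g x = \<zero>\<^bsub>N\<^esub>} = X \<inter> ker"
    using submodule_subset[OF fin_submoduleD[OF assms]] by auto
  then show ?thesis using M.rlen_hom[OF M.M_in N.M_module g assms] by simp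
qed

text \<open>
  \<open>K\<close> is the part in the kernel of a trajectory so long that the increments of its image in \<open>N\<close>
  have almost reached their limit: from then on the trajectory of \<open>X\<close> grows, beyond that of \<open>K\<close>, by
  no more than these increments.
\<close>
lemma growth_upper:
  assumes X: "M.fin X" and e: "0 < e"
  shows "\<exists>K. M.fin K \<and> K \<subseteq> ker \<and>
    growth len M \<phi> X \<le> growth len M \<phi> K + growth len N \<psi> (g ` X) + e"
proof -
  note sX = fin_submoduleD[OF X]
  have gX: "N.fin (g ` X)" by (rule M.fin_hom[OF M.M_in N.M_module g X])
  let ?T = "trajectory M \<phi> X" and ?U = "trajectory N \<psi> (g ` X)"
  note fT = M.fin_trajectory[OF X]
  note T = trajectory_submodule[OF M.M_module M.phi sX]
  note Tup = trajectory_Suc_upper1[OF M.M_module M.phi sX]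
  obtain m where m: "rlen len N (?U (Suc m)) - rlen len N (?U m) < growth len N \<psi> (g ` X) + e"
    using order_tendstoD(2)[OF N.growth_limits(1)[OF gX], of "growth len N \<psi> (g ` X) + e"] e
    by (auto simp: eventually_sequentially)
  define d where "d = rlen len N (?U (Suc m)) - rlen len N (?U m)"
  have sker: "submodule ker S M"
    by (rule mod_hom_kernel_submodule[OF M.M_module N.M_module g submodule_carrier[OF M.M_module]])
  define K where "K = ?T (Suc m) \<inter> ker"
  have sK: "submodule K S M" unfolding K_def by (rule submodule_Int[OF M.M_module T sker])
  have K: "M.fin K" using M.fin_mono[OF M.M_in fT[of "Suc m"] sK] by (simp add: K_def)
  let ?V = "trajectory M \<phi> K"
  note fV = M.fin_trajectory[OF K]
  note V = trajectory_submodule[OF M.M_module M.phi sK]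
  \<comment> \<open>\<open>?W\<close> already contains the whole kernel part \<open>K\<close> of
    \<open>?T (Suc m)\<close>, so what \<open>?T (Suc m)\<close> has beyond \<open>?W\<close> is
    visible in the image, where it amounts to at most \<open>d\<close>.\<close>
  let ?W = "msum M (?T m) K"
  have W: "M.fin ?W" by (rule M.fin_msum[OF M.M_in fT K])
  have W_le: "?W \<subseteq> ?T (Suc m)"
    using Tup[of m] by (intro msum_least[OF M.M_module T]) (auto simp: K_def)
  have jump: "rlen len M (?T (Suc m)) - rlen len M ?W \<le> d"
  proof -
    have "rlen len M K \<le> rlen len M (?W \<inter> ker)"
    proof (rule M.rlen_mono[OF M.M_in _ sK])
      show "M.fin (?W \<inter> ker)"
        by (rule M.fin_mono[OF M.M_in W submodule_Int[OF M.M_module fin_submoduleD[OF W] sker]]) simp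
      show "K \<subseteq> ?W \<inter> ker" using msum_upper2[OF M.M_module T sK] by (auto simp: K_def)
    qed
    moreover have "rlen len N (?U m) \<le> rlen len N (g ` ?W)"
    proof (rule M.rlen_mono[OF N.M_in M.fin_hom[OF M.M_in N.M_module g W]])
      show "submodule (?U m) S N"
        by (rule trajectory_submodule[OF N.M_module N.phi fin_submoduleD[OF gX]])
      show "?U m \<subseteq> g ` ?W"
        unfolding trajectory_g[OF sX, symmetric] using msum_upper1[OF M.M_module T sK] by blast
    qed
    ultimately show ?thesis
      using rlen_ker[OF W] rlen_ker[OF fT, of "Suc m"] unfolding d_def K_def trajectory_g[OF sX]
      by linarith
  qed
  \<comment> \<open>\<open>K\<close> lies in the trajectory of index m + 1, and the highest power of
    \<open>\<phi>\<close> occurring in \<open>?V n\<close> is n - 1; together they give the index n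
    + m.\<close>
  have TV: "?V n \<subseteq> ?T (n + m)" for n
  proof (induction n)
    case 0
    then show ?case using submodule_zero[OF M.M_module T] by (simp add: trajectory_0[OF M.M_module])
  next
    case (Suc n)
    have "(\<phi> ^^ n) ` K \<subseteq> ?T (Suc n + m)"
      using funpow_image_trajectory[OF M.M_module M.phi sX, of n "Suc m"]
      by (auto simp: K_def add.commute)
    then show ?case
      unfolding trajectory_Suc[OF M.M_module M.phi submodule_subset[OF sK]]
      using Suc Tup[of "n + m"] by (intro msum_least[OF M.M_module T]) auto
  qed
  \<comment> \<open>One step of \<open>?T\<close> is compared with one step of \<open>?V\<close>.
    T_(n+1+m) lies in T_(n+m) + phi^n(T_(m+1)); replacing T_(m+1) by \<open>?W\<close> costs at most
    \<open>d\<close>; the summand phi^n(T_m) is absorbed by T_(n+m). What is left, T_(n+m) +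
    phi^n(K), exceeds V_n + phi^n(K) by no more than T_(n+m) exceeds V_n.\<close>
  have "rlen len M (?T (n + m)) \<le> rlen len M (?V n) + rlen len M (?T m) + real n * d" for n
  proof (induction n)
    case (Suc n)
    let ?p = "\<phi> ^^ n"
    note p = mod_hom_funpow[OF M.phi, of n]
    have f: "M.fin (?p ` Y)" if "M.fin Y" for Y by (rule M.fin_hom[OF M.M_in M.M_module p that])
    note s = fin_submoduleD
    have "?T (Suc n + m) \<subseteq> msum M (?T (n + m)) (?p ` ?T (Suc m))"
    proof -
      have "(\<phi> ^^ (n + m)) ` X \<subseteq> ?p ` ?T (Suc m)"
        using trajectory_Suc_upper2[OF M.M_module M.phi sX, of m] by (auto simp: funpow_add)
      then show ?thesis
        unfolding add_Suc trajectory_Suc[OF M.M_module M.phi submodule_subset[OF sX], of "n + m"]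
        by (intro msum_mono) auto
    qed
    then have 1: "rlen len M (?T (Suc n + m)) \<le> rlen len M (msum M (?T (n + m)) (?p ` ?T (Suc m)))"
      by (intro M.rlen_mono[OF M.M_in M.fin_msum[OF M.M_in fT f[OF fT]] T])
    have 2: "rlen len M (msum M (?T (n + m)) (?p ` ?T (Suc m))) - rlen len M (msum M (?T (n + m)) (?p ` ?W))
        \<le> rlen len M (?p ` ?T (Suc m)) - rlen len M (?p ` ?W)"
      using W_le by (intro M.rlen_msum_diff M.M_in f fT W s[OF f[OF W]]) auto
    have 3: "rlen len M (?p ` ?T (Suc m)) - rlen len M (?p ` ?W) \<le> d"
      using M.rlen_hom_diff[OF M.M_in M.M_module p fT s[OF W] W_le] jump by linarith
    have "?p ` ?W \<subseteq> msum M (?T (n + m)) (?p ` K)"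
      unfolding mod_hom_image_msum[OF p submodule_subset[OF T] submodule_subset[OF sK]]
      using funpow_image_trajectory[OF M.M_module M.phi sX, of n m]
      by (intro msum_mono) (auto simp: add.commute)
    then have "msum M (?T (n + m)) (?p ` ?W) \<subseteq> msum M (?T (n + m)) (?p ` K)"
      using msum_upper1[OF M.M_module T s[OF f[OF K]]]
      by (intro msum_least[OF M.M_module] submodule_msum[OF M.M_module] T s[OF f[OF K]]) auto
    then have 4: "rlen len M (msum M (?T (n + m)) (?p ` ?W)) \<le> rlen len M (msum M (?T (n + m)) (?p ` K))"
      by (intro M.rlen_mono[OF M.M_in M.fin_msum[OF M.M_in fT f[OF K]]]
          submodule_msum[OF M.M_module] T s[OF f[OF W]])
    have 5: "rlen len M (msum M (?T (n + m)) (?p ` K)) - rlen len M (msum M (?V n) (?p ` K))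
        \<le> rlen len M (?T (n + m)) - rlen len M (?V n)"
      by (intro M.rlen_msum_diff M.M_in f fT K V TV)
    show ?case
      using 1 2 3 4 5 Suc unfolding trajectory_Suc[OF M.M_module M.phi submodule_subset[OF sK]]
      by (simp add: algebra_simps)
  qed (simp add: rlen_nonneg)
  moreover have "rlen len M (?T n) \<le> rlen len M (?T (n + m))" for n
    by (intro M.rlen_mono[OF M.M_in fT T] trajectory_incseq[OF M.M_module M.phi sX]) simp
  ultimately have "growth len M \<phi> X \<le> growth len M \<phi> K + d"
    by (intro growth_le[OF M.growth_limits(2)[OF X] M.growth_limits(2)[OF K]]) (rule order_trans)
  then show ?thesis using K m by (auto simp: d_def K_def)
qed

text \<open>The kernel is invariant under \<open>\<phi>\<close>, so the trajectory of
  \<open>F\<close> stays in it. The trajectory of F + G thus contains that of \<open>F\<close> in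
  its kernel part and maps onto a module containing the trajectory of \<open>g(G)\<close>.\<close>

lemma growth_lower:
  assumes "M.fin F" "F \<subseteq> ker" "M.fin G"
  shows "growth len M \<phi> F + growth len N \<psi> (g ` G) \<le> growth len M \<phi> (msum M F G)"
proof -
  note s = fin_submoduleD[OF assms(1)] fin_submoduleD[OF assms(3)]
  let ?X = "msum M F G"
  have X: "M.fin ?X" by (rule M.fin_msum[OF M.M_in assms(1,3)])
  note sX = fin_submoduleD[OF X]
  have gG: "N.fin (g ` G)" by (rule M.fin_hom[OF M.M_in N.M_module g assms(3)])
  have sker: "submodule ker S M"
    by (rule mod_hom_kernel_submodule[OF M.M_module N.M_module g submodule_carrier[OF M.M_module]])
  have ker: "\<phi> ` ker \<subseteq> ker"
    using mod_homD(1)[OF M.phi] comm mod_hom_zero[OF N.M_module N.M_module N.phi] by auto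
  have "rlen len M (trajectory M \<phi> F n) + rlen len N (trajectory N \<psi> (g ` G) n)
    \<le> rlen len M (trajectory M \<phi> ?X n) + 0 + real n * 0" for n
  proof -
    note fT = M.fin_trajectory[OF X, of n]
    note T = fin_submoduleD[OF fT]
    have F: "submodule (trajectory M \<phi> F n) S M" and G: "submodule (trajectory M \<phi> G n) S M"
      using trajectory_submodule[OF M.M_module M.phi] s by auto
    have "trajectory M \<phi> F n \<subseteq> trajectory M \<phi> ?X n \<inter> ker"
      using trajectory_least[OF M.M_module M.phi s(1) sker assms(2) ker]
        trajectory_mono[OF msum_upper1[OF M.M_module s]] by blast
    then have "rlen len M (trajectory M \<phi> F n) \<le> rlen len M (trajectory M \<phi> ?X n \<inter> ker)"
      by (intro M.rlen_mono[OF M.M_in] F M.fin_mono[OF M.M_in fT] submodule_Int[OF M.M_module T sker]) auto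
    moreover have "rlen len N (trajectory N \<psi> (g ` G) n) \<le> rlen len N (g ` trajectory M \<phi> ?X n)"
      using image_mono[OF trajectory_mono[OF msum_upper2[OF M.M_module s]], of g M \<phi> n]
      unfolding trajectory_g[OF s(2)]
      by (intro M.rlen_mono[OF N.M_in M.fin_hom[OF M.M_in N.M_module g fT]]
        trajectory_submodule[OF N.M_module N.phi fin_submoduleD[OF gG]])
    ultimately show ?thesis using rlen_ker[OF fT] by simp
  qed
  moreover have "(\<lambda>n. (rlen len M (trajectory M \<phi> F n) + rlen len N (trajectory N \<psi> (g ` G) n)) / real n)
      \<longlonglongrightarrow> growth len M \<phi> F + growth len N \<psi> (g ` G)"
    unfolding add_divide_distrib
    by (intro tendsto_add M.growth_limits(2)[OF assms(1)] N.growth_limits(2)[OF gG])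
  ultimately have "growth len M \<phi> F + growth len N \<psi> (g ` G) \<le> growth len M \<phi> ?X + 0"
    by (intro growth_le[OF _ M.growth_limits(2)[OF X]])
  then show ?thesis by simp
qed

text \<open>The upper bound is \<open>growth_upper\<close> with its error tending to 0; the lower
  bound is \<open>growth_lower\<close> applied to finitely generated lifts of submodules of
  \<open>N\<close>.\<close>

theorem entropy_on_add:
  assumes surj: "g ` carrier M = carrier N" and lfin: "\<And>F. F \<in> fg_submodules S M \<Longrightarrow> M.fin F"
  shows "M.entropy_on (carrier M) = M.entropy_on ker + N.entropy_on (carrier N)"
proof (rule antisym)
  show "M.entropy_on (carrier M) \<le> M.entropy_on ker + N.entropy_on (carrier N)"
    unfolding M.entropy_on_def[of "carrier M"]
  proof (rule SUP_least, rule ennreal_le_epsilon)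
    fix X and e :: real
    assume X: "X \<in> {X. M.fin X \<and> X \<subseteq> carrier M}" and e: "0 < e"
    obtain K where K: "M.fin K" "K \<subseteq> ker"
      "growth len M \<phi> X \<le> growth len M \<phi> K + growth len N \<psi> (g ` X) + e"
      using growth_upper[of X e] X e by auto
    have gX: "N.fin (g ` X)" using X by (intro M.fin_hom[OF M.M_in N.M_module g]) auto
    have "ennreal (growth len M \<phi> X) \<le> ennreal (growth len M \<phi> K + growth len N \<psi> (g ` X) + e)"
      using K(3) by (rule ennreal_leI)
    also have "\<dots> = ennreal (growth len M \<phi> K) + ennreal (growth len N \<psi> (g ` X)) + ennreal e"
      using M.growth_limits(3)[OF K(1)] N.growth_limits(3)[OF gX] e by simp
    also have "\<dots> \<le> M.entropy_on ker + N.entropy_on (carrier N) + ennreal e"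
      unfolding M.entropy_on_def N.entropy_on_def
      using K gX submodule_subset[OF fin_submoduleD[OF gX]] by (intro add_mono SUP_upper) auto
    finally show "ennreal (growth len M \<phi> X) \<le> M.entropy_on ker + N.entropy_on (carrier N) + ennreal e" .
  qed
  \<comment> \<open>\<open>z\<close> and \<open>z'\<close> provide members of the two index sets,
    since a supremum commutes with addition only over a nonempty set.\<close>
  have z: "{\<zero>\<^bsub>M\<^esub>} \<in> {X. M.fin X \<and> X \<subseteq> ker}"
    using submodule_zero_set[OF M.M_module] M.len_zero[OF M.M_in] submodule_zero[OF M.M_module submodule_carrier[OF M.M_module]]
      mod_hom_zero[OF M.M_module N.M_module g] by (auto simp: fin_submodule_def)
  have z': "mod_span S N {} \<in> {F \<in> fg_submodules S N. N.fin F \<and> F \<subseteq> carrier N}"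
  proof -
    have s: "submodule (mod_span S N {}) S N" by (rule mod_span_submodule[OF N.M_module]) simp
    have "mod_span S N {} \<subseteq> {\<zero>\<^bsub>N\<^esub>}" by (rule mod_span_least[OF submodule_zero_set[OF N.M_module]]) simp
    then have "len (res N (mod_span S N {})) \<le> 0"
      using M.len_mono[OF N.M_in s submodule_zero_set[OF N.M_module]] M.len_zero[OF N.M_in] by simp
    then show ?thesis using s submodule_subset[OF s] by (auto simp: fin_submodule_def fg_submodules_def)
  qed
  show "M.entropy_on ker + N.entropy_on (carrier N) \<le> M.entropy_on (carrier M)"
    unfolding M.entropy_on_def[of ker] N.entropy_on_fg
  proof (subst ennreal_SUP_add_left[symmetric])
    show "{X. M.fin X \<and> X \<subseteq> ker} \<noteq> {}" using z by blast
    show "(SUP X\<in>{X. M.fin X \<and> X \<subseteq> ker}. ennreal (growth len M \<phi> X) +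
        (SUP Y\<in>{F \<in> fg_submodules S N. N.fin F \<and> F \<subseteq> carrier N}. ennreal (growth len N \<psi> Y)))
      \<le> M.entropy_on (carrier M)"
    proof (rule SUP_least)
      fix X assume X: "X \<in> {X. M.fin X \<and> X \<subseteq> ker}"
      show "ennreal (growth len M \<phi> X) +
          (SUP Y\<in>{F \<in> fg_submodules S N. N.fin F \<and> F \<subseteq> carrier N}. ennreal (growth len N \<psi> Y))
          \<le> M.entropy_on (carrier M)"
      proof (subst ennreal_SUP_add_right)
        show "{F \<in> fg_submodules S N. N.fin F \<and> F \<subseteq> carrier N} \<noteq> {}" using z' by blast
        show "(SUP Y\<in>{F \<in> fg_submodules S N. N.fin F \<and> F \<subseteq> carrier N}.
            ennreal (growth len M \<phi> X) + ennreal (growth len N \<psi> Y)) \<le> M.entropy_on (carrier M)"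
        proof (rule SUP_least)
          fix Y assume Y: "Y \<in> {F \<in> fg_submodules S N. N.fin F \<and> F \<subseteq> carrier N}"
          \<comment> \<open>Here the restriction to finitely generated \<open>Y\<close> pays off:
            its lift \<open>G\<close> can be taken finitely generated, hence of finite length by
            \<open>lfin\<close>.\<close>
          then obtain G where G: "G \<in> fg_submodules S M" "g ` G = Y"
            using fg_submodules_lift[OF M.M_module N.M_module g, of Y] surj by auto
          note fG = lfin[OF G(1)]
          have s: "M.fin (msum M X G)" using X fG by (intro M.fin_msum[OF M.M_in]) auto
          have "ennreal (growth len M \<phi> X) + ennreal (growth len N \<psi> Y)
              = ennreal (growth len M \<phi> X + growth len N \<psi> Y)"
            using X Y M.growth_limits(3)[of X] N.growth_limits(3)[of Y] by simp
          also have "\<dots> \<le> ennreal (growth len M \<phi> (msum M X G))"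
            using growth_lower[of X G] X fG G by (intro ennreal_leI) auto
          also have "\<dots> \<le> M.entropy_on (carrier M)"
            unfolding M.entropy_on_def using s submodule_subset[OF fin_submoduleD[OF s]]
            by (intro SUP_upper) auto
          finally show "ennreal (growth len M \<phi> X) + ennreal (growth len N \<psi> Y)
            \<le> M.entropy_on (carrier M)" .
        qed
      qed
    qed
  qed
qed

end

section \<open>Modules over the polynomial ring\<close>

text \<open>Constants and X generate R[X] as a ring. The action of every polynomial is thus
  controlled by the R-action and the action of X, which identifies submodules and homomorphisms over
  R[X] with the invariant and equivariant ones over R.\<close>

lemma UP_induct [consumes 2, case_names const X add mult]:
  fixes R :: "('r, 'z) ring_scheme"
  assumes "cring R" "p \<in> carrier (UP R)"
    and const: "\<And>a. a \<in> carrier R \<Longrightarrow> Q (monom (UP R) a 0)"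
    and X: "Q (monom (UP R) \<one>\<^bsub>R\<^esub> 1)"
    and add: "\<And>p q. \<lbrakk>p \<in> carrier (UP R); q \<in> carrier (UP R); Q p; Q q\<rbrakk> \<Longrightarrow> Q (p \<oplus>\<^bsub>UP R\<^esub> q)"
    and mult: "\<And>p q. \<lbrakk>p \<in> carrier (UP R); q \<in> carrier (UP R); Q p; Q q\<rbrakk> \<Longrightarrow> Q (p \<otimes>\<^bsub>UP R\<^esub> q)"
  shows "Q p"
proof -
  interpret UP_cring R "UP R" by (intro UP_cring.intro assms)
  have m: "Q (monom (UP R) a n)" if "a \<in> carrier R" for a n
  proof (induction n)
    case (Suc n)
    have "monom (UP R) a (Suc n) = monom (UP R) a n \<otimes>\<^bsub>UP R\<^esub> monom (UP R) \<one>\<^bsub>R\<^esub> 1"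
      using that monom_mult[of a "\<one>\<^bsub>R\<^esub>" n 1] by simp
    then show ?case using mult[OF _ _ Suc X] that by simp
  qed (use const that in auto)
  have "Q (\<Oplus>\<^bsub>UP R\<^esub>i\<in>{..n}. monom (UP R) (coeff (UP R) p i) i)" for n
  proof (induction n)
    case 0
    then show ?case using m assms(2) by (simp add: Pi_iff)
  next
    case (Suc n)
    then show ?case using m assms(2) by (auto simp: Pi_iff intro!: add)
  qed
  then show ?thesis using up_repr[OF assms(2)] by metis
qed

lemma abelian_group_cong:
  assumes "abelian_group G" "carrier H = carrier G" "add H = add G" "\<zero>\<^bsub>H\<^esub> = \<zero>\<^bsub>G\<^esub>"
  shows "abelian_group H"
proof -
  interpret G: abelian_group G by fact
  show ?thesis
    by (rule abelian_groupI) (use assms(2-4) G.l_neg in \<open>auto simp: G.add.m_ac intro!: bexI[of _ "\<ominus>\<^bsub>G\<^esub> _"]\<close>)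
qed

lemma module_underlying:
  fixes R :: "'r ring"
  assumes "cring R" "module (UP R) P"
  shows "module R (underlying R P)"
proof -
  interpret UP_cring R "UP R" by (intro UP_cring.intro assms)
  interpret PM: module "UP R" P by fact
  have mm: "monom (UP R) (a \<otimes>\<^bsub>R\<^esub> b) 0 = monom (UP R) a 0 \<otimes>\<^bsub>UP R\<^esub> monom (UP R) b 0"
    if "a \<in> carrier R" "b \<in> carrier R" for a b
    using monom_mult[of a b 0 0] that by simp
  show ?thesis
  proof (rule moduleI)
    show "abelian_group (underlying R P)"
      by (rule abelian_group_cong[OF PM.M.abelian_group_axioms]) (simp_all add: underlying_def)
  qed (auto simp: assms underlying_def PM.smult_l_distr PM.smult_r_distr mm PM.smult_assoc1)
qed

lemma underlying_simps [simp]: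
  "carrier (underlying R P) = carrier P" "\<zero>\<^bsub>underlying R P\<^esub> = \<zero>\<^bsub>P\<^esub>" "add (underlying R P) = add P"
  "smult (underlying R P) a x = monom (UP R) a 0 \<odot>\<^bsub>P\<^esub> x"
  by (simp_all add: underlying_def)

lemma underlying_res: "underlying R (res P A) = res (underlying R P) A"
  by (simp add: underlying_def)

lemma X_action_res: "X_action R (res P A) = X_action R P"
  by (simp add: X_action_def fun_eq_iff)

lemma X_action_hom:
  fixes R :: "'r ring"
  assumes "cring R" "module (UP R) P"
  shows "X_action R P \<in> mod_hom R (underlying R P) (underlying R P)"
proof -
  interpret UP_cring R "UP R" by (intro UP_cring.intro assms)
  interpret PM: module "UP R" P by fact
  have "monom (UP R) \<one>\<^bsub>R\<^esub> 1 \<odot>\<^bsub>P\<^esub> (monom (UP R) a 0 \<odot>\<^bsub>P\<^esub> x)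
      = monom (UP R) a 0 \<odot>\<^bsub>P\<^esub> (monom (UP R) \<one>\<^bsub>R\<^esub> 1 \<odot>\<^bsub>P\<^esub> x)"
    if "a \<in> carrier R" "x \<in> carrier P" for a x
    using that by (simp flip: PM.smult_assoc1 monom_mult)
  then show ?thesis by (auto simp: mod_hom_def X_action_def PM.smult_r_distr)
qed

lemma submodule_UP_iff:
  fixes R :: "'r ring"
  assumes "cring R" "module (UP R) P"
  shows "submodule A (UP R) P \<longleftrightarrow> submodule A R (underlying R P) \<and> X_action R P ` A \<subseteq> A"
proof -
  interpret UP_cring R "UP R" by (intro UP_cring.intro assms)
  interpret PM: module "UP R" P by fact
  interpret U: module R "underlying R P" by (rule module_underlying[OF assms])
  show ?thesis
  proof
    assume "submodule A (UP R) P"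
    then show "submodule A R (underlying R P) \<and> X_action R P ` A \<subseteq> A"
      by (auto simp: PM.submodule_iff U.submodule_iff X_action_def)
  next
    assume A: "submodule A R (underlying R P) \<and> X_action R P ` A \<subseteq> A"
    then have A': "A \<subseteq> carrier P" "\<zero>\<^bsub>P\<^esub> \<in> A" "\<And>x y. x \<in> A \<Longrightarrow> y \<in> A \<Longrightarrow> x \<oplus>\<^bsub>P\<^esub> y \<in> A"
      "\<And>a x. a \<in> carrier R \<Longrightarrow> x \<in> A \<Longrightarrow> monom (UP R) a 0 \<odot>\<^bsub>P\<^esub> x \<in> A"
      by (auto simp: U.submodule_iff)
    have "\<forall>x\<in>A. p \<odot>\<^bsub>P\<^esub> x \<in> A" if "p \<in> carrier (UP R)" for p
      using assms(1) that
    proof (induction p rule: UP_induct)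
      case X
      then show ?case using A by (auto simp: X_action_def)
    next
      case (add p q)
      then show ?case using A' by (auto simp: PM.smult_l_distr subset_iff)
    next
      case (mult p q)
      then show ?case using A' by (auto simp: PM.smult_assoc1 subset_iff)
    qed (use A' in auto)
    then show "submodule A (UP R) P" using A' by (auto simp: PM.submodule_iff)
  qed
qed

lemma mod_hom_UP_iff:
  fixes R :: "'r ring"
  assumes "cring R" "module (UP R) P" "module (UP R) P'"
  shows "f \<in> mod_hom (UP R) P P' \<longleftrightarrow> f \<in> mod_hom R (underlying R P) (underlying R P') \<and>
    (\<forall>x\<in>carrier P. f (X_action R P x) = X_action R P' (f x))"
proof -
  interpret UP_cring R "UP R" by (intro UP_cring.intro assms)
  interpret PM: module "UP R" P by fact
  interpret PM': module "UP R" P' by fact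
  show ?thesis
  proof
    assume "f \<in> mod_hom (UP R) P P'"
    then show "f \<in> mod_hom R (underlying R P) (underlying R P') \<and>
      (\<forall>x\<in>carrier P. f (X_action R P x) = X_action R P' (f x))"
      by (auto simp: mod_hom_def X_action_def)
  next
    assume f: "f \<in> mod_hom R (underlying R P) (underlying R P') \<and>
      (\<forall>x\<in>carrier P. f (X_action R P x) = X_action R P' (f x))"
    then have f': "f \<in> carrier P \<rightarrow> carrier P'"
      "\<And>x y. x \<in> carrier P \<Longrightarrow> y \<in> carrier P \<Longrightarrow> f (x \<oplus>\<^bsub>P\<^esub> y) = f x \<oplus>\<^bsub>P'\<^esub> f y"
      "\<And>a x. a \<in> carrier R \<Longrightarrow> x \<in> carrier P \<Longrightarrow> f (monom (UP R) a 0 \<odot>\<^bsub>P\<^esub> x) = monom (UP R) a 0 \<odot>\<^bsub>P'\<^esub> f x"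
      by (auto simp: mod_hom_def)
    have fc: "f x \<in> carrier P'" if "x \<in> carrier P" for x using f'(1) that by auto
    have "\<forall>x\<in>carrier P. f (p \<odot>\<^bsub>P\<^esub> x) = p \<odot>\<^bsub>P'\<^esub> f x" if "p \<in> carrier (UP R)" for p
      using assms(1) that
    proof (induction p rule: UP_induct)
      case X
      then show ?case using f by (auto simp: X_action_def)
    next
      case (add p q)
      then show ?case using f' fc by (simp add: PM.smult_l_distr PM'.smult_l_distr)
    next
      case (mult p q)
      then show ?case using f' fc by (simp add: PM.smult_assoc1 PM'.smult_assoc1)
    qed (use f' in auto)
    then show "f \<in> mod_hom (UP R) P P'" using f' by (auto simp: mod_hom_def)
  qed
qed

lemma mod_hom_finsum:
  assumes "module S M" "module S N" "f \<in> mod_hom S M N" "finite A" "h \<in> A \<rightarrow> carrier M"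
  shows "f (\<Oplus>\<^bsub>M\<^esub>i\<in>A. h i) = (\<Oplus>\<^bsub>N\<^esub>i\<in>A. f (h i))"
proof -
  interpret M: module S M by fact
  interpret N: module S N by fact
  show ?thesis using assms(4,5)
  proof (induction A)
    case empty
    then show ?case using mod_hom_zero[OF assms(1-3)] by simp
  next
    case (insert x A)
    have "(\<Oplus>\<^bsub>M\<^esub>i\<in>A. h i) \<in> carrier M" using insert by (intro M.finsum_closed) auto
    then show ?case using insert mod_homD[OF assms(3)] by (simp add: Pi_iff)
  qed
qed

section \<open>From an endomorphism to an R[X]-module\<close>

context
  fixes R :: "'r ring" and M :: "('r, 'm) module" and \<phi>
  assumes R: "cring R" and M: "module R M" and phi: "\<phi> \<in> mod_hom R M M"
begin

interpretation UP_cring R "UP R" by (intro UP_cring.intro R)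
interpretation M: module R M by (rule M)

lemma poly_module_simps [simp]:
  "carrier (poly_module R M \<phi>) = carrier M" "\<zero>\<^bsub>poly_module R M \<phi>\<^esub> = \<zero>\<^bsub>M\<^esub>"
  "add (poly_module R M \<phi>) = add M"
  by (simp_all add: poly_module_def)

text \<open>In the definition the index set is the support of \<open>p\<close>. An interval that
  contains several supports at once makes the sums comparable term by term.\<close>

lemma poly_smult:
  assumes "p \<in> carrier (UP R)" "x \<in> carrier M" "\<And>i. n < i \<Longrightarrow> coeff (UP R) p i = \<zero>\<^bsub>R\<^esub>"
  shows "p \<odot>\<^bsub>poly_module R M \<phi>\<^esub> x = (\<Oplus>\<^bsub>M\<^esub>i\<in>{..n}. coeff (UP R) p i \<odot>\<^bsub>M\<^esub> (\<phi> ^^ i) x)"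
proof -
  have "{i. coeff (UP R) p i \<noteq> \<zero>\<^bsub>R\<^esub>} \<subseteq> {..n}" using assms(3) by (metis (mono_tags) atMost_iff mem_Collect_eq not_le subsetI)
  then show ?thesis
    using assms(1,2) mod_homD(1)[OF mod_hom_funpow[OF phi]]
    by (auto simp: poly_module_def intro!: M.add.finprod_mono_neutral_cong_left)
qed

lemma poly_smult_monom:
  assumes "a \<in> carrier R" "x \<in> carrier M"
  shows "monom (UP R) a 0 \<odot>\<^bsub>poly_module R M \<phi>\<^esub> x = a \<odot>\<^bsub>M\<^esub> x"
    and "monom (UP R) \<one>\<^bsub>R\<^esub> 1 \<odot>\<^bsub>poly_module R M \<phi>\<^esub> x = \<phi> x"
proof -
  show "monom (UP R) a 0 \<odot>\<^bsub>poly_module R M \<phi>\<^esub> x = a \<odot>\<^bsub>M\<^esub> x"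
    using assms by (subst poly_smult[where n = 0]) auto
  show "monom (UP R) \<one>\<^bsub>R\<^esub> 1 \<odot>\<^bsub>poly_module R M \<phi>\<^esub> x = \<phi> x"
    using assms mod_homD(1)[OF phi assms(2)] mod_homD(1)[OF mod_hom_funpow[OF phi] assms(2)]
    by (subst poly_smult[where n = 1]) (auto simp: Pi_iff)
qed

text \<open>The axiom with content is associativity. \<open>UP_induct\<close> reduces it to a left
  factor that is a constant or X, where the coefficients of the product are explicit and no
  convolution appears.\<close>

lemma module_poly_module: "module (UP R) (poly_module R M \<phi>)"
proof -
  let ?P = "poly_module R M \<phi>"
  have phc: "(\<phi> ^^ i) x \<in> carrier M" if "x \<in> carrier M" for x i
    using mod_homD(1)[OF mod_hom_funpow[OF phi] that] .
  have bd: "\<exists>n. \<forall>i>n. coeff (UP R) p i = \<zero>\<^bsub>R\<^esub>" if "p \<in> carrier (UP R)" for p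
    using deg_aboveD[OF _ that] by blast
  have cl: "p \<odot>\<^bsub>?P\<^esub> x \<in> carrier M" if p: "p \<in> carrier (UP R)" and x: "x \<in> carrier M" for p x
  proof -
    obtain n where "\<forall>i>n. coeff (UP R) p i = \<zero>\<^bsub>R\<^esub>" using bd[OF p] by blast
    then show ?thesis using p x phc by (subst poly_smult[where n = n]) (auto intro!: M.finsum_closed)
  qed
  have ld: "(p \<oplus>\<^bsub>UP R\<^esub> q) \<odot>\<^bsub>?P\<^esub> x = (p \<odot>\<^bsub>?P\<^esub> x) \<oplus>\<^bsub>M\<^esub> (q \<odot>\<^bsub>?P\<^esub> x)"
    if p: "p \<in> carrier (UP R)" and q: "q \<in> carrier (UP R)" and x: "x \<in> carrier M" for p q x
  proof -
    obtain n m where nm: "\<forall>i>n. coeff (UP R) p i = \<zero>\<^bsub>R\<^esub>" "\<forall>i>m. coeff (UP R) q i = \<zero>\<^bsub>R\<^esub>"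
      using bd[OF p] bd[OF q] by blast
    show ?thesis
      using p q x phc nm
      by (simp add: poly_smult[where n = "max n m"] M.smult_l_distr M.finsum_addf Pi_iff)
  qed
  have Xq: "(monom (UP R) \<one>\<^bsub>R\<^esub> 1 \<otimes>\<^bsub>UP R\<^esub> q) \<odot>\<^bsub>?P\<^esub> x = \<phi> (q \<odot>\<^bsub>?P\<^esub> x)"
    if q: "q \<in> carrier (UP R)" and x: "x \<in> carrier M" for q x
  proof -
    obtain n where n: "\<forall>i>n. coeff (UP R) q i = \<zero>\<^bsub>R\<^esub>" using bd[OF q] by blast
    have c: "coeff (UP R) (monom (UP R) \<one>\<^bsub>R\<^esub> 1 \<otimes>\<^bsub>UP R\<^esub> q) (Suc i) = coeff (UP R) q i" for i
      using coeff_monom_mult[of "\<one>\<^bsub>R\<^esub>" q 1 i] q by simp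
    have c0: "coeff (UP R) (monom (UP R) \<one>\<^bsub>R\<^esub> 1 \<otimes>\<^bsub>UP R\<^esub> q) 0 = \<zero>\<^bsub>R\<^esub>" using q by simp
    have "(monom (UP R) \<one>\<^bsub>R\<^esub> 1 \<otimes>\<^bsub>UP R\<^esub> q) \<odot>\<^bsub>?P\<^esub> x
       = (\<Oplus>\<^bsub>M\<^esub>i\<in>{..Suc n}. coeff (UP R) (monom (UP R) \<one>\<^bsub>R\<^esub> 1 \<otimes>\<^bsub>UP R\<^esub> q) i \<odot>\<^bsub>M\<^esub> (\<phi> ^^ i) x)"
    proof (rule poly_smult)
      fix i assume "Suc n < i"
      then show "coeff (UP R) (monom (UP R) \<one>\<^bsub>R\<^esub> 1 \<otimes>\<^bsub>UP R\<^esub> q) i = \<zero>\<^bsub>R\<^esub>"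
        using c[of "i - 1"] n by (cases i) auto
    qed (use q x in auto)
    also have "\<dots> = (\<Oplus>\<^bsub>M\<^esub>i\<in>{..n}. coeff (UP R) q i \<odot>\<^bsub>M\<^esub> (\<phi> ^^ Suc i) x)"
      using q x phc mod_homD(1)[OF phi]
      by (subst M.finsum_Suc2) (auto simp: c[unfolded One_nat_def] c0[unfolded One_nat_def] simp del: coeff_mult funpow.simps)
    also have "\<dots> = (\<Oplus>\<^bsub>M\<^esub>i\<in>{..n}. \<phi> (coeff (UP R) q i \<odot>\<^bsub>M\<^esub> (\<phi> ^^ i) x))"
      using q x phc mod_homD[OF phi] by (intro M.finsum_cong') auto
    also have "\<dots> = \<phi> (\<Oplus>\<^bsub>M\<^esub>i\<in>{..n}. coeff (UP R) q i \<odot>\<^bsub>M\<^esub> (\<phi> ^^ i) x)"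
      using q x phc by (subst mod_hom_finsum[OF M M phi]) auto
    also have "\<dots> = \<phi> (q \<odot>\<^bsub>?P\<^esub> x)" using q x n by (simp add: poly_smult[where n = n])
    finally show ?thesis .
  qed
  have aq: "(monom (UP R) a 0 \<otimes>\<^bsub>UP R\<^esub> q) \<odot>\<^bsub>?P\<^esub> x = a \<odot>\<^bsub>M\<^esub> (q \<odot>\<^bsub>?P\<^esub> x)"
    if a: "a \<in> carrier R" and q: "q \<in> carrier (UP R)" and x: "x \<in> carrier M" for a q x
  proof -
    obtain n where n: "\<forall>i>n. coeff (UP R) q i = \<zero>\<^bsub>R\<^esub>" using bd[OF q] by blast
    have "(monom (UP R) a 0 \<otimes>\<^bsub>UP R\<^esub> q) \<odot>\<^bsub>?P\<^esub> x
        = (\<Oplus>\<^bsub>M\<^esub>i\<in>{..n}. a \<odot>\<^bsub>M\<^esub> (coeff (UP R) q i \<odot>\<^bsub>M\<^esub> (\<phi> ^^ i) x))"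
      using a q x n phc unfolding monom_mult_is_smult[OF a q]
      by (subst poly_smult[where n = n]) (auto simp: M.smult_assoc1 intro!: M.finsum_cong')
    also have "\<dots> = a \<odot>\<^bsub>M\<^esub> (\<Oplus>\<^bsub>M\<^esub>i\<in>{..n}. coeff (UP R) q i \<odot>\<^bsub>M\<^esub> (\<phi> ^^ i) x)"
      using a q x phc by (subst M.finsum_smult_ldistr) auto
    also have "\<dots> = a \<odot>\<^bsub>M\<^esub> (q \<odot>\<^bsub>?P\<^esub> x)" using q x n by (simp add: poly_smult[where n = n])
    finally show ?thesis .
  qed
  have assoc: "\<forall>q\<in>carrier (UP R). \<forall>x\<in>carrier M. (p \<otimes>\<^bsub>UP R\<^esub> q) \<odot>\<^bsub>?P\<^esub> x = p \<odot>\<^bsub>?P\<^esub> (q \<odot>\<^bsub>?P\<^esub> x)"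
    if "p \<in> carrier (UP R)" for p
    using R that
  proof (induction p rule: UP_induct)
    case (const a)
    then show ?case by (simp add: aq poly_smult_monom cl)
  next
    case X
    show ?case using poly_smult_monom(2)[OF R.one_closed cl] Xq by auto
  next
    case (add p p')
    then show ?case by (simp add: P.l_distr ld cl)
  next
    case (mult p p')
    then show ?case by (simp add: P.m_assoc cl)
  qed
  show ?thesis
  proof (rule moduleI)
    show "cring (UP R)" by (rule UP_cring)
    show "abelian_group ?P"
      by (rule abelian_group_cong[OF M.abelian_group_axioms]) simp_all
  next
    fix p x y assume pxy: "p \<in> carrier (UP R)" "x \<in> carrier ?P" "y \<in> carrier ?P"
    obtain n where n: "\<forall>i>n. coeff (UP R) p i = \<zero>\<^bsub>R\<^esub>" using bd[OF pxy(1)] by blast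
    show "p \<odot>\<^bsub>?P\<^esub> (x \<oplus>\<^bsub>?P\<^esub> y) = (p \<odot>\<^bsub>?P\<^esub> x) \<oplus>\<^bsub>?P\<^esub> (p \<odot>\<^bsub>?P\<^esub> y)"
      using pxy n phc mod_homD(2)[OF mod_hom_funpow[OF phi]]
      by (simp add: poly_smult[where n = n] M.smult_r_distr M.finsum_addf Pi_iff)
  next
    fix x assume "x \<in> carrier ?P"
    then show "\<one>\<^bsub>UP R\<^esub> \<odot>\<^bsub>?P\<^esub> x = x" using poly_smult_monom(1)[of "\<one>\<^bsub>R\<^esub>" x] by simp
  qed (use cl ld assoc in auto)
qed

lemma X_action_poly_module: "x \<in> carrier M \<Longrightarrow> X_action R (poly_module R M \<phi>) x = \<phi> x"
  by (simp only: X_action_def poly_smult_monom(2)[OF R.one_closed])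

lemma mod_hom_poly_module:
  "f \<in> mod_hom R (underlying R (poly_module R M \<phi>)) N \<longleftrightarrow> f \<in> mod_hom R M N"
  "f' \<in> mod_hom R K (underlying R (poly_module R M \<phi>)) \<longleftrightarrow> f' \<in> mod_hom R K M"
  by (auto simp: mod_hom_def poly_smult_monom Pi_iff)

end

section \<open>The entropy as a length function\<close>

locale entropy_setting =
  fixes R :: "'r ring" and L :: "('r, 'm) module \<Rightarrow> ennreal"
  assumes R: "cring R" and L: "length_function R {M. module R M} L"
begin

sublocale length_fun R "{M. module R M}" L
  by (intro length_fun.intro L) (auto simp: module_res)

lemma lFin_XD:
  assumes "P \<in> lFin_X R L"
  shows "module (UP R) P" "module R (underlying R P)"
    "F \<in> fg_submodules R (underlying R P) \<Longrightarrow> fin_submodule R L (underlying R P) F"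
proof -
  show P: "module (UP R) P" using assms by (simp add: lFin_X_def)
  show "module R (underlying R P)" by (rule module_underlying[OF R P])
  show "F \<in> fg_submodules R (underlying R P) \<Longrightarrow> fin_submodule R L (underlying R P) F"
    using assms by (auto simp: lFin_X_def locally_finite_def Fin_sub_def fin_submodule_def)
qed

lemma lFin_XI:
  assumes "module (UP R) P"
    "\<And>F. F \<in> fg_submodules R (underlying R P) \<Longrightarrow> fin_submodule R L (underlying R P) F"
  shows "P \<in> lFin_X R L"
  using assms by (auto simp: lFin_X_def locally_finite_def Fin_sub_def fin_submodule_def)

lemma length_endo_X:
  "module (UP R) P \<Longrightarrow> length_endo R {M. module R M} L (underlying R P) (X_action R P)"
  using length_fun_axioms module_underlying[OF R] X_action_hom[OF R]
  by (auto intro!: length_endo.intro length_endo_axioms.intro)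

lemma ent_X_eq:
  assumes "module (UP R) P"
  shows "ent_X R L P = length_endo.entropy_on R L (underlying R P) (X_action R P) (carrier P)"
proof -
  interpret length_endo R "{M. module R M}" L "underlying R P" "X_action R P"
    by (rule length_endo_X[OF assms])
  have "Fin_sub R L (underlying R P) = {N. fin N \<and> N \<subseteq> carrier P}"
    using submodule_subset[of _ R "underlying R P"] by (auto simp: Fin_sub_def fin_submodule_def)
  then show ?thesis
    unfolding ent_X_def ent_def entropy_on_def by (intro SUP_cong) (auto simp: ent_sub_eq_growth)
qed

lemma length_endo_hom_X:
  assumes "module (UP R) P" "module (UP R) P'" "f \<in> mod_hom (UP R) P P'"
  shows "length_endo_hom R {M. module R M} L (underlying R P) (X_action R P)
    (underlying R P') (X_action R P') f"
  using assms length_endo_X mod_hom_UP_iff[OF R assms(1,2)]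
  by (auto intro!: length_endo_hom.intro length_endo_hom_axioms.intro)

lemma lFin_X_res:
  assumes "P \<in> lFin_X R L" "submodule A (UP R) P"
  shows "res P A \<in> lFin_X R L"
proof (rule lFin_XI)
  note P = lFin_XD[OF assms(1)]
  show "module (UP R) (res P A)" by (rule module_res[OF P(1) assms(2)])
  have A: "submodule A R (underlying R P)" using assms(2) submodule_UP_iff[OF R P(1)] by simp
  fix F assume "F \<in> fg_submodules R (underlying R (res P A))"
  then have "F \<in> fg_submodules R (underlying R P)" "F \<subseteq> A"
    by (auto simp: underlying_res fg_submodules_res[OF P(2) A])
  with P(3) have "fin_submodule R L (underlying R P) F" by simp
  then show "fin_submodule R L (underlying R (res P A)) F"
    using \<open>F \<subseteq> A\<close> by (simp add: fin_submodule_def underlying_res submodule_res_iff[OF P(2) A])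
qed

lemma lFin_X_image:
  assumes "P \<in> lFin_X R L" "module (UP R) P'" "f \<in> mod_hom (UP R) P P'" "f ` carrier P = carrier P'"
  shows "P' \<in> lFin_X R L"
proof (rule lFin_XI[OF assms(2)])
  note P = lFin_XD[OF assms(1)]
  note P' = module_underlying[OF R assms(2)]
  have f: "f \<in> mod_hom R (underlying R P) (underlying R P')"
    using assms(3) mod_hom_UP_iff[OF R P(1) assms(2)] by simp
  fix F assume F: "F \<in> fg_submodules R (underlying R P')"
  then have "F \<subseteq> f ` carrier (underlying R P)"
    using assms(4) submodule_subset[of F R "underlying R P'"] by (simp add: fg_submodules_def)
  then obtain G where "G \<in> fg_submodules R (underlying R P)" "f ` G = F"
    using fg_submodules_lift[OF P(2) P' f F] by auto
  moreover have "underlying R P \<in> {M. module R M}" using P(2) by simp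
  ultimately show "fin_submodule R L (underlying R P') F"
    using fin_hom[OF _ P' f P(3)] by metis
qed

lemma length_fun_X:
  "length_function (UP R) (lFin_X R L) LX \<Longrightarrow> length_fun (UP R) (lFin_X R L) LX"
  by (rule length_fun.intro[OF _ lFin_XD(1) lFin_X_res lFin_X_image])

text \<open>The kernel of \<open>g\<close> is the image of \<open>f\<close>, and
  \<open>entropy_on_inj\<close> identifies the entropy inside that image with the entropy of
  \<open>A\<close>.\<close>

lemma ent_X_exact:
  assumes "A \<in> lFin_X R L" "B \<in> lFin_X R L" "D \<in> lFin_X R L" "mod_short_exact (UP R) A f B g D"
  shows "ent_X R L B = ent_X R L A + ent_X R L D"
proof -
  note M = lFin_XD[OF assms(1)] lFin_XD[OF assms(2)] lFin_XD[OF assms(3)]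
  have ex: "f \<in> mod_hom (UP R) A B" "g \<in> mod_hom (UP R) B D" "inj_on f (carrier A)"
     "f ` carrier A = {x \<in> carrier B. g x = \<zero>\<^bsub>D\<^esub>}" "g ` carrier B = carrier D"
    using assms(4) by (auto simp: mod_short_exact_def)
  interpret f: length_endo_hom R "{M. module R M}" L "underlying R A" "X_action R A"
    "underlying R B" "X_action R B" f
    by (rule length_endo_hom_X[OF M(1,4) ex(1)])
  interpret g: length_endo_hom R "{M. module R M}" L "underlying R B" "X_action R B"
    "underlying R D" "X_action R D" g
    by (rule length_endo_hom_X[OF M(4,7) ex(2)])
  show ?thesis
    using g.entropy_on_add M(6) f.entropy_on_inj ex(3,4,5)
    by (simp add: ent_X_eq M)
qed

lemma ent_X_res:
  assumes "module (UP R) P" "submodule A (UP R) P"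
  shows "ent_X R L (res P A) = length_endo.entropy_on R L (underlying R P) (X_action R P) A"
proof -
  note PA = module_res[OF assms]
  have "(\<lambda>x. x) \<in> mod_hom (UP R) (res P A) P"
    using submodule_subset[OF assms(2)] by (auto simp: mod_hom_def)
  then interpret i: length_endo_hom R "{M. module R M}" L "underlying R (res P A)" "X_action R (res P A)"
    "underlying R P" "X_action R P" "\<lambda>x. x"
    by (rule length_endo_hom_X[OF PA assms(1)])
  show ?thesis using i.entropy_on_inj by (simp add: ent_X_eq PA)
qed

text \<open>Since X maps each trajectory of \<open>N\<close> into the next, their union is the
  R[X]-span of the generators of \<open>N\<close>. This links finite generation over R, used for
  entropy, with finite generation over R[X], used for upper continuity.\<close>

lemma fg_submodules_UP:
  assumes "module (UP R) P" "N \<in> fg_submodules R (underlying R P)"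
  shows "\<exists>G\<in>fg_submodules (UP R) P. N \<subseteq> G \<and> G = (\<Union>n. trajectory (underlying R P) (X_action R P) N n)"
proof -
  obtain E where E: "finite E" "N = mod_span R (underlying R P) E" "E \<subseteq> carrier P"
      "submodule N R (underlying R P)"
    using assms(2) by (auto simp: fg_submodules_def)
  note U = module_underlying[OF R assms(1)] and X = X_action_hom[OF R assms(1)]
  let ?T = "trajectory (underlying R P) (X_action R P) N"
  note T = trajectory_submodule[OF U X E(4)]
  have EN: "E \<subseteq> N" unfolding E(2) by (rule mod_span_upper)
  have N: "N \<subseteq> (\<Union>n. ?T n)" using trajectory_1[OF U X E(4)] by blast
  have s: "submodule (\<Union>n. ?T n) (UP R) P"
    unfolding submodule_UP_iff[OF R assms(1)]
    using submodule_UN_chain[where A = ?T, OF U T trajectory_Suc_upper1[OF U X E(4)]]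
      funpow_image_trajectory[OF U X E(4), of 1] by force
  have G: "submodule (mod_span (UP R) P E) (UP R) P" by (rule mod_span_submodule[OF assms(1) E(3)])
  have "mod_span (UP R) P E = (\<Union>n. ?T n)"
  proof
    show "mod_span (UP R) P E \<subseteq> (\<Union>n. ?T n)"
      using s EN N by (intro mod_span_least) auto
    have "submodule (mod_span (UP R) P E) R (underlying R P)"
      "X_action R P ` mod_span (UP R) P E \<subseteq> mod_span (UP R) P E"
      using G submodule_UP_iff[OF R assms(1)] by auto
    then show "(\<Union>n. ?T n) \<subseteq> mod_span (UP R) P E"
      unfolding E(2) using mod_span_upper[of E "UP R" P] E(2,4)
      by (intro UN_least trajectory_least[OF U X] mod_span_least) auto
  qed
  then show ?thesis using N E(1,3) G by (auto simp: fg_submodules_def)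
qed

text \<open>Finitely generated R-submodules compute the entropy by \<open>entropy_on_fg\<close>, and
  each of them lies in a finitely generated R[X]-submodule.\<close>

lemma ent_X_fg:
  assumes "P \<in> lFin_X R L"
  shows "ent_X R L P = (SUP G\<in>fg_submodules (UP R) P. ent_X R L (res P G))"
proof -
  note P = lFin_XD(1)[OF assms]
  interpret length_endo R "{M. module R M}" L "underlying R P" "X_action R P"
    by (rule length_endo_X[OF P])
  have "ent_X R L P = entropy_on (carrier P)" by (rule ent_X_eq[OF P])
  also have "\<dots> = (SUP G\<in>fg_submodules (UP R) P. entropy_on G)"
  proof (rule antisym)
    show "entropy_on (carrier P) \<le> (SUP G\<in>fg_submodules (UP R) P. entropy_on G)"
      unfolding entropy_on_fg[of "carrier P"]
    proof (rule SUP_least)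
      fix N assume N: "N \<in> {F \<in> fg_submodules R (underlying R P). fin F \<and> F \<subseteq> carrier P}"
      then obtain G where G: "G \<in> fg_submodules (UP R) P" "N \<subseteq> G"
        using fg_submodules_UP[OF P, of N] by auto
      have "ennreal (growth L (underlying R P) (X_action R P) N) \<le> entropy_on G"
        unfolding entropy_on_def using N G by (intro SUP_upper) auto
      then show "ennreal (growth L (underlying R P) (X_action R P) N)
        \<le> (SUP G\<in>fg_submodules (UP R) P. entropy_on G)"
        using G(1) by (rule SUP_upper2[rotated])
    qed
    show "(SUP G\<in>fg_submodules (UP R) P. entropy_on G) \<le> entropy_on (carrier P)"
    proof (rule SUP_least)
      fix G assume "G \<in> fg_submodules (UP R) P"
      then have "G \<subseteq> carrier P" by (auto simp: fg_submodules_def dest: submodule_subset)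
      then show "entropy_on G \<le> entropy_on (carrier P)"
        unfolding entropy_on_def by (intro SUP_subset_mono) auto
    qed
  qed
  also have "\<dots> = (SUP G\<in>fg_submodules (UP R) P. ent_X R L (res P G))"
    by (intro SUP_cong refl ent_X_res[OF P, symmetric]) (auto simp: fg_submodules_def)
  finally show ?thesis .
qed

lemma ent_X_zero:
  assumes "module (UP R) P" "carrier P = {\<zero>\<^bsub>P\<^esub>}"
  shows "ent_X R L P = 0"
proof -
  interpret length_endo R "{M. module R M}" L "underlying R P" "X_action R P"
    by (rule length_endo_X[OF assms(1)])
  have "growth L (underlying R P) (X_action R P) N = 0" if "fin N" for N
  proof -
    have "traj N n = {\<zero>\<^bsub>underlying R P\<^esub>}" for n
      using submodule_subset[OF fin_submoduleD[OF fin_trajectory[OF that]], of n]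
        submodule_zero[OF M_module fin_submoduleD[OF fin_trajectory[OF that]], of n] assms(2) by auto
    then have "(\<lambda>n. rl (traj N n) / real n) = (\<lambda>n. 0)"
      using len_zero[OF M_in] by (simp add: rlen_def)
    then show ?thesis using growth_limits(2)[OF that] LIMSEQ_unique tendsto_const by metis
  qed
  then have "entropy_on (carrier P) \<le> 0" unfolding entropy_on_def by (intro SUP_least) auto
  then show ?thesis by (simp add: ent_X_eq[OF assms(1)])
qed

theorem ent_X_length_function: "length_function (UP R) (lFin_X R L) (ent_X R L)"
  unfolding length_function_def
proof (intro conjI ballI allI impI)
  fix P assume "P \<in> lFin_X R L" "carrier P = {\<zero>\<^bsub>P\<^esub>}"
  then show "ent_X R L P = 0" using ent_X_zero lFin_XD(1) by blast
next
  fix P P' assume P: "P \<in> lFin_X R L" "P' \<in> lFin_X R L" "mod_isomorphic (UP R) P P'"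
  then obtain f where f: "f \<in> mod_hom (UP R) P P'" "bij_betw f (carrier P) (carrier P')"
    by (auto simp: mod_isomorphic_def)
  note M = lFin_XD(1)[OF P(1)] lFin_XD(1)[OF P(2)]
  \<comment> \<open>Invariance under isomorphism is additivity for an exact sequence whose kernel is
    zero.\<close>
  let ?Z = "res P {\<zero>\<^bsub>P\<^esub>}"
  have z: "\<zero>\<^bsub>P\<^esub> \<in> carrier P" using submodule_zero[OF M(1) submodule_carrier[OF M(1)]] .
  have Z: "?Z \<in> lFin_X R L" by (rule lFin_X_res[OF P(1) submodule_zero_set[OF M(1)]])
  have "mod_short_exact (UP R) ?Z (\<lambda>x. x) P f P'"
    using f z mod_hom_zero[OF M f(1)] by (auto simp: mod_short_exact_def mod_hom_def bij_betw_def inj_on_def)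
  from ent_X_exact[OF Z P(1,2) this] ent_X_zero[OF lFin_XD(1)[OF Z]]
  show "ent_X R L P = ent_X R L P'" by simp
next
  fix A B D f g assume "A \<in> lFin_X R L" "B \<in> lFin_X R L" "D \<in> lFin_X R L" "mod_short_exact (UP R) A f B g D"
  then show "ent_X R L B = ent_X R L A + ent_X R L D" by (rule ent_X_exact)
next
  fix P assume "P \<in> lFin_X R L"
  then show "ent_X R L P = (SUP F\<in>fg_submodules (UP R) P. ent_X R L (res P F))" by (rule ent_X_fg)
qed

end

section \<open>Copies of the Bernoulli module\<close>

lemma direct_power_simps [simp]:
  "\<zero>\<^bsub>direct_power N\<^esub> = (\<lambda>i. \<zero>\<^bsub>N\<^esub>)" "x \<oplus>\<^bsub>direct_power N\<^esub> y = (\<lambda>i. x i \<oplus>\<^bsub>N\<^esub> y i)"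
  "a \<odot>\<^bsub>direct_power N\<^esub> x = (\<lambda>i. a \<odot>\<^bsub>N\<^esub> x i)"
  by (simp_all add: direct_power_def)

lemma carrier_direct_power:
  "x \<in> carrier (direct_power N) \<longleftrightarrow> (\<forall>i. x i \<in> carrier N) \<and> finite {i. x i \<noteq> \<zero>\<^bsub>N\<^esub>}"
  by (simp add: direct_power_def)

lemma module_direct_power:
  assumes "module R N"
  shows "module R (direct_power N)"
proof -
  interpret N: module R N by fact
  show ?thesis
  proof (rule moduleI)
    show "cring R" by (rule N.R.is_cring)
    show "abelian_group (direct_power N)"
    proof (rule abelian_groupI)
      fix x y assume xy: "x \<in> carrier (direct_power N)" "y \<in> carrier (direct_power N)"
      have "{i. x i \<oplus>\<^bsub>N\<^esub> y i \<noteq> \<zero>\<^bsub>N\<^esub>} \<subseteq> {i. x i \<noteq> \<zero>\<^bsub>N\<^esub>} \<union> {i. y i \<noteq> \<zero>\<^bsub>N\<^esub>}" by auto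
      then show "x \<oplus>\<^bsub>direct_power N\<^esub> y \<in> carrier (direct_power N)"
        using xy by (auto simp: carrier_direct_power intro: finite_subset)
      show "x \<oplus>\<^bsub>direct_power N\<^esub> y = y \<oplus>\<^bsub>direct_power N\<^esub> x"
        using xy by (auto simp: carrier_direct_power N.a_comm)
    next
      fix x assume x: "x \<in> carrier (direct_power N)"
      then show "\<exists>y\<in>carrier (direct_power N). y \<oplus>\<^bsub>direct_power N\<^esub> x = \<zero>\<^bsub>direct_power N\<^esub>"
        by (intro bexI[of _ "\<lambda>i. \<ominus>\<^bsub>N\<^esub> x i"]) (auto simp: carrier_direct_power N.l_neg)
    qed (auto simp: carrier_direct_power N.a_assoc)
  next
    fix a x assume "a \<in> carrier R" "x \<in> carrier (direct_power N)"
    moreover from this have "{i. a \<odot>\<^bsub>N\<^esub> x i \<noteq> \<zero>\<^bsub>N\<^esub>} \<subseteq> {i. x i \<noteq> \<zero>\<^bsub>N\<^esub>}" by auto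
    ultimately show "a \<odot>\<^bsub>direct_power N\<^esub> x \<in> carrier (direct_power N)"
      by (auto simp: carrier_direct_power intro: finite_subset)
  qed (auto simp: carrier_direct_power N.smult_l_distr N.smult_r_distr N.smult_assoc1)
qed

lemma right_shift_simps [simp]: "right_shift N x 0 = \<zero>\<^bsub>N\<^esub>" "right_shift N x (Suc i) = x i"
  by (simp_all add: right_shift_def)

lemma right_shift_hom:
  assumes "module R N"
  shows "right_shift N \<in> mod_hom R (direct_power N) (direct_power N)"
proof -
  interpret N: module R N by fact
  have "{i. right_shift N x i \<noteq> \<zero>\<^bsub>N\<^esub>} \<subseteq> Suc ` {i. x i \<noteq> \<zero>\<^bsub>N\<^esub>}" for x
  proof
    fix i assume "i \<in> {i. right_shift N x i \<noteq> \<zero>\<^bsub>N\<^esub>}"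
    then show "i \<in> Suc ` {i. x i \<noteq> \<zero>\<^bsub>N\<^esub>}" by (cases i) auto
  qed
  then have f: "finite {i. x i \<noteq> \<zero>\<^bsub>N\<^esub>} \<Longrightarrow> finite {i. right_shift N x i \<noteq> \<zero>\<^bsub>N\<^esub>}" for x
    by (meson finite_imageI finite_subset)
  have c: "right_shift N x i \<in> carrier N" if "\<forall>i. x i \<in> carrier N" for x i
    using that by (cases i) auto
  have "right_shift N (\<lambda>i. x i \<oplus>\<^bsub>N\<^esub> y i) i = right_shift N x i \<oplus>\<^bsub>N\<^esub> right_shift N y i" for x y i
    by (cases i) auto
  moreover have "right_shift N (\<lambda>i. a \<odot>\<^bsub>N\<^esub> x i) i = a \<odot>\<^bsub>N\<^esub> right_shift N x i" if "a \<in> carrier R" for a x i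
    using that by (cases i) auto
  ultimately show ?thesis
    unfolding mod_hom_def by (auto simp: carrier_direct_power f c fun_eq_iff)
qed

lemma bernoulli_simps:
  assumes "cring R" "module R N"
  shows "carrier (bernoulli R N) = carrier (direct_power N)"
    and "module (UP R) (bernoulli R N)"
    and "\<And>x. x \<in> carrier (direct_power N) \<Longrightarrow> X_action R (bernoulli R N) x = right_shift N x"
    and "\<And>f K. f \<in> mod_hom R K (underlying R (bernoulli R N)) \<longleftrightarrow> f \<in> mod_hom R K (direct_power N)"
proof -
  note p = assms(1) module_direct_power[OF assms(2)] right_shift_hom[OF assms(2)]
  show "carrier (bernoulli R N) = carrier (direct_power N)"
    unfolding bernoulli_def by (rule poly_module_simps(1)[OF p])
  show "module (UP R) (bernoulli R N)"
    unfolding bernoulli_def by (rule module_poly_module[OF p])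
  show "X_action R (bernoulli R N) x = right_shift N x" if "x \<in> carrier (direct_power N)" for x
    unfolding bernoulli_def by (rule X_action_poly_module[OF p that])
  show "f \<in> mod_hom R K (underlying R (bernoulli R N)) \<longleftrightarrow> f \<in> mod_hom R K (direct_power N)" for f K
    unfolding bernoulli_def by (rule mod_hom_poly_module(2)[OF p])
qed

text \<open>The elements of B(N) have type \<open>nat => 'm\<close>, outside the reach of length
  functions on \<open>'m\<close>. Everything is therefore stated for an isomorphic \<open>P\<close>,
  with \<open>h x i\<close> playing the role of the i-th coordinate of \<open>x\<close>.\<close>

locale bernoulli_copy =
  fixes R :: "'r ring" and N :: "('r, 'm) module" and P :: "(nat \<Rightarrow> 'r, 'p) module" and h
  assumes R: "cring R" and N_module: "module R N" and P_module: "module (UP R) P"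
    and h: "h \<in> mod_hom (UP R) P (bernoulli R N)"
    and bij: "bij_betw h (carrier P) (carrier (bernoulli R N))"
begin

abbreviation "U \<equiv> underlying R P"
abbreviation "X \<equiv> X_action R P"

sublocale N: module R N by (rule N_module)
sublocale UPmod: module "UP R" P by (rule P_module)

lemma U_module: "module R U"
  by (rule module_underlying[OF R P_module])

lemma X_hom: "X \<in> mod_hom R U U"
  by (rule X_action_hom[OF R P_module])

lemma h_hom: "h \<in> mod_hom R U (direct_power N)"
  and h_X: "x \<in> carrier P \<Longrightarrow> h (X x) = right_shift N (h x)"
proof -
  note b = bernoulli_simps[OF R N_module]
  have *: "h \<in> mod_hom R U (underlying R (bernoulli R N))"
    "\<forall>x\<in>carrier P. h (X x) = X_action R (bernoulli R N) (h x)"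
    using h mod_hom_UP_iff[OF R P_module b(2)] by auto
  show "h \<in> mod_hom R U (direct_power N)" using *(1) b(4) by blast
  then show "x \<in> carrier P \<Longrightarrow> h (X x) = right_shift N (h x)"
    using *(2) b(3)[of "h x"] mod_homD(1)[of h R U "direct_power N" x] by simp
qed

lemma h_carrier:
  assumes "x \<in> carrier P" shows "h x i \<in> carrier N" "finite {i. h x i \<noteq> \<zero>\<^bsub>N\<^esub>}"
  using mod_homD(1)[OF h_hom, of x] assms by (auto simp: carrier_direct_power)

lemma h_add: "x \<in> carrier P \<Longrightarrow> y \<in> carrier P \<Longrightarrow> h (x \<oplus>\<^bsub>P\<^esub> y) i = h x i \<oplus>\<^bsub>N\<^esub> h y i"
  using mod_homD(2)[OF h_hom, of x y] by simp

lemma h_zero: "h \<zero>\<^bsub>P\<^esub> i = \<zero>\<^bsub>N\<^esub>"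
  using mod_hom_zero[OF U_module module_direct_power[OF N_module] h_hom] by simp

lemma h_X_simps: "x \<in> carrier P \<Longrightarrow> h (X x) 0 = \<zero>\<^bsub>N\<^esub>" "x \<in> carrier P \<Longrightarrow> h (X x) (Suc i) = h x i"
  by (simp_all add: h_X)

lemma h_bij: "bij_betw h (carrier P) (carrier (direct_power N))"
  using bij bernoulli_simps(1)[OF R N_module] by simp

lemma h_eqI: "x \<in> carrier P \<Longrightarrow> y \<in> carrier P \<Longrightarrow> (\<And>i. h x i = h y i) \<Longrightarrow> x = y"
  using h_bij by (auto simp: bij_betw_def inj_on_def fun_eq_iff)

lemma h_ex:
  assumes "\<And>i. t i \<in> carrier N" "finite {i. t i \<noteq> \<zero>\<^bsub>N\<^esub>}"
  obtains x where "x \<in> carrier P" "h x = t"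
proof -
  have "t \<in> h ` carrier P" using assms h_bij by (auto simp: bij_betw_def carrier_direct_power)
  then show thesis using that by auto
qed

lemma coordinate_hom: "(\<lambda>x. h x i) \<in> mod_hom R U N"
  using h_hom by (auto simp: mod_hom_def carrier_direct_power Pi_iff)

lemma lift_hom:
  assumes "module R K" "f \<in> mod_hom R K (direct_power N)"
  obtains f' where "f' \<in> mod_hom R K U" "\<And>k. k \<in> carrier K \<Longrightarrow> h (f' k) = f k"
proof -
  interpret K: module R K by fact
  interpret U: module R U by (rule U_module)
  define f' where "f' k = inv_into (carrier P) h (f k)" for k
  have im: "f k \<in> h ` carrier P" if "k \<in> carrier K" for k
    using h_bij mod_homD(1)[OF assms(2) that] by (simp add: bij_betw_def)
  have f': "f' k \<in> carrier P" "h (f' k) = f k" if "k \<in> carrier K" for k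
    unfolding f'_def using inv_into_into[OF im[OF that]] f_inv_into_f[OF im[OF that]] by auto
  have "f' \<in> mod_hom R K U"
    unfolding mod_hom_def
  proof (intro CollectI conjI ballI)
    fix x y assume "x \<in> carrier K" "y \<in> carrier K"
    then show "f' (x \<oplus>\<^bsub>K\<^esub> y) = f' x \<oplus>\<^bsub>U\<^esub> f' y"
      using f' mod_homD[OF assms(2)] by (intro h_eqI) (auto simp: h_add)
  next
    fix a x assume a: "a \<in> carrier R" "x \<in> carrier K"
    have "f' (a \<odot>\<^bsub>K\<^esub> x) = a \<odot>\<^bsub>U\<^esub> f' x"
    proof (rule h_eqI)
      show "a \<odot>\<^bsub>U\<^esub> f' x \<in> carrier P" using a f'(1) U.smult_closed[of a "f' x"] by simp
      show "h (f' (a \<odot>\<^bsub>K\<^esub> x)) i = h (a \<odot>\<^bsub>U\<^esub> f' x) i" for i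
        using a f' mod_homD(3)[OF assms(2), of a x] mod_homD(3)[OF h_hom, of a "f' x"]
        by (simp del: underlying_simps(4))
    qed (use f' a in auto)
    then show "f' (a \<odot>\<^bsub>K\<^esub> x) = a \<odot>\<^bsub>U\<^esub> f' x" .
  qed (use f' in auto)
  then show thesis using that f' by blast
qed

text \<open>This is the functor B applied to \<open>\<psi>\<close>. It commutes with X because
  \<open>\<psi>\<close> fixes the zero that the shift inserts in coordinate 0.\<close>

lemma endo_lift:
  assumes "\<psi> \<in> mod_hom R N N"
  obtains f where "f \<in> mod_hom (UP R) P P" "\<And>x i. x \<in> carrier P \<Longrightarrow> h (f x) i = \<psi> (h x i)"
proof -
  have z: "\<psi> \<zero>\<^bsub>N\<^esub> = \<zero>\<^bsub>N\<^esub>" by (rule mod_hom_zero[OF N_module N_module assms])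
  then have "{i. \<psi> (y i) \<noteq> \<zero>\<^bsub>N\<^esub>} \<subseteq> {i. y i \<noteq> \<zero>\<^bsub>N\<^esub>}" for y :: "nat \<Rightarrow> 'm" by auto
  then have "finite {i. y i \<noteq> \<zero>\<^bsub>N\<^esub>} \<Longrightarrow> finite {i. \<psi> (y i) \<noteq> \<zero>\<^bsub>N\<^esub>}" for y :: "nat \<Rightarrow> 'm"
    using finite_subset by blast
  then have "(\<lambda>y i. \<psi> (y i)) \<in> mod_hom R (direct_power N) (direct_power N)"
    using assms by (auto simp: mod_hom_def carrier_direct_power Pi_iff)
  from lift_hom[OF U_module mod_hom_comp[OF h_hom this]]
  obtain f where f: "f \<in> mod_hom R U U" "\<And>x. x \<in> carrier U \<Longrightarrow> h (f x) = (\<lambda>i. \<psi> (h x i))"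
    by blast
  have "f (X x) = X (f x)" if x: "x \<in> carrier P" for x
  proof (rule h_eqI)
    have c: "X x \<in> carrier P" "f x \<in> carrier P" using x mod_homD(1)[OF X_hom] mod_homD(1)[OF f(1)] by auto
    show "f (X x) \<in> carrier P" "X (f x) \<in> carrier P"
      using c mod_homD(1)[OF X_hom] mod_homD(1)[OF f(1)] by auto
    show "h (f (X x)) i = h (X (f x)) i" for i
      using c x z f(2) by (cases i) (auto simp: h_X_simps)
  qed
  then have "f \<in> mod_hom (UP R) P P"
    using f(1) mod_hom_UP_iff[OF R P_module P_module] by blast
  then show thesis using that f(2) by auto
qed

lemma const_lift:
  obtains f where "f \<in> mod_hom R N U" "\<And>c. c \<in> carrier N \<Longrightarrow> h (f c) 0 = c"
    "\<And>c i. c \<in> carrier N \<Longrightarrow> h (f c) (Suc i) = \<zero>\<^bsub>N\<^esub>"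
proof -
  have "finite {i::nat. (if i = 0 then c else \<zero>\<^bsub>N\<^esub>) \<noteq> \<zero>\<^bsub>N\<^esub>}" for c
    by (rule finite_subset[of _ "{0}"]) auto
  then have "(\<lambda>c i. if i = (0::nat) then c else \<zero>\<^bsub>N\<^esub>) \<in> mod_hom R N (direct_power N)"
    by (auto simp: mod_hom_def carrier_direct_power)
  from lift_hom[OF N_module this]
  obtain f where "f \<in> mod_hom R N U"
    "\<And>c. c \<in> carrier N \<Longrightarrow> h (f c) = (\<lambda>i. if i = (0::nat) then c else \<zero>\<^bsub>N\<^esub>)"
    by blast
  then show thesis using that by simp
qed

text \<open>For a submodule \<open>T\<close> this is B(T) inside B(N), see
  \<open>coords_in_copy\<close>.\<close>

definition coords_in :: "'m set \<Rightarrow> 'p set" where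
  "coords_in T = {x \<in> carrier P. \<forall>i. h x i \<in> T}"

lemma coords_in_submodule:
  assumes "submodule T R N"
  shows "submodule (coords_in T) (UP R) P"
proof -
  interpret U: module R U by (rule U_module)
  have T: "\<zero>\<^bsub>N\<^esub> \<in> T" "\<forall>x\<in>T. \<forall>y\<in>T. x \<oplus>\<^bsub>N\<^esub> y \<in> T"
    "\<forall>a\<in>carrier R. \<forall>x\<in>T. a \<odot>\<^bsub>N\<^esub> x \<in> T" using assms by (auto simp: N.submodule_iff)
  have "submodule (coords_in T) R U"
    unfolding U.submodule_iff
  proof (intro conjI ballI)
    fix a x assume a: "a \<in> carrier R" "x \<in> coords_in T"
    then have "x \<in> carrier P" by (simp add: coords_in_def)
    then show "a \<odot>\<^bsub>U\<^esub> x \<in> coords_in T"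
      using a T(3) mod_homD(3)[OF h_hom a(1), of x] U.smult_closed[OF a(1), of x]
      by (simp add: coords_in_def del: underlying_simps(4))
  qed (use T in \<open>auto simp: coords_in_def h_add h_zero\<close>)
  moreover have "X ` coords_in T \<subseteq> coords_in T"
  proof (safe)
    fix x assume "x \<in> coords_in T"
    then have x: "x \<in> carrier P" "\<And>i. h x i \<in> T" by (auto simp: coords_in_def)
    have "h (X x) i \<in> T" for i using x T(1) by (cases i) (auto simp: h_X_simps)
    then show "X x \<in> coords_in T" using mod_homD(1)[OF X_hom, of x] x by (simp add: coords_in_def)
  qed
  ultimately show ?thesis using submodule_UP_iff[OF R P_module] by blast
qed

lemma coords_in_copy:
  assumes T: "submodule T R N"
  shows "bernoulli_copy R (res N T) (res P (coords_in T)) h"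
proof -
  note NT = module_res[OF N_module T] and PT = module_res[OF P_module coords_in_submodule[OF T]]
  note b = bernoulli_simps[OF R NT]
  have Tc: "T \<subseteq> carrier N" by (rule submodule_subset[OF T])
  have c: "carrier (direct_power (res N T)) = h ` coords_in T"
  proof -
    have "t \<in> h ` coords_in T" if "t \<in> carrier (direct_power (res N T))" for t
    proof -
      have t: "\<And>i. t i \<in> T" "finite {i. t i \<noteq> \<zero>\<^bsub>N\<^esub>}"
        using that by (auto simp: carrier_direct_power)
      then obtain x where "x \<in> carrier P" "h x = t" using h_ex[of t] Tc by blast
      then show ?thesis using t by (auto simp: coords_in_def)
    qed
    then show ?thesis by (auto simp: carrier_direct_power coords_in_def h_carrier)
  qed
  have "h \<in> mod_hom R (underlying R (res P (coords_in T))) (direct_power (res N T))"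
    unfolding underlying_res using h_hom c by (auto simp: mod_hom_def coords_in_def)
  moreover have "h (X_action R (res P (coords_in T)) x) = X_action R (bernoulli R (res N T)) (h x)"
    if x: "x \<in> coords_in T" for x
  proof -
    have "h x \<in> carrier (direct_power (res N T))" using x c by auto
    then have "X_action R (bernoulli R (res N T)) (h x) = right_shift (res N T) (h x)" by (rule b(3))
    also have "\<dots> = right_shift N (h x)" by (simp add: right_shift_def fun_eq_iff split: nat.split)
    finally show ?thesis using x h_X by (simp add: X_action_res coords_in_def)
  qed
  ultimately have "h \<in> mod_hom (UP R) (res P (coords_in T)) (bernoulli R (res N T))"
    unfolding mod_hom_UP_iff[OF R PT b(2)] b(4) by simp
  moreover have "bij_betw h (carrier (res P (coords_in T))) (carrier (bernoulli R (res N T)))"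
    using h_bij c b(1) by (auto simp: bij_betw_def coords_in_def inj_on_def)
  ultimately show ?thesis by (intro bernoulli_copy.intro R NT PT)
qed

text \<open>Seen as N[X], these are the polynomials of degree below \<open>n\<close>: an exhaustion
  by R-submodules of computable length, which X moves one step up.\<close>

definition initial :: "nat \<Rightarrow> 'p set" where
  "initial n = {x \<in> carrier P. \<forall>i\<ge>n. h x i = \<zero>\<^bsub>N\<^esub>}"

lemma initial_submodule: "submodule (initial n) R U"
proof -
  interpret U: module R U by (rule U_module)
  show ?thesis
    unfolding U.submodule_iff
  proof (intro conjI ballI)
    fix a x assume a: "a \<in> carrier R" "x \<in> initial n"
    then have "x \<in> carrier P" by (simp add: initial_def)
    then show "a \<odot>\<^bsub>U\<^esub> x \<in> initial n"
      using a mod_homD(3)[OF h_hom a(1), of x] U.smult_closed[OF a(1), of x]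
      by (simp add: initial_def del: underlying_simps(4))
  qed (auto simp: initial_def h_add h_zero)
qed

lemma initial_Suc: "initial n \<subseteq> initial (Suc n)"
  by (auto simp: initial_def)

lemma UN_initial: "(\<Union>n. initial n) = carrier P"
proof -
  have "\<exists>n. x \<in> initial n" if x: "x \<in> carrier P" for x
  proof -
    obtain n where "\<forall>i\<in>{i. h x i \<noteq> \<zero>\<^bsub>N\<^esub>}. i < n"
      using finite_nat_set_iff_bounded h_carrier(2)[OF x] by blast
    then have "x \<in> initial n" using x by (auto simp: initial_def)
    then show ?thesis ..
  qed
  then show ?thesis by (auto simp: initial_def)
qed

lemma X_initial: "X ` initial n \<subseteq> initial (Suc n)"
proof safe
  fix x assume "x \<in> initial n"
  then have x: "x \<in> carrier P" "\<And>i. i \<ge> n \<Longrightarrow> h x i = \<zero>\<^bsub>N\<^esub>" by (auto simp: initial_def)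
  have "h (X x) i = \<zero>\<^bsub>N\<^esub>" if "i \<ge> Suc n" for i
    using that x by (cases i) (auto simp: h_X_simps)
  then show "X x \<in> initial (Suc n)" using x mod_homD(1)[OF X_hom, of x] by (simp add: initial_def)
qed

text \<open>Division by X with remainder: \<open>c\<close> is the constant term and \<open>y\<close>
  the sequence shifted back.\<close>

lemma initial_decomp:
  assumes "x \<in> initial (Suc n)"
  obtains c y where "c \<in> initial 1" "y \<in> initial n" "x = c \<oplus>\<^bsub>P\<^esub> X y" "\<And>i. h y i = h x (Suc i)" "h c 0 = h x 0"
proof -
  have x: "x \<in> carrier P" "\<And>i. i \<ge> Suc n \<Longrightarrow> h x i = \<zero>\<^bsub>N\<^esub>" using assms by (auto simp: initial_def)
  have "finite {i. h x (Suc i) \<noteq> \<zero>\<^bsub>N\<^esub>}"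
    using finite_vimageI[OF h_carrier(2)[OF x(1)], of Suc] by (simp add: vimage_def)
  then obtain y where y: "y \<in> carrier P" "h y = (\<lambda>i. h x (Suc i))"
    using h_ex[of "\<lambda>i. h x (Suc i)"] h_carrier(1)[OF x(1)] by blast
  obtain f where f: "f \<in> mod_hom R N U" "\<And>c. c \<in> carrier N \<Longrightarrow> h (f c) 0 = c"
    "\<And>c i. c \<in> carrier N \<Longrightarrow> h (f c) (Suc i) = \<zero>\<^bsub>N\<^esub>" using const_lift by blast
  let ?c = "f (h x 0)"
  have c: "?c \<in> carrier P" "h ?c 0 = h x 0" "\<And>i. h ?c (Suc i) = \<zero>\<^bsub>N\<^esub>"
    using h_carrier(1)[OF x(1)] f mod_homD(1)[OF f(1), of "h x 0"] by auto
  have Xy: "X y \<in> carrier P" using mod_homD(1)[OF X_hom, of y] y by simp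
  have "x = ?c \<oplus>\<^bsub>P\<^esub> X y"
  proof (rule h_eqI)
    show "h x i = h (?c \<oplus>\<^bsub>P\<^esub> X y) i" for i
      using c y Xy h_carrier(1)[OF x(1)] by (cases i) (auto simp: h_add h_X_simps)
  qed (use x c Xy in auto)
  moreover have "h ?c i = \<zero>\<^bsub>N\<^esub>" if "i \<ge> 1" for i using that c(3) by (cases i) auto
  then have "?c \<in> initial 1" using c(1) by (simp add: initial_def)
  moreover have "y \<in> initial n" using x y by (simp add: initial_def)
  ultimately show thesis using that y(2) c(2) by simp
qed

end

section \<open>The entropy of B(N) for N of finite length\<close>

locale finite_bernoulli_copy = entropy_setting R L + bernoulli_copy R N P h
  for R :: "'r ring" and L :: "('r, 'm) module \<Rightarrow> ennreal" and N :: "('r, 'm) module"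
    and P :: "(nat \<Rightarrow> 'r, 'm) module" and h +
  assumes L_finite: "L N < \<infinity>"
begin

sublocale E: length_endo R "{M. module R M}" L U X
  by (rule length_endo_X[OF P_module])

lemma len_initial: "L (res U (initial n)) = of_nat n * L N"
proof (induction n)
  case 0
  have "initial 0 = {\<zero>\<^bsub>U\<^esub>}" using h_zero by (auto simp: initial_def intro: h_eqI)
  then show ?case using len_zero[of U] U_module by simp
next
  case (Suc n)
  \<comment> \<open>Projection to the top coordinate \<open>n\<close> has kernel
    \<open>initial n\<close> and image \<open>N\<close>, so each step adds
    \<open>L N\<close>.\<close>
  have "{x \<in> initial (Suc n). h x n = \<zero>\<^bsub>N\<^esub>} = initial n"
    by (auto simp: initial_def) (metis Suc_leI le_neq_implies_less)
  moreover have "(\<lambda>x. h x n) ` initial (Suc n) = carrier N"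
  proof
    show "(\<lambda>x. h x n) ` initial (Suc n) \<subseteq> carrier N" by (auto simp: initial_def h_carrier)
    show "carrier N \<subseteq> (\<lambda>x. h x n) ` initial (Suc n)"
    proof
      fix c assume c: "c \<in> carrier N"
      have "finite {i. (if i = n then c else \<zero>\<^bsub>N\<^esub>) \<noteq> \<zero>\<^bsub>N\<^esub>}"
        by (rule finite_subset[of _ "{n}"]) auto
      then have "(\<lambda>i. if i = n then c else \<zero>\<^bsub>N\<^esub>) \<in> h ` carrier P"
        using h_bij c by (simp add: bij_betw_def carrier_direct_power)
      then obtain x where "x \<in> carrier P" "h x = (\<lambda>i. if i = n then c else \<zero>\<^bsub>N\<^esub>)"
        by (metis (no_types, lifting) imageE)
      then show "c \<in> (\<lambda>x. h x n) ` initial (Suc n)"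
        by (intro image_eqI[of _ _ x]) (auto simp: initial_def)
    qed
  qed
  moreover have "res N (carrier N) = N" by simp
  ultimately show ?case
    using len_hom[of U N "\<lambda>x. h x n" "initial (Suc n)", OF _ N_module coordinate_hom initial_submodule]
      U_module Suc by (simp add: algebra_simps)
qed

lemma fin_initial: "E.fin (initial n)"
  using initial_submodule L_finite by (simp add: fin_submodule_def len_initial ennreal_mult_less_top of_nat_less_top)

lemma rlen_initial: "E.rl (initial n) = real n * enn2real (L N)"
  by (simp add: rlen_def len_initial enn2real_mult)

lemma fg_subset_initial:
  assumes "F \<in> fg_submodules R U"
  shows "\<exists>n. F \<subseteq> initial n"
  using fg_submodule_chain[where A = initial, OF assms initial_submodule initial_Suc] assms UN_initial
    submodule_subset[of F R U] by (auto simp: fg_submodules_def)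

lemma copy_in_lFin_X: "P \<in> lFin_X R L"
proof (rule lFin_XI[OF P_module])
  fix F assume F: "F \<in> fg_submodules R U"
  then obtain n where "F \<subseteq> initial n" using fg_subset_initial by blast
  then show "E.fin F" using F by (intro fin_mono[OF E.M_in fin_initial]) (auto simp: fg_submodules_def)
qed

text \<open>The n-th trajectory of \<open>initial m\<close> stays in \<open>initial (n + m)\<close>,
  of length (n + m) times \<open>L N\<close>; the contribution of m is bounded and disappears in the
  limit.\<close>

lemma growth_initial_le: "growth L U X (initial m) \<le> enn2real (L N)"
proof -
  let ?l = "enn2real (L N)"
  have sub: "E.traj (initial m) n \<subseteq> initial (n + m)" for n
  proof (induction n)
    case 0
    then show ?case using submodule_zero[OF U_module initial_submodule, of m]
      by (simp add: trajectory_0[OF U_module])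
  next
    case (Suc n)
    have "(X ^^ n) ` initial m \<subseteq> initial (n + m)" for n
    proof (induction n)
      case (Suc n)
      have "(X ^^ Suc n) ` initial m = X ` (X ^^ n) ` initial m" by (simp add: image_image)
      also have "\<dots> \<subseteq> X ` initial (n + m)" using Suc by blast
      also have "\<dots> \<subseteq> initial (Suc n + m)" using X_initial[of "n + m"] by simp
      finally show ?case .
    qed simp
    from this[of n] show ?case
      unfolding trajectory_Suc[OF U_module X_hom submodule_subset[OF initial_submodule]]
      using Suc initial_Suc[of "n + m"] by (intro msum_least[OF U_module initial_submodule]) auto
  qed
  have "E.rl (E.traj (initial m) n) \<le> real n * ?l + real m * ?l + real n * 0" for n
    using rlen_mono[OF E.M_in fin_initial trajectory_submodule[OF U_module X_hom initial_submodule] sub, of n]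
    by (simp add: rlen_initial algebra_simps)
  moreover have "(\<lambda>n. real n * ?l / real n) \<longlonglongrightarrow> ?l"
    by (rule tendsto_eventually) (auto simp: eventually_sequentially intro!: exI[of _ 1])
  ultimately have "growth L U X (initial m) \<le> ?l + 0"
    by (intro growth_le[OF E.growth_limits(2)[OF fin_initial]])
  then show ?thesis by simp
qed

text \<open>Constants and their n - 1 shifts fill all degrees below n, so the n-th trajectory of the
  constants contains \<open>initial n\<close>.\<close>

lemma growth_initial_ge: "enn2real (L N) \<le> growth L U X (initial 1)"
proof -
  let ?l = "enn2real (L N)"
  have "initial n \<subseteq> E.traj (initial 1) n" for n
  proof (induction n)
    case 0
    have "initial 0 = {\<zero>\<^bsub>U\<^esub>}" using h_zero by (auto simp: initial_def intro: h_eqI)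
    then show ?case by (simp add: trajectory_0[OF U_module])
  next
    case (Suc n)
    note T = trajectory_submodule[OF U_module X_hom initial_submodule, of 1]
    interpret U: module R U by (rule U_module)
    show ?case
    proof
      fix x assume "x \<in> initial (Suc n)"
      then obtain c y where c: "c \<in> initial 1" "y \<in> initial n" "x = c \<oplus>\<^bsub>P\<^esub> X y"
        by (rule initial_decomp)
      have "initial 1 \<subseteq> E.traj (initial 1) (Suc n)"
        using trajectory_1[OF U_module X_hom initial_submodule, of 1]
         trajectory_incseq[OF U_module X_hom initial_submodule, of 1 "Suc n" 1] by simp
      moreover have "X y \<in> E.traj (initial 1) (Suc n)"
        using funpow_image_trajectory[OF U_module X_hom initial_submodule, of 1 1 n] c(2) Suc by auto
      ultimately show "x \<in> E.traj (initial 1) (Suc n)"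
        using c(1,3) T[of "Suc n"] by (auto simp: U.submodule_iff)
    qed
  qed
  then have "real n * ?l \<le> E.rl (E.traj (initial 1) n) + 0 + real n * 0" for n
    using rlen_mono[OF E.M_in E.fin_trajectory[OF fin_initial] initial_submodule]
    by (simp flip: rlen_initial)
  moreover have "(\<lambda>n. real n * ?l / real n) \<longlonglongrightarrow> ?l"
    by (rule tendsto_eventually) (auto simp: eventually_sequentially intro!: exI[of _ 1])
  ultimately have "?l \<le> growth L U X (initial 1) + 0"
    by (intro growth_le[OF _ E.growth_limits(2)[OF fin_initial]])
  then show ?thesis by simp
qed

lemma ent_X_copy: "ent_X R L P = L N"
proof -
  have l: "ennreal (enn2real (L N)) = L N" using L_finite by simp
  have "E.entropy_on (carrier P) = L N"
  proof (rule antisym)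
    show "E.entropy_on (carrier P) \<le> L N"
      unfolding E.entropy_on_fg
    proof (rule SUP_least)
      fix F assume F: "F \<in> {F \<in> fg_submodules R U. E.fin F \<and> F \<subseteq> carrier P}"
      then obtain m where "F \<subseteq> initial m" using fg_subset_initial by blast
      then have "growth L U X F \<le> enn2real (L N)"
        using E.growth_mono[OF fin_initial, of F m] growth_initial_le[of m] F by (auto dest: fin_submoduleD)
      then show "ennreal (growth L U X F) \<le> L N" using l ennreal_leI by metis
    qed
    have "L N \<le> ennreal (growth L U X (initial 1))" using ennreal_leI[OF growth_initial_ge] l by simp
    also have "\<dots> \<le> E.entropy_on (carrier P)"
      unfolding E.entropy_on_def using fin_initial by (intro SUP_upper) (auto simp: initial_def)
    finally show "L N \<le> E.entropy_on (carrier P)" .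
  qed
  then show ?thesis by (simp add: ent_X_eq[OF P_module])
qed

end

section \<open>Uniqueness\<close>

lemma mod_hom_inv:
  assumes "module S M" "f \<in> mod_hom S M N" "bij_betw f (carrier M) (carrier N)"
  shows "inv_into (carrier M) f \<in> mod_hom S N M"
proof -
  interpret M: module S M by fact
  let ?g = "inv_into (carrier M) f"
  have f: "inj_on f (carrier M)" "f ` carrier M = carrier N" using assms(3) by (auto simp: bij_betw_def)
  have g: "?g y \<in> carrier M" "f (?g y) = y" if "y \<in> carrier N" for y
    using inv_into_into[of y f "carrier M"] f_inv_into_f[of y f "carrier M"] f(2) that by auto
  have gf: "?g (f x) = x" if "x \<in> carrier M" for x using inv_into_f_f[OF f(1) that] .
  show ?thesis
    unfolding mod_hom_def
  proof (intro CollectI conjI ballI)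
    fix x y assume xy: "x \<in> carrier N" "y \<in> carrier N"
    have "f (?g x \<oplus>\<^bsub>M\<^esub> ?g y) = x \<oplus>\<^bsub>N\<^esub> y" using mod_homD(2)[OF assms(2)] g xy by simp
    then show "?g (x \<oplus>\<^bsub>N\<^esub> y) = ?g x \<oplus>\<^bsub>M\<^esub> ?g y" using gf g xy by (metis M.a_closed)
  next
    fix a x assume a: "a \<in> carrier S" "x \<in> carrier N"
    have "f (a \<odot>\<^bsub>M\<^esub> ?g x) = a \<odot>\<^bsub>N\<^esub> x" using mod_homD(3)[OF assms(2)] g a by simp
    then show "?g (a \<odot>\<^bsub>N\<^esub> x) = a \<odot>\<^bsub>M\<^esub> ?g x" using gf g a by (metis M.smult_closed)
  qed (use g in auto)
qed

lemma mod_hom_diff: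
  assumes "module S M" "module S N" "f \<in> mod_hom S M N" "g \<in> mod_hom S M N"
  shows "(\<lambda>x. f x \<ominus>\<^bsub>N\<^esub> g x) \<in> mod_hom S M N"
proof -
  interpret N: module S N by fact
  note f = mod_homD[OF assms(3)] and g = mod_homD[OF assms(4)]
  show ?thesis
    unfolding mod_hom_def
    using f g
    by (auto simp: a_minus_def N.minus_add N.smult_r_distr N.smult_r_minus N.add.m_ac)
qed

section \<open>Room for a copy of B(N)\<close>

lemma list_injection:
  assumes "infinite (UNIV :: 'm set)"
  shows "\<exists>f :: 'm list \<Rightarrow> 'm. inj f"
proof -
  have "|lists (UNIV :: 'm set)| =o |UNIV :: 'm set|" using assms by (rule card_of_lists_infinite)
  then obtain f where "bij_betw f (lists (UNIV :: 'm set)) (UNIV :: 'm set)"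
    using card_of_ordIso by blast
  then show ?thesis by (auto simp: bij_betw_def)
qed

text \<open>A finitely supported sequence is recovered from the list of its values up to the least
  index \<open>n x\<close> beyond which it vanishes, and an infinite type contains a copy of its own
  lists.\<close>

lemma bernoulli_copy_exists:
  fixes R :: "'r ring" and N :: "('r, 'm) module"
  assumes "infinite (UNIV :: 'm set)" "cring R" "module R N"
  obtains P :: "(nat \<Rightarrow> 'r, 'm) module" and h where "bernoulli_copy R N P h"
proof -
  note b = bernoulli_simps[OF assms(2,3)]
  obtain e :: "'m list \<Rightarrow> 'm" where e: "inj e" using list_injection[OF assms(1)] by blast
  define n where "n x = (LEAST n. \<forall>i\<ge>n. x i = \<zero>\<^bsub>N\<^esub>)" for x :: "nat \<Rightarrow> 'm"
  define j where "j x = e (map x [0..<n x])" for x :: "nat \<Rightarrow> 'm"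
  have n: "x i = \<zero>\<^bsub>N\<^esub>" if "x \<in> carrier (direct_power N)" "i \<ge> n x" for x i
  proof -
    have "finite {i. x i \<noteq> \<zero>\<^bsub>N\<^esub>}" using that(1) by (simp add: carrier_direct_power)
    then obtain k where "\<forall>i\<in>{i. x i \<noteq> \<zero>\<^bsub>N\<^esub>}. i < k"
      using finite_nat_set_iff_bounded by blast
    then have "\<forall>i\<ge>k. x i = \<zero>\<^bsub>N\<^esub>" by (metis (mono_tags, lifting) mem_Collect_eq not_le)
    then have "\<forall>i\<ge>n x. x i = \<zero>\<^bsub>N\<^esub>" unfolding n_def by (rule LeastI)
    then show ?thesis using that(2) by blast
  qed
  have inj: "inj_on j (carrier (bernoulli R N))"
    unfolding b(1)
  proof (rule inj_onI, rule ext)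
    fix x y i assume xy: "x \<in> carrier (direct_power N)" "y \<in> carrier (direct_power N)" "j x = j y"
    then have m: "map x [0..<n x] = map y [0..<n y]" using e by (simp add: j_def inj_eq)
    then have l: "n x = n y" by (metis diff_zero length_map length_upt)
    show "x i = y i"
    proof (cases "i < n x")
      case True
      then show ?thesis using m l by simp
    next
      case False
      then show ?thesis using n[OF xy(1), of i] n[OF xy(2), of i] l by simp
    qed
  qed
  obtain P :: "(nat \<Rightarrow> 'r, 'm) module" where P: "module (UP R) P"
      "carrier P = j ` carrier (bernoulli R N)" "j \<in> mod_hom (UP R) (bernoulli R N) P"
  proof (rule module_transfer[OF b(2), of j])
    fix x y x' y'
    assume "x \<in> carrier (bernoulli R N)" "y \<in> carrier (bernoulli R N)"
      "x' \<in> carrier (bernoulli R N)" "y' \<in> carrier (bernoulli R N)" "j x = j x'" "j y = j y'"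
    then show "j (x \<oplus>\<^bsub>bernoulli R N\<^esub> y) = j (x' \<oplus>\<^bsub>bernoulli R N\<^esub> y')"
      using inj_onD[OF inj] by metis
  next
    fix a x x'
    assume "x \<in> carrier (bernoulli R N)" "x' \<in> carrier (bernoulli R N)" "j x = j x'"
    then show "j (a \<odot>\<^bsub>bernoulli R N\<^esub> x) = j (a \<odot>\<^bsub>bernoulli R N\<^esub> x')"
      using inj_onD[OF inj] by metis
  qed
  have j: "bij_betw j (carrier (bernoulli R N)) (carrier P)" using inj P(2) by (simp add: bij_betw_def)
  have "bernoulli_copy R N P (inv_into (carrier (bernoulli R N)) j)"
    by (intro bernoulli_copy.intro assms P(1) mod_hom_inv[OF b(2) P(3) j] bij_betw_inv_into[OF j])
  then show thesis by (rule that)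
qed

text \<open>Finitely many elements of B(N) have only finitely many coordinates altogether. A
  finitely generated submodule thus lies in B(T) for the span \<open>T\<close> of these coordinates,
  which has finite length by \<open>lfin\<close>.\<close>

lemma (in entropy_setting) locally_finite_copy_in_lFin_X:
  fixes P :: "(nat \<Rightarrow> 'r, 'm) module"
  assumes "bernoulli_copy R N P h" and lfin: "\<And>F. F \<in> fg_submodules R N \<Longrightarrow> fin_submodule R L N F"
  shows "P \<in> lFin_X R L"
proof -
  interpret C: bernoulli_copy R N P h by fact
  show ?thesis
  proof (rule lFin_XI[OF C.P_module])
    fix F assume F: "F \<in> fg_submodules R C.U"
    then obtain E where E: "finite E" "F = mod_span R C.U E" "E \<subseteq> carrier P"
      by (auto simp: fg_submodules_def)
    define W where "W = (\<Union>x\<in>E. range (h x))"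
    have "finite (range (h x))" if "x \<in> E" for x
    proof (rule finite_subset)
      show "range (h x) \<subseteq> insert \<zero>\<^bsub>N\<^esub> (h x ` {i. h x i \<noteq> \<zero>\<^bsub>N\<^esub>})" by auto
      show "finite (insert \<zero>\<^bsub>N\<^esub> (h x ` {i. h x i \<noteq> \<zero>\<^bsub>N\<^esub>}))" using C.h_carrier(2)[of x] that E(3) by auto
    qed
    then have W: "finite W" "W \<subseteq> carrier N" using E C.h_carrier(1) by (auto simp: W_def)
    let ?T = "mod_span R N W"
    have T: "submodule ?T R N" by (rule mod_span_submodule[OF C.N_module W(2)])
    have "?T \<in> fg_submodules R N" using T W by (auto simp: fg_submodules_def)
    then have LT: "L (res N ?T) < \<infinity>" using lfin by (simp add: fin_submodule_def)
    interpret T: finite_bernoulli_copy R L "res N ?T" "res P (C.coords_in ?T)" h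
      using C.coords_in_copy[OF T] LT
      by (intro finite_bernoulli_copy.intro finite_bernoulli_copy_axioms.intro entropy_setting_axioms)
    have cs: "submodule (C.coords_in ?T) R C.U"
      using C.coords_in_submodule[OF T] submodule_UP_iff[OF R C.P_module] by blast
    have "E \<subseteq> C.coords_in ?T"
    proof
      fix x assume x: "x \<in> E"
      then have "h x i \<in> W" for i by (auto simp: W_def)
      then have "h x i \<in> ?T" for i using mod_span_upper[of W R N] by blast
      then show "x \<in> C.coords_in ?T" using x E(3) by (auto simp: C.coords_in_def)
    qed
    then have "F \<subseteq> C.coords_in ?T" unfolding E(2) by (rule mod_span_least[OF cs])
    then have "F \<in> fg_submodules R (underlying R (res P (C.coords_in ?T)))"
      using F by (simp add: underlying_res fg_submodules_res[OF C.U_module cs])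
    from lFin_XD(3)[OF T.copy_in_lFin_X this] F show "fin_submodule R L C.U F"
      by (simp add: fin_submodule_def underlying_res fg_submodules_def)
  qed
qed

section \<open>A normalised length function is the entropy\<close>

locale normalised_length = entropy_setting R L
  for R :: "'r ring" and L :: "('r, 'm) module \<Rightarrow> ennreal" +
  fixes LX
  assumes LX: "length_function (UP R) (lFin_X R L) LX" and normalised: "bernoulli_normalised R L LX"
    and infinite: "infinite (UNIV :: 'm set)"
begin

sublocale X: length_fun "UP R" "lFin_X R L" LX
  by (rule length_fun_X[OF LX])

text \<open>
  With \<open>T\<^sub>n\<close> the trajectory of \<open>N\<close>, let \<open>B\<^sub>n\<close> be the submodule \<open>B(T\<^sub>n)\<close> of \<open>B(P)\<close> and \<open>\<delta>\<close> the injective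
  endomorphism \<open>X - B(\<phi>)\<close> of \<open>B(P)\<close>, whose cokernel is \<open>P\<close>. Since \<open>T\<^sub>n\<^sub>+\<^sub>1 = N + \<phi>(T\<^sub>n)\<close>, one has
  \<open>B\<^sub>n\<^sub>+\<^sub>1 = B\<^sub>1 + \<delta>(B\<^sub>n)\<close>. Hence \<open>B\<^sub>1\<close> maps onto \<open>P\<close>, and the kernel is the union of the
  \<open>B\<^sub>1 \<inter> \<delta>(B\<^sub>n)\<close>, whose length is \<open>L(N) - (L(T\<^sub>n\<^sub>+\<^sub>1) - L(T\<^sub>n))\<close>.
\<close>
lemma length_generated:
  assumes P: "P \<in> lFin_X R L" and N: "N \<in> fg_submodules R (underlying R P)"
    and gen: "carrier P = (\<Union>n. trajectory (underlying R P) (X_action R P) N n)"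
  shows "LX P = ennreal (growth L (underlying R P) (X_action R P) N)"
proof -
  let ?V = "underlying R P" and ?\<phi> = "X_action R P"
  note PM = lFin_XD(1)[OF P] and V = lFin_XD(2)[OF P] and phi = X_action_hom[OF R lFin_XD(1)[OF P]]
  have sN: "submodule N R ?V" using N by (simp add: fg_submodules_def)
  interpret V: length_endo R "{M. module R M}" L ?V ?\<phi> by (rule length_endo_X[OF PM])
  have fN: "V.fin N" by (rule lFin_XD(3)[OF P N])
  let ?T = "trajectory ?V ?\<phi> N"
  note T = trajectory_submodule[OF V phi sN]
  note Tup = trajectory_Suc_upper1[OF V phi sN]
  note Tmono = trajectory_incseq[OF V phi sN]
  have T1: "?T 1 = N" by (rule trajectory_1[OF V phi sN])
  obtain B :: "(nat \<Rightarrow> 'r, 'm) module" and h where C: "bernoulli_copy R ?V B h"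
    by (rule bernoulli_copy_exists[OF infinite R V])
  interpret C: bernoulli_copy R ?V B h by (rule C)
  have B: "B \<in> lFin_X R L" by (rule locally_finite_copy_in_lFin_X[OF C lFin_XD(3)[OF P]])
  note BM = C.P_module
  obtain \<psi> where \<psi>: "\<psi> \<in> mod_hom (UP R) B B" "\<And>x i. x \<in> carrier B \<Longrightarrow> h (\<psi> x) i = ?\<phi> (h x i)"
    using C.endo_lift[OF phi] by blast
  have X: "C.X \<in> mod_hom (UP R) B B"
    using C.X_hom mod_hom_UP_iff[OF R BM BM] by blast
  define \<delta> where "\<delta> x = C.X x \<ominus>\<^bsub>B\<^esub> \<psi> x" for x
  have \<delta>: "\<delta> \<in> mod_hom (UP R) B B"
    unfolding \<delta>_def[abs_def] by (rule mod_hom_diff[OF BM BM X \<psi>(1)])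
  interpret PP: module "UP R" P by (rule PM)
  have cl: "C.X x \<in> carrier B" "\<psi> x \<in> carrier B" "\<delta> x \<in> carrier B" if "x \<in> carrier B" for x
    using mod_homD(1)[OF X that] mod_homD(1)[OF \<psi>(1) that] mod_homD(1)[OF \<delta> that] .
  have split: "C.X x = \<psi> x \<oplus>\<^bsub>B\<^esub> \<delta> x" if "x \<in> carrier B" for x
    using cl[OF that] C.UPmod.M.add.m_lcomm[of "\<psi> x" "C.X x" "\<ominus>\<^bsub>B\<^esub> \<psi> x"]
    by (simp add: \<delta>_def a_minus_def C.UPmod.M.r_neg)
  have phi0: "?\<phi> \<zero>\<^bsub>?V\<^esub> = \<zero>\<^bsub>?V\<^esub>" by (rule mod_hom_zero[OF V V phi])

  \<comment> \<open>The vanishing in coordinates from 1 on says that each coordinate of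
    \<open>x\<close> is the \<open>?\<phi>\<close>-image of the next; starting beyond the finite
    support, all of them are zero. Leaving coordinate 0 of \<open>\<delta> x\<close> free also shows
    that the image of \<open>\<delta>\<close> contains no nonzero constant, which makes
    \<open>\<kappa>\<close> injective below.\<close>
  have \<delta>_zero: "x = \<zero>\<^bsub>B\<^esub>" if x: "x \<in> carrier B" and z: "\<And>i. h (\<delta> x) (Suc i) = \<zero>\<^bsub>?V\<^esub>" for x
  proof (rule ccontr)
    assume nz: "x \<noteq> \<zero>\<^bsub>B\<^esub>"
    have rec: "h x i = ?\<phi> (h x (Suc i))" for i
      using arg_cong[OF split[OF x], of "\<lambda>y. h y (Suc i)"] z[of i] cl[OF x] x C.h_carrier(1)[of "\<psi> x"]
      by (simp add: C.h_X_simps C.h_add \<psi>(2))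
    have "\<exists>i. h x i \<noteq> \<zero>\<^bsub>?V\<^esub>" using nz C.h_eqI[OF x C.UPmod.M.zero_closed] C.h_zero by metis
    define S where "S = {i. h x i \<noteq> \<zero>\<^bsub>?V\<^esub>}"
    have S: "finite S" "S \<noteq> {}" using C.h_carrier(2)[OF x] \<open>\<exists>i. _\<close> by (auto simp: S_def)
    have "Suc (Max S) \<notin> S" using Max_ge[OF S(1), of "Suc (Max S)"] by auto
    then have "h x (Max S) = \<zero>\<^bsub>?V\<^esub>" using rec[of "Max S"] phi0 by (simp add: S_def)
    then show False using Max_in[OF S] by (simp add: S_def)
  qed
  have \<delta>_inj: "inj_on \<delta> (carrier B)"
    by (rule mod_hom_injI[OF BM BM \<delta> submodule_carrier[OF BM]]) (auto intro!: \<delta>_zero simp: C.h_zero)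

  \<comment> \<open>The filtration of B(P) by the B(T_n)\<close>
  define Bn where "Bn n = C.coords_in (?T n)" for n
  define D where "D n = \<delta> ` Bn n" for n
  have sB: "submodule (Bn n) (UP R) B" for n unfolding Bn_def by (rule C.coords_in_submodule[OF T])
  have sD: "submodule (D n) (UP R) B" for n unfolding D_def by (rule mod_hom_image_submodule[OF BM BM \<delta> sB])
  have Bc: "Bn n \<subseteq> carrier B" for n by (rule submodule_subset[OF sB])
  have Bup: "Bn n \<subseteq> Bn (Suc n)" for n using Tup by (auto simp: Bn_def C.coords_in_def)
  then have Bmono: "m \<le> n \<Longrightarrow> Bn m \<subseteq> Bn n" for m n using lift_Suc_mono_le[of Bn] by blast
  have Dup: "D n \<subseteq> D (Suc n)" for n using Bup[of n] by (auto simp: D_def)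
  have UB: "(\<Union>n. Bn n) = carrier B"
  proof -
    have "\<exists>n. x \<in> Bn n" if x: "x \<in> carrier B" for x
    proof -
      have "\<exists>n. \<forall>i<k. h x i \<in> ?T n" for k
      proof (induction k)
        case (Suc k)
        then obtain n where n: "\<forall>i<k. h x i \<in> ?T n" by blast
        have "h x k \<in> carrier P" using C.h_carrier(1)[OF x] by simp
        then obtain m where "h x k \<in> ?T m" using gen by auto
        then have "\<forall>i<Suc k. h x i \<in> ?T (max n m)"
          using n Tmono[of n "max n m"] Tmono[of m "max n m"] by (auto simp: less_Suc_eq)
        then show ?case by blast
      qed simp
      moreover obtain k where "x \<in> C.initial k" using C.UN_initial x by blast
      ultimately obtain n where n: "\<forall>i<k. h x i \<in> ?T n" "\<forall>i\<ge>k. h x i = \<zero>\<^bsub>?V\<^esub>"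
        unfolding C.initial_def by blast
      have "h x i \<in> ?T n" for i
        using n submodule_zero[OF V T[of n]] by (cases "i < k") auto
      then show ?thesis using x by (auto simp: Bn_def C.coords_in_def)
    qed
    then show ?thesis using Bc by auto
  qed
  have XB: "C.X ` Bn n \<subseteq> Bn n" for n
    using sB submodule_UP_iff[OF R BM] by blast
  have \<psi>B: "\<psi> ` Bn n \<subseteq> Bn (Suc n)" for n
  proof safe
    fix x assume x: "x \<in> Bn n"
    then have "?\<phi> (h x i) \<in> ?T (Suc n)" for i
      using funpow_image_trajectory[OF V phi sN, of 1 n] by (auto simp: Bn_def C.coords_in_def)
    then show "\<psi> x \<in> Bn (Suc n)" using x Bc[of n] cl(2)[of x] \<psi>(2)[of x] by (auto simp: Bn_def C.coords_in_def)
  qed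
  have Bn_decomp: "\<exists>u\<in>Bn 1. \<exists>w\<in>Bn n. x = u \<oplus>\<^bsub>B\<^esub> \<psi> w" if x: "x \<in> Bn (Suc n)" for x n
  proof -
    have xB: "x \<in> carrier B" "\<And>i. h x i \<in> ?T (Suc n)" using x by (auto simp: Bn_def C.coords_in_def)
    have z: "\<zero>\<^bsub>?V\<^esub> \<in> N" "\<zero>\<^bsub>?V\<^esub> \<in> ?T n" using submodule_zero[OF V] sN T by auto
    \<comment> \<open>The splitting T_(n+1) = N + phi(T_n) is chosen for each coordinate separately.
      Sending zero to the pair of zeros keeps the supports of \<open>u\<close> and \<open>w\<close>
      finite.\<close>
    have "\<exists>p. fst p \<in> N \<and> snd p \<in> ?T n \<and> y = fst p \<oplus>\<^bsub>?V\<^esub> ?\<phi> (snd p) \<and> (y = \<zero>\<^bsub>?V\<^esub> \<longrightarrow> p = (\<zero>\<^bsub>?V\<^esub>, \<zero>\<^bsub>?V\<^esub>))"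
      if y: "y \<in> ?T (Suc n)" for y
    proof (cases "y = \<zero>\<^bsub>?V\<^esub>")
      case True
      then show ?thesis using z phi0 C.N.M.r_zero[OF C.N.M.zero_closed] by (intro exI[of _ "(\<zero>\<^bsub>?V\<^esub>, \<zero>\<^bsub>?V\<^esub>)"]) simp
    next
      case False
      have "y \<in> msum ?V N (?\<phi> ` ?T n)" using trajectory_Suc_shift[OF V phi sN] y by blast
      then show ?thesis using False by (auto simp: msum_def)
    qed
    then obtain p where p: "\<And>y. y \<in> ?T (Suc n) \<Longrightarrow> fst (p y) \<in> N \<and> snd (p y) \<in> ?T n \<and>
        y = fst (p y) \<oplus>\<^bsub>?V\<^esub> ?\<phi> (snd (p y)) \<and> (y = \<zero>\<^bsub>?V\<^esub> \<longrightarrow> p y = (\<zero>\<^bsub>?V\<^esub>, \<zero>\<^bsub>?V\<^esub>))"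
      by metis
    have Nc: "N \<subseteq> carrier ?V" "?T n \<subseteq> carrier ?V" using submodule_subset[OF sN] submodule_subset[OF T] by auto
    have fs: "finite {i. fst (p (h x i)) \<noteq> \<zero>\<^bsub>?V\<^esub>}" "finite {i. snd (p (h x i)) \<noteq> \<zero>\<^bsub>?V\<^esub>}"
      using p[OF xB(2)] by (auto intro!: finite_subset[OF _ C.h_carrier(2)[OF xB(1)]])
    obtain u where u: "u \<in> carrier B" "h u = (\<lambda>i. fst (p (h x i)))"
      using C.h_ex[OF _ fs(1)] p[OF xB(2)] Nc by blast
    obtain w where w: "w \<in> carrier B" "h w = (\<lambda>i. snd (p (h x i)))"
      using C.h_ex[OF _ fs(2)] p[OF xB(2)] Nc by blast
    have "x = u \<oplus>\<^bsub>B\<^esub> \<psi> w"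
    proof (rule C.h_eqI)
      show "h x i = h (u \<oplus>\<^bsub>B\<^esub> \<psi> w) i" for i
        using p[OF xB(2), of i] u w cl(2)[OF w(1)] by (simp add: C.h_add \<psi>(2))
    qed (use xB u w cl in auto)
    moreover have "u \<in> Bn 1" "w \<in> Bn n"
      using u w p[OF xB(2)] by (auto simp: Bn_def C.coords_in_def T1[unfolded One_nat_def])
    ultimately show ?thesis by blast
  qed
  have BD: "Bn (Suc n) = msum B (Bn 1) (D n)" for n
  proof
    have "D n \<subseteq> Bn (Suc n)" for n
    proof
      fix y assume "y \<in> D n"
      then obtain x where x: "x \<in> Bn n" "y = \<delta> x" by (auto simp: D_def)
      have "C.X x \<in> Bn (Suc n)" "\<psi> x \<in> Bn (Suc n)" using XB Bup \<psi>B x(1) by blast+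
      then show "y \<in> Bn (Suc n)"
        unfolding x(2) \<delta>_def a_minus_def using C.UPmod.submoduleE(3,5)[OF sB] by blast
    qed
    then show "msum B (Bn 1) (D n) \<subseteq> Bn (Suc n)"
      using Bmono[of 1 "Suc n"] by (intro msum_least[OF BM sB]) auto
    \<comment> \<open>In the induction step the term \<open>\<psi> w\<close> is rewritten as X w -
      \<open>\<delta> w\<close>: the first part lies in \<open>Bn (Suc n)\<close>, where the
      induction hypothesis applies, the second in \<open>D (Suc n)\<close>.\<close>
    show "Bn (Suc n) \<subseteq> msum B (Bn 1) (D n)"
    proof (induction n)
      case 0
      then show ?case using msum_upper1[OF BM sB[of 1] sD[of 0]] by simp
    next
      case (Suc n)
      show ?case
      proof
        fix x assume "x \<in> Bn (Suc (Suc n))"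
        then obtain u w where uw: "u \<in> Bn 1" "w \<in> Bn (Suc n)" "x = u \<oplus>\<^bsub>B\<^esub> \<psi> w" using Bn_decomp by blast
        let ?Y = "msum B (Bn 1) (D (Suc n))"
        have sY: "submodule ?Y (UP R) B" by (rule submodule_msum[OF BM sB sD])
        have "C.X w \<in> ?Y"
          using XB uw(2) Suc msum_mono[OF order_refl Dup[of n], of B "Bn 1"] by blast
        moreover have "\<delta> w \<in> ?Y"
          using uw(2) subsetD[OF msum_upper2[OF BM sB[of 1] sD[of "Suc n"]]] by (auto simp: D_def)
        moreover have "\<psi> w = C.X w \<oplus>\<^bsub>B\<^esub> \<ominus>\<^bsub>B\<^esub> \<delta> w"
          using split[of w] cl[of w] uw(2) Bc[of "Suc n"] by (simp add: subset_iff C.UPmod.M.a_assoc C.UPmod.M.r_neg)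
        ultimately have "\<psi> w \<in> ?Y" using C.UPmod.submoduleE(3,5)[OF sY] by auto
        moreover have "u \<in> ?Y" using msum_upper1[OF BM sB sD] uw(1) by blast
        ultimately show "x \<in> ?Y" unfolding uw(3) using C.UPmod.submoduleE(5)[OF sY] by blast
      qed
    qed
  qed

  \<comment> \<open>The cokernel of X - B(phi) is P\<close>
  let ?D = "\<delta> ` carrier B"
  have sDD: "submodule ?D (UP R) B" by (rule mod_hom_image_submodule[OF BM BM \<delta> submodule_carrier[OF BM]])
  have UD: "?D = (\<Union>n. D n)" unfolding UB[symmetric] D_def by blast
  obtain Q :: "(nat \<Rightarrow> 'r, 'm) module" and \<pi> where Q: "module (UP R) Q" "\<pi> \<in> mod_hom (UP R) B Q"
    "\<pi> ` carrier B = carrier Q" "{x \<in> carrier B. \<pi> x = \<zero>\<^bsub>Q\<^esub>} = ?D"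
    using quotient_exists[OF BM sDD] by blast
  interpret Q: module "UP R" Q by (rule Q)
  have QC: "Q \<in> lFin_X R L" by (rule lFin_X_image[OF B Q(1-3)])
  have \<pi>\<delta>: "\<pi> (\<delta> x) = \<zero>\<^bsub>Q\<^esub>" if "x \<in> carrier B" for x using Q(4) that by blast
  have \<pi>X: "\<pi> (C.X x) = \<pi> (\<psi> x)" if "x \<in> carrier B" for x
    using split[OF that] cl[OF that] mod_homD[OF Q(2)] \<pi>\<delta>[OF that] by simp
  obtain \<iota> where \<iota>: "\<iota> \<in> mod_hom R ?V C.U" "\<And>c. c \<in> carrier ?V \<Longrightarrow> h (\<iota> c) 0 = c"
    "\<And>c i. c \<in> carrier ?V \<Longrightarrow> h (\<iota> c) (Suc i) = \<zero>\<^bsub>?V\<^esub>"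
    using C.const_lift by blast
  have \<iota>c: "\<iota> c \<in> carrier B" if "c \<in> carrier P" for c using mod_homD(1)[OF \<iota>(1), of c] that by simp
  \<comment> \<open>\<open>\<kappa>\<close> embeds \<open>P\<close> as the constants and reduces
    modulo \<open>?D\<close>. It is equivariant because X and \<open>\<psi>\<close> agree modulo
    \<open>?D\<close>, and \<open>\<psi>\<close> acts on constants as
    \<open>?\<phi>\<close>.\<close>
  define \<kappa> where "\<kappa> c = \<pi> (\<iota> c)" for c
  have \<pi>': "\<pi> \<in> mod_hom R C.U (underlying R Q)" "\<And>x. x \<in> carrier B \<Longrightarrow> \<pi> (C.X x) = X_action R Q (\<pi> x)"
    using Q(2) mod_hom_UP_iff[OF R BM Q(1)] by auto
  have \<iota>\<phi>: "\<iota> (?\<phi> c) = \<psi> (\<iota> c)" if c: "c \<in> carrier P" for c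
  proof (rule C.h_eqI)
    have c': "?\<phi> c \<in> carrier ?V" "c \<in> carrier ?V" using mod_homD(1)[OF phi, of c] c by simp_all
    show "\<iota> (?\<phi> c) \<in> carrier B" "\<psi> (\<iota> c) \<in> carrier B" using \<iota>c c c' cl by auto
    show "h (\<iota> (?\<phi> c)) i = h (\<psi> (\<iota> c)) i" for i
      using \<iota>(2,3)[OF c'(1)] \<iota>(2,3)[OF c'(2)] \<psi>(2)[OF \<iota>c[OF c]] phi0 by (cases i) auto
  qed
  have "\<kappa> \<in> mod_hom (UP R) P Q"
    unfolding mod_hom_UP_iff[OF R PM Q(1)]
  proof
    show "\<kappa> \<in> mod_hom R ?V (underlying R Q)"
      unfolding \<kappa>_def[abs_def] by (rule mod_hom_comp[OF \<iota>(1) \<pi>'(1)])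
    show "\<forall>c\<in>carrier P. \<kappa> (?\<phi> c) = X_action R Q (\<kappa> c)"
    proof
      fix c assume c: "c \<in> carrier P"
      have "\<kappa> (?\<phi> c) = \<pi> (C.X (\<iota> c))" unfolding \<kappa>_def \<iota>\<phi>[OF c] \<pi>X[OF \<iota>c[OF c]] ..
      also have "\<dots> = X_action R Q (\<kappa> c)" unfolding \<kappa>_def by (rule \<pi>'(2)[OF \<iota>c[OF c]])
      finally show "\<kappa> (?\<phi> c) = X_action R Q (\<kappa> c)" .
    qed
  qed
  moreover have "inj_on \<kappa> (carrier P)"
  proof (rule mod_hom_injI[OF PM Q(1) \<open>\<kappa> \<in> _\<close> submodule_carrier[OF PM]])
    fix c assume c: "c \<in> carrier P" "\<kappa> c = \<zero>\<^bsub>Q\<^esub>"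
    then obtain b where b: "b \<in> carrier B" "\<iota> c = \<delta> b" using Q(4) \<iota>c by (auto simp: \<kappa>_def)
    have "h (\<delta> b) (Suc i) = \<zero>\<^bsub>?V\<^esub>" for i using \<iota>(3)[of c i] c(1) unfolding b(2) by simp
    then have "b = \<zero>\<^bsub>B\<^esub>" by (rule \<delta>_zero[OF b(1)])
    then have "\<iota> c = \<zero>\<^bsub>B\<^esub>" using b(2) mod_hom_zero[OF BM BM \<delta>] by simp
    then show "c = \<zero>\<^bsub>P\<^esub>" using \<iota>(2)[of c] c(1) C.h_zero by simp
  qed
  moreover have "\<kappa> ` carrier P = carrier Q"
  proof
    show "\<kappa> ` carrier P \<subseteq> carrier Q" using mod_homD(1)[OF \<open>\<kappa> \<in> _\<close>] by blast
    \<comment> \<open>Horner evaluation at \<open>?\<phi>\<close>: writing x = c + X y, the class of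
      X y equals that of \<open>\<psi> y\<close>, which has the same degree bound as
      \<open>y\<close>.\<close>
    have "\<pi> x \<in> \<kappa> ` carrier P" if "x \<in> C.initial n" for x n
      using that
    proof (induction n arbitrary: x)
      case 0
      then have "x = \<zero>\<^bsub>B\<^esub>" by (auto simp: C.initial_def C.h_zero intro: C.h_eqI)
      then have "\<pi> x = \<kappa> \<zero>\<^bsub>P\<^esub>"
        using mod_hom_zero[OF BM Q(1,2)] mod_hom_zero[OF PM Q(1) \<open>\<kappa> \<in> _\<close>] by simp
      then show ?case using C.N.M.zero_closed by simp
    next
      case (Suc n)
      then obtain c y where c: "c \<in> C.initial 1" "y \<in> C.initial n" "x = c \<oplus>\<^bsub>B\<^esub> C.X y" "h c 0 = h x 0"
        using C.initial_decomp by metis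
      have cB: "c \<in> carrier B" "y \<in> carrier B" using c by (auto simp: C.initial_def)
      have hc: "h c 0 \<in> carrier P" using C.h_carrier(1)[OF cB(1)] by simp
      have "c = \<iota> (h c 0)"
      proof (rule C.h_eqI)
        show "h c i = h (\<iota> (h c 0)) i" for i
          using c(1) \<iota>(2,3)[of "h c 0"] hc by (cases i) (auto simp: C.initial_def)
      qed (use cB \<iota>c[OF hc] in auto)
      then have 1: "\<pi> c = \<kappa> (h c 0)" by (simp add: \<kappa>_def)
      have "\<psi> y \<in> C.initial n" using c(2) \<psi>(2)[OF cB(2)] cl(2)[OF cB(2)] phi0 by (simp add: C.initial_def)
      then obtain d where d: "d \<in> carrier P" "\<pi> (\<psi> y) = \<kappa> d" using Suc.IH by blast
      have "\<pi> x = \<kappa> (h c 0) \<oplus>\<^bsub>Q\<^esub> \<kappa> d"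
        unfolding c(3) using mod_homD(2)[OF Q(2) cB(1) cl(1)[OF cB(2)]] 1 \<pi>X[OF cB(2)] d(2) by simp
      also have "\<dots> = \<kappa> (h c 0 \<oplus>\<^bsub>P\<^esub> d)" using mod_homD(2)[OF \<open>\<kappa> \<in> _\<close> hc d(1)] by simp
      finally show ?case using C.N.M.a_closed[of "h c 0" d] hc d(1) by simp
    qed
    then show "carrier Q \<subseteq> \<kappa> ` carrier P" unfolding Q(3)[symmetric] using C.UN_initial by blast
  qed
  ultimately have "mod_isomorphic (UP R) P Q" by (auto simp: mod_isomorphic_def bij_betw_def)
  then have PQ: "LX P = LX Q" by (rule length_functionD(2)[OF LX P QC])

  \<comment> \<open>Lengths in the filtration\<close>
  have fT: "V.fin (?T n)" for n by (rule V.fin_trajectory[OF fN])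
  \<comment> \<open>The normalisation enters here: \<open>Bn n\<close> is a copy of B(T_n), and T_n
    has finite length even if P has not.\<close>
  have LB: "LX (res B (Bn n)) = ennreal (V.rl (?T n))" for n
  proof -
    interpret Bn: bernoulli_copy R "res ?V (?T n)" "res B (C.coords_in (?T n))" h
      by (rule C.coords_in_copy[OF T])
    have "mod_isomorphic (UP R) (res B (Bn n)) (bernoulli R (res ?V (?T n)))"
      using Bn.h Bn.bij by (auto simp: mod_isomorphic_def Bn_def)
    then have "LX (res B (Bn n)) = L (res ?V (?T n))"
      using normalised Bn.P_module Bn.N_module fT
      by (auto simp: bernoulli_normalised_def fin_submodule_def Bn_def)
    then show ?thesis using ennreal_rlen[OF fT] by simp
  qed
  have LD: "LX (res B (D n)) = ennreal (V.rl (?T n))" for n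
    unfolding D_def using X.len_inj[OF B BM \<delta> sB inj_on_subset[OF \<delta>_inj Bc]] LB by simp
  define d where "d n = V.rl (?T (Suc n)) - V.rl (?T n)" for n
  let ?e = "growth L ?V ?\<phi> N"
  have e: "d \<longlonglongrightarrow> ?e" "?e \<le> d n" "decseq d" "0 \<le> ?e" for n
    using V.growth_limits[OF fN] by (auto simp: d_def[abs_def])
  \<comment> \<open>T_0 is zero and T_1 is N, so the first and largest increment is the length of N.
    Hence the difference \<open>V.rl N - ?e\<close> is nonnegative and not truncated by
    \<open>ennreal\<close>.\<close>
  have d_le: "d n \<le> V.rl N" for n
  proof -
    have "V.rl (?T 0) = 0" using len_zero[OF V.M_in] by (simp add: rlen_def trajectory_0[OF V])
    then show ?thesis using decseqD[OF e(3), of 0 n] T1 by (simp add: d_def)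
  qed
  \<comment> \<open>Modularity for \<open>Bn 1\<close> and \<open>D n\<close>, whose sum is
    \<open>Bn (Suc n)\<close> by \<open>BD\<close>; the three known lengths are those of T_1, T_n
    and T_(n+1).\<close>
  have LK: "LX (res B (Bn 1 \<inter> D n)) = ennreal (V.rl N - d n)" for n
  proof -
    have fB: "fin_submodule (UP R) LX B (Bn k)" "rlen LX B (Bn k) = V.rl (?T k)" for k
      using sB LB by (auto simp: fin_submodule_def rlen_def rlen_nonneg)
    have fD: "fin_submodule (UP R) LX B (D k)" "rlen LX B (D k) = V.rl (?T k)" for k
      using sD LD by (auto simp: fin_submodule_def rlen_def rlen_nonneg)
    have "rlen LX B (Bn (Suc n)) + rlen LX B (Bn 1 \<inter> D n) = rlen LX B (Bn 1) + rlen LX B (D n)"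
      unfolding BD by (rule X.rlen_modular[OF B fB(1) fD(1)])
    then have "rlen LX B (Bn 1 \<inter> D n) = V.rl N - d n" using fB(2) fD(2) T1 by (simp add: d_def)
    moreover have "fin_submodule (UP R) LX B (Bn 1 \<inter> D n)"
      using X.fin_mono[OF B fB(1) submodule_Int[OF BM sB sD]] by blast
    ultimately show ?thesis using ennreal_rlen by metis
  qed
  have LKer: "LX (res B (Bn 1 \<inter> ?D)) = ennreal (V.rl N - ?e)"
  proof -
    have "Bn 1 \<inter> D n \<subseteq> Bn 1 \<inter> D (Suc n)" for n using Dup[of n] by blast
    then have "LX (res B (\<Union>n. Bn 1 \<inter> D n)) = (SUP n. LX (res B (Bn 1 \<inter> D n)))"
      by (rule X.len_UN[OF B submodule_Int[OF BM sB sD]])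
    moreover have "Bn 1 \<inter> ?D = (\<Union>n. Bn 1 \<inter> D n)" using UD by blast
    ultimately have "LX (res B (Bn 1 \<inter> ?D)) = (SUP n. LX (res B (Bn 1 \<inter> D n)))" by simp
    also have "\<dots> = (SUP n. ennreal (V.rl N - d n))" by (simp only: LK)
    \<comment> \<open>As \<open>d\<close> decreases, the sequence increases, so its supremum is also
      its limit.\<close>
    also have "\<dots> = ennreal (V.rl N - ?e)"
    proof (rule LIMSEQ_unique)
      show "(\<lambda>n. ennreal (V.rl N - d n)) \<longlonglongrightarrow> (SUP n. ennreal (V.rl N - d n))"
        by (rule LIMSEQ_SUP) (use e(3) in \<open>auto simp: incseq_def decseq_def intro!: ennreal_leI\<close>)
      show "(\<lambda>n. ennreal (V.rl N - d n)) \<longlonglongrightarrow> ennreal (V.rl N - ?e)"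
        by (intro tendsto_ennrealI tendsto_diff tendsto_const e(1))
    qed
    finally show ?thesis .
  qed
  have "\<pi> ` Bn 1 = carrier Q"
  proof
    show "\<pi> ` Bn 1 \<subseteq> carrier Q" using Bc Q(3) by blast
    \<comment> \<open>By \<open>BD\<close> every element of \<open>Bn (Suc n)\<close> differs from
      one of \<open>Bn 1\<close> by an element of \<open>D n\<close>, which \<open>\<pi>\<close>
      kills.\<close>
    have "\<pi> ` Bn (Suc n) \<subseteq> \<pi> ` Bn 1" for n
    proof
      fix y assume "y \<in> \<pi> ` Bn (Suc n)"
      then obtain u x where "u \<in> Bn 1" "x \<in> Bn n" "y = \<pi> (u \<oplus>\<^bsub>B\<^esub> \<delta> x)"
        unfolding BD by (auto simp: msum_def D_def)
      moreover from this have "\<pi> (u \<oplus>\<^bsub>B\<^esub> \<delta> x) = \<pi> u"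
        using Bc mod_homD(1,2)[OF Q(2)] \<pi>\<delta>[of x] cl(3)[of x] by (simp add: subset_iff)
      ultimately show "y \<in> \<pi> ` Bn 1" by simp
    qed
    then have "\<pi> ` Bn n \<subseteq> \<pi> ` Bn 1" for n using Bup[of n] by blast
    then show "carrier Q \<subseteq> \<pi> ` Bn 1" unfolding Q(3)[symmetric] UB[symmetric] by blast
  qed
  moreover have "{x \<in> Bn 1. \<pi> x = \<zero>\<^bsub>Q\<^esub>} = Bn 1 \<inter> ?D" using Q(4) Bc[of 1] by blast
  moreover have "res Q (carrier Q) = Q" by simp
  ultimately have "LX (res B (Bn 1)) = LX (res B (Bn 1 \<inter> ?D)) + LX Q"
    using X.len_hom[OF B Q(1,2) sB, of 1] by simp
  \<comment> \<open>The kernel has finite length, so it can be cancelled and \<open>LX Q\<close> is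
    determined.\<close>
  then have "ennreal (V.rl N) = ennreal (V.rl N - ?e) + LX Q" using LB[of 1] LKer T1 by simp
  moreover have "ennreal (V.rl N) = ennreal (V.rl N - ?e) + ennreal ?e"
    using e(2)[of 0] d_le[of 0] e(4) by (simp flip: ennreal_plus)
  ultimately have "LX Q = ennreal ?e" by (simp add: ennreal_add_left_cancel)
  then show ?thesis using PQ by simp
qed

text \<open>Both sides are suprema: \<open>LX\<close> over finitely generated R[X]-submodules, the
  entropy over finitely generated R-submodules. \<open>length_generated\<close> matches the terms,
  an R-submodule corresponding to the union of its trajectories.\<close>

lemma eq_ent_X:
  assumes P: "P \<in> lFin_X R L"
  shows "LX P = ent_X R L P"
proof -
  let ?V = "underlying R P" and ?\<phi> = "X_action R P"
  note PM = lFin_XD(1)[OF P] and V = lFin_XD(2)[OF P] and phi = X_action_hom[OF R lFin_XD(1)[OF P]]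
  interpret V: length_endo R "{M. module R M}" L ?V ?\<phi> by (rule length_endo_X[OF PM])
  \<comment> \<open>\<open>length_generated\<close> is applied inside \<open>G\<close>. The
    inclusion of \<open>G\<close> into \<open>P\<close> is injective and equivariant, so the growth
    of \<open>N\<close> is the same in both modules.\<close>
  have gr: "LX (res P G) = ennreal (growth L ?V ?\<phi> N)"
    if N: "N \<in> fg_submodules R ?V" and G: "submodule G (UP R) P" "G = (\<Union>n. trajectory ?V ?\<phi> N n)" for N G
  proof -
    have GP: "res P G \<in> lFin_X R L" by (rule lFin_X_res[OF P G(1)])
    note GM = lFin_XD[OF GP]
    have "(\<lambda>x. x) \<in> mod_hom (UP R) (res P G) P"
      using submodule_subset[OF G(1)] by (auto simp: mod_hom_def)
    then interpret i: length_endo_hom R "{M. module R M}" L "underlying R (res P G)" "X_action R (res P G)"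
        ?V ?\<phi> "\<lambda>x. x"
      by (rule length_endo_hom_X[OF GM(1) PM])
    have sG: "submodule G R ?V" using G(1) submodule_UP_iff[OF R PM] by blast
    have sN: "submodule N R ?V" using N by (simp add: fg_submodules_def)
    have NG: "N \<subseteq> G" unfolding G(2) using trajectory_1[OF V phi sN] by blast
    have N': "N \<in> fg_submodules R (underlying R (res P G))"
      using N NG by (simp add: underlying_res fg_submodules_res[OF V sG])
    then have sN': "submodule N R (underlying R (res P G))" by (simp add: fg_submodules_def)
    have "carrier (res P G) = (\<Union>n. trajectory (underlying R (res P G)) (X_action R (res P G)) N n)"
      using i.trajectory_g[OF sN'] by (simp add: G(2))
    then have "LX (res P G) = ennreal (growth L (underlying R (res P G)) (X_action R (res P G)) N)"
      by (rule length_generated[OF GP N'])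
    also have "\<dots> = ennreal (growth L ?V ?\<phi> N)"
      using i.growth_inj[OF _ GM(3)[OF N']] by simp
    finally show ?thesis .
  qed
  show ?thesis
    unfolding ent_X_eq[OF PM] V.entropy_on_fg
  proof (rule antisym)
    show "LX P \<le> (SUP F\<in>{F \<in> fg_submodules R ?V. V.fin F \<and> F \<subseteq> carrier P}. ennreal (growth L ?V ?\<phi> F))"
      unfolding length_functionD(4)[OF LX P]
    proof (rule SUP_least)
      fix G assume G: "G \<in> fg_submodules (UP R) P"
      then obtain E where E: "finite E" "G = mod_span (UP R) P E" "E \<subseteq> carrier P" "submodule G (UP R) P"
        by (auto simp: fg_submodules_def)
      let ?N = "mod_span R ?V E"
      have sN: "submodule ?N R ?V" using mod_span_submodule[OF V] E(3) by simp
      have N: "?N \<in> fg_submodules R ?V" using sN E(1,3) by (auto simp: fg_submodules_def)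
      obtain G' where G': "G' \<in> fg_submodules (UP R) P" "?N \<subseteq> G'" "G' = (\<Union>n. trajectory ?V ?\<phi> ?N n)"
        using fg_submodules_UP[OF PM N] by blast
      have sG': "submodule G' (UP R) P" using G'(1) by (simp add: fg_submodules_def)
      have "G = G'"
      proof
        \<comment> \<open>The R[X]-span of \<open>E\<close> and the union of the trajectories of its
          R-span are the same submodule.\<close>
        show "G \<subseteq> G'" unfolding E(2)
          using mod_span_upper[of E R ?V] G'(2) by (intro mod_span_least[OF sG']) auto
        have G1: "submodule G R ?V" "?\<phi> ` G \<subseteq> G" using E(4) submodule_UP_iff[OF R PM] by auto
        have "E \<subseteq> G" using mod_span_upper[of E "UP R" P] E(2) by simp
        then show "G' \<subseteq> G" unfolding G'(3)
          by (intro UN_least trajectory_least[OF V phi sN G1(1) _ G1(2)] mod_span_least[OF G1(1)])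
      qed
      then have "LX (res P G) = ennreal (growth L ?V ?\<phi> ?N)" using gr[OF N E(4)] G'(3) by simp
      also have "\<dots> \<le> (SUP F\<in>{F \<in> fg_submodules R ?V. V.fin F \<and> F \<subseteq> carrier P}. ennreal (growth L ?V ?\<phi> F))"
        using N lFin_XD(3)[OF P N] submodule_subset[OF sN] by (intro SUP_upper) simp
      finally show "LX (res P G) \<le> \<dots>" .
    qed
    show "(SUP F\<in>{F \<in> fg_submodules R ?V. V.fin F \<and> F \<subseteq> carrier P}. ennreal (growth L ?V ?\<phi> F)) \<le> LX P"
    proof (rule SUP_least)
      fix N assume N: "N \<in> {F \<in> fg_submodules R ?V. V.fin F \<and> F \<subseteq> carrier P}"
      then obtain G where G: "G \<in> fg_submodules (UP R) P" "G = (\<Union>n. trajectory ?V ?\<phi> N n)"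
        using fg_submodules_UP[OF PM, of N] by blast
      then have "ennreal (growth L ?V ?\<phi> N) = LX (res P G)"
        using gr[of N G] N by (simp add: fg_submodules_def)
      also have "\<dots> \<le> LX P" unfolding length_functionD(4)[OF LX P] using G(1) by (rule SUP_upper)
      finally show "ennreal (growth L ?V ?\<phi> N) \<le> LX P" .
    qed
  qed
qed

end

section \<open>Valuation domains\<close>

context nondiscrete_archimedean_valuation_domain
begin

lemma cring_R: "cring R"
proof -
  \<comment> \<open>Twice the value of -1 is the value of 1, which is 0; this yields closure of the
    valuation ring under negation.\<close>
  have v_minus_one: "0 \<le> v (\<ominus>\<^bsub>Q\<^esub> \<one>\<^bsub>Q\<^esub>)"
  proof -
    have "v (\<ominus>\<^bsub>Q\<^esub> \<one>\<^bsub>Q\<^esub>) + v (\<ominus>\<^bsub>Q\<^esub> \<one>\<^bsub>Q\<^esub>) = 0"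
      using v_mult[of "\<ominus>\<^bsub>Q\<^esub> \<one>\<^bsub>Q\<^esub>" "\<ominus>\<^bsub>Q\<^esub> \<one>\<^bsub>Q\<^esub>"] v_one by (simp add: l_minus)
    then show ?thesis by (cases "v (\<ominus>\<^bsub>Q\<^esub> \<one>\<^bsub>Q\<^esub>)") auto
  qed
  have "subring {a \<in> carrier Q. 0 \<le> v a} Q"
  proof (rule subringI)
    fix a assume a: "a \<in> {a \<in> carrier Q. 0 \<le> v a}"
    have "v (\<ominus>\<^bsub>Q\<^esub> a) = v (\<ominus>\<^bsub>Q\<^esub> \<one>\<^bsub>Q\<^esub>) + v a"
      using v_mult[of "\<ominus>\<^bsub>Q\<^esub> \<one>\<^bsub>Q\<^esub>" a] a by (simp add: l_minus)
    then show "\<ominus>\<^bsub>Q\<^esub> a \<in> {a \<in> carrier Q. 0 \<le> v a}" using a v_minus_one by simp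
  next
    fix a b assume ab: "a \<in> {a \<in> carrier Q. 0 \<le> v a}" "b \<in> {a \<in> carrier Q. 0 \<le> v a}"
    show "a \<otimes>\<^bsub>Q\<^esub> b \<in> {a \<in> carrier Q. 0 \<le> v a}" using ab v_mult by simp
    show "a \<oplus>\<^bsub>Q\<^esub> b \<in> {a \<in> carrier Q. 0 \<le> v a}"
      using ab v_add[of a b] by (auto intro: order_trans[rotated])
  qed (auto simp: v_one)
  then have "domain R" unfolding R_eq by (rule subring_is_domain)
  then show ?thesis by (simp add: domain_def)
qed

text \<open>A finite ring would have a least positive value, against the density of the value group
  near 0.\<close>

lemma infinite_R: "infinite (carrier R)"
proof
  assume fin: "finite (carrier R)"
  define A where "A = {x \<in> v ` carrier R. 0 < x}"
  have small: "\<exists>x\<in>A. x < ereal t" if t: "0 < t" for t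
  proof -
    obtain a where "a \<in> carrier Q" "0 < v a" "v a < ereal t"
      using value_group_dense[OF t] by (auto simp: zero_ereal_def)
    then show ?thesis by (intro bexI[of _ "v a"]) (auto simp: A_def R_eq)
  qed
  have A: "finite A" "A \<noteq> {}" using fin small[of 1] by (auto simp: A_def)
  \<comment> \<open>\<open>A\<close> contains infinity, the value of 0, so its minimum is first
    bounded by 1 to make it a real number, to which \<open>small\<close> applies.\<close>
  obtain x where "x \<in> A" "x < ereal 1" using small[of 1] by auto
  then have "Min A < ereal 1" using A Min_le order.strict_trans1 by blast
  moreover have "0 < Min A" using Min_in[OF A] by (simp add: A_def)
  ultimately obtain r where r: "Min A = ereal r" "0 < r" by (cases "Min A") auto
  then obtain y where "y \<in> A" "y < Min A" using small[of r] by auto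
  then show False using Min_le[OF A(1)] by (simp add: not_le[symmetric])
qed

end

text \<open>The supremum involves values at submodules of \<open>M\<close>; these stay in
  \<open>C\<close>, where the two functions agree.\<close>

lemma length_function_cong:
  assumes "length_fun S C len" "\<And>M. M \<in> C \<Longrightarrow> len' M = len M"
  shows "length_function S C len'"
proof -
  interpret length_fun S C len by fact
  have "len' (res M F) = len (res M F)" if "M \<in> C" "F \<in> fg_submodules S M" for M F
    using that C_sub assms(2) by (simp add: fg_submodules_def)
  then show ?thesis
    unfolding length_function_def using assms(2) length_functionD[OF len] by (simp cong: SUP_cong)
qed

text \<open>Functions in HOL are total, so uniqueness is stated among functions with a fixed default
  outside \<open>lFin_X R L\<close>; the second conjunct compares arbitrary ones on
  \<open>lFin_X R L\<close> only.\<close>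

theorem theorem7p3:
  fixes R Q :: "'r ring"
    and v :: "'r \<Rightarrow> ereal"
    and L :: "('r, 'm) module \<Rightarrow> ennreal"
  assumes "nondiscrete_archimedean_valuation_domain R Q v"
    and "carrier R \<lesssim> (UNIV :: 'm set)"
    and "induced_length R v L"
  shows "(\<exists>!LX. LX \<in> extensional (lFin_X R L) \<and>
            length_function (UP R) (lFin_X R L) LX \<and> bernoulli_normalised R L LX) \<and>
         (\<forall>LX. length_function (UP R) (lFin_X R L) LX \<and> bernoulli_normalised R L LX \<longrightarrow>
            (\<forall>P \<in> lFin_X R L. LX P = ent_X R L P))"
proof -
  interpret D: nondiscrete_archimedean_valuation_domain R Q v by (rule assms(1))
  interpret entropy_setting R L
    using assms(3) D.cring_R by (simp add: entropy_setting_def induced_length_def)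
  \<comment> \<open>The infinite ring embeds into \<open>'m\<close>, so there is room for the copies
    of B(N) used for uniqueness.\<close>
  have inf: "infinite (UNIV :: 'm set)"
    using assms(2) D.infinite_R inj_on_finite by (auto simp: lepoll_def)
  have uniq: "LX P = ent_X R L P"
    if "length_function (UP R) (lFin_X R L) LX" "bernoulli_normalised R L LX" "P \<in> lFin_X R L" for LX P
  proof -
    interpret normalised_length R L LX
      by (intro normalised_length.intro normalised_length_axioms.intro entropy_setting_axioms that inf)
    show ?thesis by (rule eq_ent_X[OF that(3)])
  qed
  define E where "E = restrict (ent_X R L) (lFin_X R L)"
  have "length_function (UP R) (lFin_X R L) E"
    by (rule length_function_cong[OF length_fun_X[OF ent_X_length_function]]) (simp add: E_def)
  moreover have "bernoulli_normalised R L E"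
    unfolding bernoulli_normalised_def
  proof (intro allI impI)
    fix N :: "('r, 'm) module" and P :: "(nat \<Rightarrow> 'r, 'm) module"
    assume a: "module R N \<and> L N < \<infinity> \<and> module (UP R) P \<and> mod_isomorphic (UP R) P (bernoulli R N)"
    then obtain h where "bernoulli_copy R N P h"
      using R by (auto simp: mod_isomorphic_def bernoulli_copy_def)
    with a interpret finite_bernoulli_copy R L N P h
      by (intro finite_bernoulli_copy.intro finite_bernoulli_copy_axioms.intro entropy_setting_axioms) auto
    show "E P = L N" using copy_in_lFin_X ent_X_copy by (simp add: E_def)
  qed
  moreover have "LX = E"
    if "LX \<in> extensional (lFin_X R L)" "length_function (UP R) (lFin_X R L) LX"
      "bernoulli_normalised R L LX" for LX
    by (rule extensionalityI[OF that(1)]) (simp_all add: E_def uniq[OF that(2,3)])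
  moreover have "E \<in> extensional (lFin_X R L)" by (simp add: E_def)
  ultimately have "\<exists>!LX. LX \<in> extensional (lFin_X R L) \<and>
      length_function (UP R) (lFin_X R L) LX \<and> bernoulli_normalised R L LX"
    by (intro ex1I[of _ E]) blast+
  then show ?thesis using uniq by blast
qed

end
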